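(* For any $v\in\mathbb Z_{\ge0}$ we have $$\mathrm{Var}\bigl(\mathrm{Ann}_{\mathrm U(\mathfrak{sp}_\infty)}(\mathbf S^\cdot(V_\infty\otimes\mathbb F^v)\otimes V_{\mathbb W})\bigr)=\mathfrak{sp}_\infty^{\le 2v+1}.$$
   Context: The base field $\mathbb F$ is algebraically closed of characteristic zero. $\mathfrak{sp}_\infty=\bigcup_n\mathfrak g_n$ with $\mathfrak g_n=\mathfrak{sp}_{2n}=\mathfrak{sp}(V_n)$ under the standard inclusions (so $V_{n+1}|_{\mathfrak g_n}$ is $V_n$ plus a trivial module), and $V_\infty=\varinjlim V_n$ is the natural $\mathfrak{sp}_\infty$-module; $\mathbf S^\cdot(V_\infty\otimes\mathbb F^v)$ is its symmetric algebra with $\mathfrak{sp}_\infty$ acting on the factor $V_\infty$. Let $\mathbb W_\infty$ be the Weyl algebra generated by $x_1,x_2,\dots,\partial_{x_1},\partial_{x_2},\dots$ with relations $[x_i,x_j]=[\partial_{x_i},\partial_{x_j}]=0$, $[\partial_{x_i},x_j]=\delta_{ij}$. The span $\tilde{\mathfrak s}$ of $1$, $x_ix_j$, $x_i\partial_{x_j}$, $\partial_{x_i}\partial_{x_j}$ (all $i,j$) is a Lie subalgebra under the commutator, and its derived subalgebra $[\tilde{\mathfrak s},\tilde{\mathfrak s}]$ is isomorphic to $\mathfrak{sp}_\infty$, with $\mathfrak{sp}_{2n}$ realized using the variables $x_1,\dots,x_n$. $V_{\mathbb W}$ denotes $\mathbb F[x_1,x_2,\dots]$ with the resulting $\mathfrak{sp}_\infty$-module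 structure. For an ideal $I\subset\mathrm U(\mathfrak{sp}_\infty)$, $\mathrm{gr}\,I\subset\mathbf S^\cdot(\mathfrak{sp}_\infty)$ is the associated graded ideal for the degree filtration and $\mathrm{Var}(I)\subset\mathfrak{sp}_\infty^*=\varprojlim\mathfrak g_n^*$ is its set of common zeros. For $r\in\mathbb Z_{\ge0}$, $\mathfrak g_n^{\le r}:=\{X\in\mathfrak g_n\mid\exists\lambda\in\mathbb F:\ \operatorname{rk}(X-\lambda\,\mathrm{Id}_{V_n})\le r\}$, regarded as a subset of $\mathfrak g_n^*$ via compatible identifications $\mathfrak g_n\cong\mathfrak g_n^*$ (e.g. by the trace form of $V_n$), and $\mathfrak{sp}_\infty^{\le r}:=\varprojlim\mathfrak g_n^{\le r}\subset\mathfrak{sp}_\infty^*$. *)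

theory Defs
  imports
    "HOL-Algebra.QuotRing"
    "HOL-Library.Poly_Mapping"
    "HOL-Library.FuncSet"
    "HOL-Computational_Algebra.Polynomial"
begin

section \<open>Free vector spaces\<close>

abbreviation keys where "keys \<equiv> Poly_Mapping.keys"
abbreviation lookup where "lookup \<equiv> Poly_Mapping.lookup"

text \<open>
  The type \<open>'b \<Rightarrow>\<^sub>0 'a\<close> is the \<open>'a\<close>-vector space with basis \<open>'b\<close>; all vector spaces below are
  subspaces of such spaces. \<open>lin_ext f\<close> is the linear map with the values \<open>f\<close> on the basis.
\<close>

definition scale :: "'a::field \<Rightarrow> ('b \<Rightarrow>\<^sub>0 'a) \<Rightarrow> ('b \<Rightarrow>\<^sub>0 'a)" where
  "scale c p = Poly_Mapping.map ((*) c) p"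

definition lin_ext :: "('b \<Rightarrow> ('c \<Rightarrow>\<^sub>0 'a)) \<Rightarrow> ('b \<Rightarrow>\<^sub>0 'a::field) \<Rightarrow> ('c \<Rightarrow>\<^sub>0 'a)" where
  "lin_ext f p = (\<Sum>b\<in>keys p. scale (lookup p b) (f b))"

lemma lookup_scale [simp]: "lookup (scale c p) k = c * lookup p k"
  by (simp add: scale_def Poly_Mapping.map.rep_eq when_def)

lemma vector_space_scale: "vector_space scale"
  by unfold_locales (auto intro!: poly_mapping_eqI simp: lookup_add algebra_simps)

lemma scale_zero [simp]: "scale 0 p = 0" "scale c 0 = 0"
  and scale_add: "scale c (p + q) = scale c p + scale c q"
  and scale_diff: "scale c (p - q) = scale c p - scale c q"
  and scale_minus: "scale c (- p) = - scale c p"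
  and scale_add_left: "scale (c + d) p = scale c p + scale d p"
  and scale_scale [simp]: "scale c (scale d p) = scale (c * d) p"
  and scale_one [simp]: "scale 1 p = p"
  by (auto intro!: poly_mapping_eqI simp: lookup_add lookup_minus algebra_simps)

lemma scale_sum: "scale c (sum f A) = (\<Sum>a\<in>A. scale c (f a))"
  by (rule poly_mapping_eqI) (simp add: lookup_sum sum_distrib_left)

lemma scale_diff_left: "scale (c - d) p = scale c p - scale d p"
  by (rule poly_mapping_eqI) (simp add: lookup_minus algebra_simps)

lemma scale_sum_left: "scale (sum f A) p = (\<Sum>a\<in>A. scale (f a) p)"
  by (rule poly_mapping_eqI) (simp add: lookup_sum sum_distrib_right)

lemma lin_ext_superset:
  assumes "finite S" "keys p \<subseteq> S"
  shows "lin_ext f p = (\<Sum>b\<in>S. scale (lookup p b) (f b))"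
  unfolding lin_ext_def
  by (rule sum.mono_neutral_left) (use assms in \<open>auto simp: in_keys_iff\<close>)

lemma lin_ext_add: "lin_ext f (p + q) = lin_ext f p + lin_ext f q"
proof -
  let ?S = "keys p \<union> keys q"
  have "keys (p + q) \<subseteq> ?S" by (rule Poly_Mapping.keys_add)
  then show ?thesis
    by (simp add: lin_ext_superset[of ?S] lookup_add scale_add_left sum.distrib)
qed

lemma lin_ext_scale: "lin_ext f (scale c p) = scale c (lin_ext f p)"
proof -
  have "keys (scale c p) \<subseteq> keys p" by (auto simp: in_keys_iff)
  then show ?thesis
    by (simp add: lin_ext_superset[of "keys p"] scale_sum)
qed

lemma lin_ext_single [simp]: "lin_ext f (Poly_Mapping.single b c) = scale c (f b)"
  by (simp add: lin_ext_superset[of "{b}"])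

lemma lin_ext_zero [simp]: "lin_ext f 0 = 0"
  by (simp add: lin_ext_def)

lemma lin_ext_sum: "lin_ext f (sum g A) = (\<Sum>a\<in>A. lin_ext f (g a))"
  by (induction A rule: infinite_finite_induct) (auto simp: lin_ext_add)

lemma lin_ext_minus: "lin_ext f (- p) = - lin_ext f p"
  by (metis lin_ext_add lin_ext_zero add.right_inverse add_eq_0_iff)

lemma lin_ext_diff: "lin_ext f (p - q) = lin_ext f p - lin_ext f q"
  by (metis lin_ext_add lin_ext_minus diff_conv_add_uminus)

lemma pm_expand: "p = (\<Sum>m\<in>keys p. scale (lookup p m) (Poly_Mapping.single m 1))"
  by (rule poly_mapping_eqI)
     (simp add: lookup_sum lookup_single when_def in_keys_iff if_distrib cong: if_cong)

lemma linear_eqI: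
  assumes f: "\<And>p q. f (p + q) = f p + f q" "\<And>c p. f (scale c p) = scale c (f p)"
    and g: "\<And>p q. g (p + q) = g p + g q" "\<And>c p. g (scale c p) = scale c (g p)"
    and eq: "\<And>m. f (Poly_Mapping.single m 1) = g (Poly_Mapping.single m 1)"
  shows "f (p::'m \<Rightarrow>\<^sub>0 'a::field) = (g p :: 'n \<Rightarrow>\<^sub>0 'a)"
proof -
  have f0: "f 0 = 0" using f(2)[of 0 0] by simp
  have g0: "g 0 = 0" using g(2)[of 0 0] by simp
  have fs: "f (sum h A) = (\<Sum>a\<in>A. f (h a))" for h and A :: "'m set"
    by (induction A rule: infinite_finite_induct) (auto simp: f f0)
  have gs: "g (sum h A) = (\<Sum>a\<in>A. g (h a))" for h and A :: "'m set"
    by (induction A rule: infinite_finite_induct) (auto simp: g g0)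
  show ?thesis
    by (subst (1 2) pm_expand) (simp only: fs gs f g eq)
qed

lemma scale_single [simp]: "scale c (Poly_Mapping.single m d) = Poly_Mapping.single m (c * d)"
  by (rule poly_mapping_eqI) (simp add: lookup_single when_def)

section \<open>Enveloping and symmetric algebra of a Lie algebra\<close>

definition free_mult :: "('x list \<Rightarrow>\<^sub>0 'a) \<Rightarrow> ('x list \<Rightarrow>\<^sub>0 'a) \<Rightarrow> ('x list \<Rightarrow>\<^sub>0 'a::field)" where
  "free_mult s t = lin_ext (\<lambda>u. lin_ext (\<lambda>w. Poly_Mapping.single (u @ w) 1) t) s"

definition free_algebra :: "'x set \<Rightarrow> ('x list \<Rightarrow>\<^sub>0 'a::field) ring" where
  "free_algebra G =
     \<lparr>carrier = {t. keys t \<subseteq> lists G}, monoid.mult = free_mult, one = Poly_Mapping.single [] 1,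
      zero = 0, add = (+)\<rparr>"

definition gen :: "'x \<Rightarrow> ('x list \<Rightarrow>\<^sub>0 'a::field)" where
  "gen x = Poly_Mapping.single [x] 1"

lemma free_mult_lin:
  "free_mult (p + q) r = free_mult p r + free_mult q r"
  "free_mult (scale c p) r = scale c (free_mult p r)"
  "free_mult r (p + q) = free_mult r p + free_mult r q"
  "free_mult r (scale c p) = scale c (free_mult r p)"
  unfolding free_mult_def lin_ext_add lin_ext_scale
  subgoal by (rule refl)
  subgoal by (rule refl)
  subgoal by (simp add: lin_ext_def[of _ r] scale_add sum.distrib)
  subgoal by (simp add: lin_ext_def[of _ r] scale_sum mult.commute)
  done

lemma free_mult_single: "free_mult (Poly_Mapping.single u 1) (Poly_Mapping.single w 1) = Poly_Mapping.single (u @ w) 1"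
  by (simp add: free_mult_def)

lemma free_mult_assoc: "free_mult (free_mult p q) r = free_mult p (free_mult q r)"
proof (rule linear_eqI[where f = "\<lambda>p. free_mult (free_mult p q) r"], goal_cases)
  case (5 u)
  show ?case
  proof (rule linear_eqI[where f = "\<lambda>q. free_mult (free_mult _ q) r"], goal_cases)
    case (5 v)
    show ?case
      by (rule linear_eqI[where f = "\<lambda>r. free_mult (free_mult _ _) r"])
         (simp_all add: free_mult_lin free_mult_single)
  qed (simp_all add: free_mult_lin)
qed (simp_all add: free_mult_lin)

lemma free_mult_one: "free_mult (Poly_Mapping.single [] 1) p = p" "free_mult p (Poly_Mapping.single [] 1) = p"
  by (rule linear_eqI[where f = "free_mult (Poly_Mapping.single [] 1)" and g = "\<lambda>p. p"],
      simp_all add: free_mult_lin free_mult_single)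
     (rule linear_eqI[where f = "\<lambda>p. free_mult p (Poly_Mapping.single [] 1)" and g = "\<lambda>p. p"],
      simp_all add: free_mult_lin free_mult_single)

lemma keys_free_mult: "keys (free_mult p q) \<subseteq> {u @ w | u w. u \<in> keys p \<and> w \<in> keys q}"
proof
  fix x assume x: "x \<in> keys (free_mult p q)"
  have "lookup (free_mult p q) x = (\<Sum>u\<in>keys p. \<Sum>w\<in>keys q. lookup p u * (lookup q w * (if u @ w = x then 1 else 0)))"
    unfolding free_mult_def lin_ext_def lookup_sum lookup_scale lookup_single when_def sum_distrib_left ..
  with x have "(\<Sum>u\<in>keys p. \<Sum>w\<in>keys q. lookup p u * (lookup q w * (if u @ w = x then 1 else 0))) \<noteq> 0"
    by (simp add: in_keys_iff)
  then obtain u where "u \<in> keys p" "(\<Sum>w\<in>keys q. lookup p u * (lookup q w * (if u @ w = x then 1 else 0))) \<noteq> 0"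
    by (meson sum.neutral)
  moreover then obtain w where "w \<in> keys q" "lookup p u * (lookup q w * (if u @ w = x then 1 else 0)) \<noteq> 0"
    by (meson sum.neutral)
  ultimately show "x \<in> {u @ w | u w. u \<in> keys p \<and> w \<in> keys q}" by (auto split: if_splits)
qed

lemma ring_free_algebra: "ring (free_algebra G :: ('x list \<Rightarrow>\<^sub>0 'a::field) ring)"
proof (rule ringI)
  have keys_uminus: "keys (- p) = keys p" for p :: "'x list \<Rightarrow>\<^sub>0 'a" by (auto simp: in_keys_iff)
  show "abelian_group (free_algebra G :: ('x list \<Rightarrow>\<^sub>0 'a::field) ring)"
  proof (rule abelian_groupI, goal_cases)
    case (6 x)
    then have "- x \<in> carrier (free_algebra G)" by (simp add: free_algebra_def keys_uminus)
    then show ?case by (rule bexI[rotated]) (simp add: free_algebra_def)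
  qed (auto simp: free_algebra_def ac_simps dest!: set_mp[OF Poly_Mapping.keys_add])
  have lists: "keys (free_mult p q) \<subseteq> lists G" if "keys p \<subseteq> lists G" "keys q \<subseteq> lists G"
    for p q :: "'x list \<Rightarrow>\<^sub>0 'a"
    using keys_free_mult[of p q] that by (force simp: subset_iff)
  show "Group.monoid (free_algebra G :: ('x list \<Rightarrow>\<^sub>0 'a::field) ring)"
    by (rule monoidI) (use lists in \<open>simp_all add: free_algebra_def free_mult_assoc free_mult_one\<close>)
qed (simp_all only: free_algebra_def partial_object.simps monoid.simps ring.simps free_mult_lin)

text \<open>
  Here \<open>L\<close> is a subspace of a free vector space. The free algebra is on the underlying \<^emph>\<open>set\<close> of \<open>L\<close>,
  so that its quotient by \<open>linear_relations L\<close> is the tensor algebra of the vector space \<open>L\<close>.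
  The algebras \<open>U(L)\<close> and \<open>S(L)\<close> are then obtained in a single quotient step.
\<close>

definition linear_relations ::
    "('b \<Rightarrow>\<^sub>0 'a) set \<Rightarrow> (('b \<Rightarrow>\<^sub>0 'a) list \<Rightarrow>\<^sub>0 'a::field) set" where
  "linear_relations L =
     {gen (x + y) - gen x - gen y | x y. x \<in> L \<and> y \<in> L} \<union>
     {gen (scale c x) - scale c (gen x) | c x. x \<in> L}"

definition lie_relations ::
    "('b \<Rightarrow>\<^sub>0 'a) set \<Rightarrow> (('b \<Rightarrow>\<^sub>0 'a) \<Rightarrow> ('b \<Rightarrow>\<^sub>0 'a) \<Rightarrow> ('b \<Rightarrow>\<^sub>0 'a))
      \<Rightarrow> (('b \<Rightarrow>\<^sub>0 'a) list \<Rightarrow>\<^sub>0 'a::field) set" where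
  "lie_relations L br =
     {free_mult (gen x) (gen y) - free_mult (gen y) (gen x) - gen (br x y) | x y. x \<in> L \<and> y \<in> L}"

definition comm_relations ::
    "('b \<Rightarrow>\<^sub>0 'a) set \<Rightarrow> (('b \<Rightarrow>\<^sub>0 'a) list \<Rightarrow>\<^sub>0 'a::field) set" where
  "comm_relations L = {free_mult (gen x) (gen y) - free_mult (gen y) (gen x) | x y. x \<in> L \<and> y \<in> L}"

definition env_ideal where
  "env_ideal L br = genideal (free_algebra L) (linear_relations L \<union> lie_relations L br)"

definition sym_ideal where
  "sym_ideal L = genideal (free_algebra L) (linear_relations L \<union> comm_relations L)"

definition env_algebra ::
    "('b \<Rightarrow>\<^sub>0 'a) set \<Rightarrow> (('b \<Rightarrow>\<^sub>0 'a) \<Rightarrow> ('b \<Rightarrow>\<^sub>0 'a) \<Rightarrow> ('b \<Rightarrow>\<^sub>0 'a))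
      \<Rightarrow> (('b \<Rightarrow>\<^sub>0 'a) list \<Rightarrow>\<^sub>0 'a::field) set ring" where
  "env_algebra L br = free_algebra L Quot env_ideal L br"

definition sym_algebra ::
    "('b \<Rightarrow>\<^sub>0 'a) set \<Rightarrow> (('b \<Rightarrow>\<^sub>0 'a) list \<Rightarrow>\<^sub>0 'a::field) set ring" where
  "sym_algebra L = free_algebra L Quot sym_ideal L"

definition env_class where
  "env_class L br t = env_ideal L br +>\<^bsub>free_algebra L\<^esub> t"

definition sym_class where
  "sym_class L t = sym_ideal L +>\<^bsub>free_algebra L\<^esub> t"

text \<open>\<open>env_less L br k\<close> is the filtration step \<open>U\<^sub>\<le>\<^sub>k\<^sub>-\<^sub>1\<close>, with \<open>U\<^sub>\<le>\<^sub>-\<^sub>1 = 0\<close>.\<close>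

definition env_less where
  "env_less L br k =
     env_class L br ` {t \<in> carrier (free_algebra L). \<forall>w\<in>keys t. length w < k}"

text \<open>
  The canonical map \<open>S\<^sup>k(L) \<longrightarrow> U\<^sub>\<le>\<^sub>k / U\<^sub>\<le>\<^sub>k\<^sub>-\<^sub>1\<close> sends the class of a homogeneous tensor \<open>t\<close> of degree \<open>k\<close>
  to the class of \<open>t\<close>. \<open>gr_component L br I k\<close> is the preimage of
  \<open>(I \<inter> U\<^sub>\<le>\<^sub>k + U\<^sub>\<le>\<^sub>k\<^sub>-\<^sub>1) / U\<^sub>\<le>\<^sub>k\<^sub>-\<^sub>1\<close> under this map (which is bijective by Poincare-Birkhoff-Witt).
\<close>

definition gr_component where
  "gr_component L br I k =
     {sym_class L t | t. t \<in> carrier (free_algebra L) \<and> (\<forall>w\<in>keys t. length w = k) \<and>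
        (\<exists>u\<in>I. env_class L br t \<ominus>\<^bsub>env_algebra L br\<^esub> u \<in> env_less L br k)}"

definition gr_ideal where
  "gr_ideal L br I =
     {finsum (sym_algebra L) s {..d} | s (d::nat). \<forall>k\<le>d. s k \<in> gr_component L br I k}"

definition dual_space :: "('b \<Rightarrow>\<^sub>0 'a::field) set \<Rightarrow> (('b \<Rightarrow>\<^sub>0 'a) \<Rightarrow> 'a) set" where
  "dual_space L =
     {\<xi> \<in> extensional L. (\<forall>x\<in>L. \<forall>y\<in>L. \<xi> (x + y) = \<xi> x + \<xi> y) \<and>
        (\<forall>c. \<forall>x\<in>L. \<xi> (scale c x) = c * \<xi> x)}"

definition free_eval :: "('x \<Rightarrow> 'a) \<Rightarrow> ('x list \<Rightarrow>\<^sub>0 'a::field) \<Rightarrow> 'a" where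
  "free_eval \<xi> t = (\<Sum>w\<in>keys t. lookup t w * prod_list (map \<xi> w))"

text \<open>
  Elements of \<open>S(L)\<close> are cosets; \<open>free_eval \<xi>\<close> is constant on each coset when \<open>\<xi>\<close> is linear. The same
  remark applies to \<open>env_act\<close> below, for a representation \<open>\<rho>\<close>.
\<close>

definition sym_eval :: "('x \<Rightarrow> 'a) \<Rightarrow> ('x list \<Rightarrow>\<^sub>0 'a::field) set \<Rightarrow> 'a" where
  "sym_eval \<xi> f = the_elem (free_eval \<xi> ` f)"

definition assoc_variety where
  "assoc_variety L br I = {\<xi> \<in> dual_space L. \<forall>f\<in>gr_ideal L br I. sym_eval \<xi> f = 0}"

section \<open>Modules\<close>

text \<open>
  A module over \<open>L\<close> is given by its action \<open>\<rho> :: 'l \<Rightarrow> 'm \<Rightarrow> 'm\<close> and, where it is not a whole type,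
  its carrier.
\<close>

definition free_act :: "('l \<Rightarrow> ('m \<Rightarrow>\<^sub>0 'a) \<Rightarrow> ('m \<Rightarrow>\<^sub>0 'a)) \<Rightarrow> ('l list \<Rightarrow>\<^sub>0 'a::field)
      \<Rightarrow> ('m \<Rightarrow>\<^sub>0 'a) \<Rightarrow> ('m \<Rightarrow>\<^sub>0 'a)" where
  "free_act \<rho> t m = lin_ext (\<lambda>w. foldr \<rho> w m) t"

definition env_act :: "('l \<Rightarrow> ('m \<Rightarrow>\<^sub>0 'a) \<Rightarrow> ('m \<Rightarrow>\<^sub>0 'a)) \<Rightarrow> ('l list \<Rightarrow>\<^sub>0 'a::field) set
      \<Rightarrow> ('m \<Rightarrow>\<^sub>0 'a) \<Rightarrow> ('m \<Rightarrow>\<^sub>0 'a)" where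
  "env_act \<rho> u m = the_elem ((\<lambda>t. free_act \<rho> t m) ` u)"

definition annihilator where
  "annihilator L br \<rho> M = {u \<in> carrier (env_algebra L br). \<forall>m\<in>M. env_act \<rho> u m = 0}"

definition tensor :: "('m \<Rightarrow>\<^sub>0 'a) \<Rightarrow> ('n \<Rightarrow>\<^sub>0 'a) \<Rightarrow> ('m \<times> 'n \<Rightarrow>\<^sub>0 'a::field)" where
  "tensor f g = lin_ext (\<lambda>a. lin_ext (\<lambda>b. Poly_Mapping.single (a, b) 1) g) f"

definition tensor_act :: "('l \<Rightarrow> ('m \<Rightarrow>\<^sub>0 'a) \<Rightarrow> ('m \<Rightarrow>\<^sub>0 'a)) \<Rightarrow> ('l \<Rightarrow> ('n \<Rightarrow>\<^sub>0 'a) \<Rightarrow> ('n \<Rightarrow>\<^sub>0 'a))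
      \<Rightarrow> 'l \<Rightarrow> ('m \<times> 'n \<Rightarrow>\<^sub>0 'a) \<Rightarrow> ('m \<times> 'n \<Rightarrow>\<^sub>0 'a::field)" where
  "tensor_act \<rho> \<sigma> X =
     lin_ext (\<lambda>(a, b). tensor (\<rho> X (Poly_Mapping.single a 1)) (Poly_Mapping.single b 1) +
                       tensor (Poly_Mapping.single a 1) (\<sigma> X (Poly_Mapping.single b 1)))"

definition tensor_space :: "('m \<Rightarrow>\<^sub>0 'a) set \<Rightarrow> ('n \<Rightarrow>\<^sub>0 'a) set \<Rightarrow> ('m \<times> 'n \<Rightarrow>\<^sub>0 'a::field) set" where
  "tensor_space M N = module.span scale {tensor f g | f g. f \<in> M \<and> g \<in> N}"

section \<open>The Lie algebra of finitary symplectic matrices\<close>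

text \<open>
  The natural module has the basis \<open>e\<^sub>i = Inl i\<close>, \<open>f\<^sub>i = Inr i\<close> for \<open>i \<ge> 0\<close>, and \<open>V\<^sub>n\<close> is spanned by the
  basis vectors with \<open>i < n\<close>. The matrix entry \<open>(a, b)\<close> of \<open>X\<close> is the coefficient of \<open>a\<close> in \<open>X b\<close>.
\<close>

type_synonym idx = "nat + nat"
type_synonym 'a fvec = "idx \<Rightarrow>\<^sub>0 'a"
type_synonym 'a fmat = "idx \<times> idx \<Rightarrow>\<^sub>0 'a"

definition idx_upto :: "nat \<Rightarrow> idx set" where
  "idx_upto n = Inl ` {..<n} \<union> Inr ` {..<n}"

definition V_fin :: "nat \<Rightarrow> 'a::field fvec set" where
  "V_fin n = {u. keys u \<subseteq> idx_upto n}"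

definition mat_vec :: "'a::field fmat \<Rightarrow> 'a fvec \<Rightarrow> 'a fvec" where
  "mat_vec X u = lin_ext (\<lambda>(a, b). Poly_Mapping.single a (lookup u b)) X"

definition mat_mult :: "'a::field fmat \<Rightarrow> 'a fmat \<Rightarrow> 'a fmat" where
  "mat_mult X Y =
     lin_ext (\<lambda>(a, b). lin_ext (\<lambda>(c, d). if b = c then Poly_Mapping.single (a, d) 1 else 0) Y) X"

definition mat_bracket :: "'a::field fmat \<Rightarrow> 'a fmat \<Rightarrow> 'a fmat" where
  "mat_bracket X Y = mat_mult X Y - mat_mult Y X"

definition mat_trace :: "'a::field fmat \<Rightarrow> 'a" where
  "mat_trace X = (\<Sum>(a, b)\<in>keys X. if a = b then lookup X (a, b) else 0)"

fun omega_basis :: "idx \<Rightarrow> idx \<Rightarrow> 'a::field" where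
  "omega_basis (Inr i) (Inl j) = (if i = j then 1 else 0)"
| "omega_basis (Inl i) (Inr j) = (if i = j then - 1 else 0)"
| "omega_basis (Inl i) (Inl j) = 0"
| "omega_basis (Inr i) (Inr j) = 0"

definition omega :: "'a::field fvec \<Rightarrow> 'a fvec \<Rightarrow> 'a" where
  "omega u w = (\<Sum>a\<in>keys u. \<Sum>b\<in>keys w. lookup u a * lookup w b * omega_basis a b)"

definition sp :: "nat \<Rightarrow> 'a::field fmat set" where
  "sp n = {X. keys X \<subseteq> idx_upto n \<times> idx_upto n \<and>
              (\<forall>u w. omega (mat_vec X u) w + omega u (mat_vec X w) = 0)}"

definition sp_inf :: "'a::field fmat set" where
  "sp_inf = (\<Union>n. sp n)"

section \<open>The rank loci\<close>

definition rank_on :: "nat \<Rightarrow> ('a::field fvec \<Rightarrow> 'a fvec) \<Rightarrow> nat" where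
  "rank_on n A = vector_space.dim scale (A ` V_fin n)"

definition sp_rank_le :: "nat \<Rightarrow> nat \<Rightarrow> 'a::field fmat set" where
  "sp_rank_le n r = {X \<in> sp n. \<exists>c. rank_on n (\<lambda>u. mat_vec X u - scale c u) \<le> r}"

definition trace_dual :: "nat \<Rightarrow> 'a::field fmat \<Rightarrow> 'a fmat \<Rightarrow> 'a" where
  "trace_dual n X = restrict (\<lambda>Y. mat_trace (mat_mult X Y)) (sp n)"

text \<open>
  An element of the inverse limit of the duals \<open>(sp n)\<^sup>*\<close> is a functional on \<open>sp_inf\<close>, with the
  restriction maps as projections.
\<close>

definition sp_inf_rank_le :: "nat \<Rightarrow> ('a::field fmat \<Rightarrow> 'a) set" where
  "sp_inf_rank_le r =
     {\<xi> \<in> dual_space sp_inf. \<forall>n. restrict \<xi> (sp n) \<in> trace_dual n ` sp_rank_le n r}"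

section \<open>Polynomial rings and the two modules\<close>

type_synonym ('i, 'a) mpoly = "('i \<Rightarrow>\<^sub>0 nat) \<Rightarrow>\<^sub>0 'a"

definition pvar :: "'i \<Rightarrow> ('i, 'a::field) mpoly" where
  "pvar i = Poly_Mapping.single (Poly_Mapping.single i 1) 1"

definition pdiff :: "'i \<Rightarrow> ('i, 'a::field) mpoly \<Rightarrow> ('i, 'a) mpoly" where
  "pdiff i = lin_ext (\<lambda>m. Poly_Mapping.single (m - Poly_Mapping.single i 1) (of_nat (lookup m i)))"

text \<open>
  The symmetric algebra of \<open>V \<otimes> F\<^sup>v\<close> is the polynomial ring in the basis \<open>a \<otimes> e\<^sub>k\<close>, written as the
  variable \<open>(a, k)\<close> with \<open>k < v\<close>. A matrix \<open>X\<close> acts by the derivation that extends \<open>X \<otimes> id\<close>.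
\<close>

definition sym_module :: "nat \<Rightarrow> (idx \<times> nat, 'a::field) mpoly set" where
  "sym_module v = {p. \<forall>m\<in>keys p. keys m \<subseteq> UNIV \<times> {..<v}}"

definition sym_act :: "nat \<Rightarrow> 'a::field fmat \<Rightarrow> (idx \<times> nat, 'a) mpoly \<Rightarrow> (idx \<times> nat, 'a) mpoly" where
  "sym_act v X p = lin_ext (\<lambda>(a, b). \<Sum>k<v. pvar (a, k) * pdiff (b, k) p) X"

text \<open>
  The Weyl algebra acts faithfully on polynomials. With \<open>e\<^sub>i\<close> and \<open>f\<^sub>i\<close> realised as \<open>x\<^sub>i\<close> and
  \<open>\<partial>\<^sub>i\<close>, the commutator of the Weyl algebra restricts to the form \<open>omega\<close> on the natural module.
  \<open>weyl_dual b\<close> is the basis dual to \<open>weyl_gen b\<close>: the commutator of \<open>weyl_dual b\<close> with \<open>weyl_gen c\<close> is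
  1 if \<open>b = c\<close> and 0 otherwise.
\<close>

fun weyl_gen :: "idx \<Rightarrow> (nat, 'a::field) mpoly \<Rightarrow> (nat, 'a) mpoly" where
  "weyl_gen (Inl i) p = pvar i * p"
| "weyl_gen (Inr i) p = pdiff i p"

fun weyl_dual :: "idx \<Rightarrow> (nat, 'a::field) mpoly \<Rightarrow> (nat, 'a) mpoly" where
  "weyl_dual (Inl i) p = pdiff i p"
| "weyl_dual (Inr i) p = - (pvar i * p)"

text \<open>
  \<open>X \<in> sp_inf\<close> acts by the element of the derived algebra of the span of \<open>1\<close>, \<open>x\<^sub>i x\<^sub>j\<close>,
  \<open>x\<^sub>i \<partial>\<^sub>j\<close>, \<open>\<partial>\<^sub>i \<partial>\<^sub>j\<close> whose commutator with the span of the \<open>x\<^sub>i\<close>, \<open>\<partial>\<^sub>i\<close> is the natural action of \<open>X\<close>.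
  For example, the matrix with \<open>e\<^sub>j \<mapsto> e\<^sub>i\<close>, \<open>f\<^sub>i \<mapsto> - f\<^sub>j\<close> acts by \<open>(x\<^sub>i \<partial>\<^sub>j + \<partial>\<^sub>j x\<^sub>i) / 2\<close>.
\<close>

definition weyl_act :: "'a::field fmat \<Rightarrow> (nat, 'a) mpoly \<Rightarrow> (nat, 'a) mpoly" where
  "weyl_act X p = scale (1 / 2) (lin_ext (\<lambda>(a, b). weyl_gen a (weyl_dual b p)) X)"

text \<open>
  The commutator with \<open>weyl_act X\<close> is the natural action of \<open>X\<close> (\<open>weyl_act_gen\<close>), and \<open>weyl_act\<close> is
  a representation (\<open>weyl_act_mat_bracket\<close>). In the following, \<open>opp\<close> exchanges \<open>e\<^sub>i\<close> and \<open>f\<^sub>i\<close>.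
\<close>

lemma scale_conv_mult: "scale c p = Poly_Mapping.single 0 c * (p :: ('i, 'a::field) mpoly)"
  by (simp add: scale_def mult_map_scale_conv_mult)

lemma mult_scale: "q * scale c p = scale c (q * p)" for p :: "('i, 'a::field) mpoly"
  by (simp add: scale_conv_mult algebra_simps)

lemma pdiff_add: "pdiff i (p + q) = pdiff i p + pdiff i q"
  and pdiff_scale: "pdiff i (scale c p) = scale c (pdiff i p)"
  by (simp_all add: pdiff_def lin_ext_add lin_ext_scale)

lemma pdiff_single: "pdiff i (Poly_Mapping.single m 1) =
   Poly_Mapping.single (m - Poly_Mapping.single i 1) (of_nat (lookup m i) :: 'a::field)"
  by (simp add: pdiff_def)

lemma minus_single_eq: "lookup m j \<noteq> 0 \<Longrightarrow>
  (Poly_Mapping.single i 1 + m) - Poly_Mapping.single j (1::nat) = Poly_Mapping.single i 1 + (m - Poly_Mapping.single j 1)"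
  by (rule poly_mapping_eqI) (auto simp: lookup_add lookup_minus lookup_single when_def)

lemma pdiff_pvar: "pdiff i (pvar j * p) = (if i = j then p else 0) + pvar j * pdiff i (p :: ('i, 'a::field) mpoly)"
proof (rule linear_eqI[where f = "\<lambda>p. pdiff i (pvar j * p)" and g = "\<lambda>p. (if i = j then p else 0) + pvar j * pdiff i p"])
  fix m :: "'i \<Rightarrow>\<^sub>0 nat"
  have *: "Poly_Mapping.single i (1::nat) + m - Poly_Mapping.single i 1 = m"
    by (rule poly_mapping_eqI) (auto simp: lookup_add lookup_minus)
  show "pdiff i (pvar j * Poly_Mapping.single m 1) = (if i = j then Poly_Mapping.single m 1 else 0) + pvar j * pdiff i (Poly_Mapping.single m (1::'a))"
  proof (cases "lookup m i = 0")
    case True then show ?thesis using *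
      by (auto simp: pvar_def mult_single pdiff_single lookup_add lookup_single when_def)
  next
    case False
    have "Poly_Mapping.single (Poly_Mapping.single i 1 + m - Poly_Mapping.single i 1) (of_nat (Suc (lookup m i)) :: 'a) = Poly_Mapping.single m 1 + Poly_Mapping.single m (of_nat (lookup m i))"
      unfolding * by (simp add: single_add)
    moreover have "Poly_Mapping.single i 1 + (m - Poly_Mapping.single i 1) = m"
      using minus_single_eq[OF False, of i] * by simp
    ultimately show ?thesis using minus_single_eq[OF False, of j]
      by (auto simp: pvar_def mult_single pdiff_single lookup_add lookup_single when_def)
  qed
qed (auto simp: pdiff_add pdiff_scale distrib_left mult_scale scale_add)

lemma pdiff_commute: "pdiff i (pdiff j p) = pdiff j (pdiff i (p :: ('i, 'a::field) mpoly))"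
proof (cases "i = j")
  case False
  show ?thesis
  proof (rule linear_eqI[where f = "\<lambda>p. pdiff i (pdiff j p)" and g = "\<lambda>p. pdiff j (pdiff i p)"])
    fix m :: "'i \<Rightarrow>\<^sub>0 nat"
    have "m - Poly_Mapping.single j 1 - Poly_Mapping.single i 1 = m - Poly_Mapping.single i 1 - Poly_Mapping.single j (1::nat)"
      by (rule poly_mapping_eqI) (auto simp: lookup_minus)
    with False show "pdiff i (pdiff j (Poly_Mapping.single m 1)) = pdiff j (pdiff i (Poly_Mapping.single m (1::'a)))"
      by (simp add: pdiff_def lookup_minus lookup_single when_def mult.commute)
  qed (simp_all add: pdiff_add pdiff_scale)
qed simp

definition opp :: "idx \<Rightarrow> idx" where "opp = case_sum Inr Inl"
definition omega_sign :: "idx \<Rightarrow> 'a::field" where "omega_sign = case_sum (\<lambda>_. 1) (\<lambda>_. -1)"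

lemma opp_omega_sign [simp]: "opp (opp a) = a" "omega_sign (opp a) = - omega_sign a" "omega_sign a * omega_sign a = 1"
  by (auto simp: opp_def omega_sign_def split: sum.splits)

lemma omega_basis_eq: "omega_basis a b = (if a = opp b then omega_sign b else 0)"
  by (cases a; cases b) (auto simp: opp_def omega_sign_def)

lemma weyl_gen_lin: "weyl_gen a (p + q) = weyl_gen a p + weyl_gen a q"
   "weyl_gen a (scale c p) = scale c (weyl_gen a p)"
  by (cases a; simp add: pdiff_add pdiff_scale distrib_left mult_scale)+

lemma weyl_gen_sum: "weyl_gen a (sum h A) = (\<Sum>x\<in>A. weyl_gen a (h x))"
proof -
  have "weyl_gen a 0 = 0" using weyl_gen_lin(2)[of a 0 0] by simp
  then show ?thesis
  by (induction A rule: infinite_finite_induct) (auto simp: weyl_gen_lin)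
qed

lemma weyl_dual_eq: "weyl_dual b p = scale (omega_sign b) (weyl_gen (opp b) p)"
  by (cases b) (auto simp: opp_def omega_sign_def intro!: poly_mapping_eqI)

lemma weyl_gen_comm: "weyl_gen a (weyl_gen b p) = weyl_gen b (weyl_gen a p) + scale (omega_basis a b) p"
  by (cases a; cases b)
     (auto simp: pdiff_pvar pdiff_commute mult.left_commute scale_conv_mult[of "-1"] single_uminus)

lemma finite_idx_upto [simp]: "finite (idx_upto n)" by (simp add: idx_upto_def)
lemma opp_idx_upto [simp]: "opp a \<in> idx_upto n \<longleftrightarrow> a \<in> idx_upto n"
  by (cases a) (auto simp: idx_upto_def opp_def)

lemma lin_ext_square:
  assumes "finite S" "keys X \<subseteq> S \<times> S"
  shows "lin_ext f X = (\<Sum>a\<in>S. \<Sum>b\<in>S. scale (lookup X (a, b)) (f (a, b)))"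
  using assms by (simp add: lin_ext_superset[of "S \<times> S"] sum.cartesian_product case_prod_unfold)

lemma lookup_mat_vec:
  assumes "finite S" "keys X \<subseteq> S \<times> S"
  shows "lookup (mat_vec X (Poly_Mapping.single c 1)) a = lookup X (a, c)"
proof -
  have "lookup (mat_vec X (Poly_Mapping.single c 1)) a =
     (\<Sum>a'\<in>S. \<Sum>b\<in>S. if a' = a then if b = c then lookup X (a, c) else 0 else 0)"
    unfolding mat_vec_def lin_ext_square[OF assms]
    by (auto simp: lookup_sum lookup_single when_def intro!: sum.cong)
  also have "\<dots> = (\<Sum>a'\<in>S. if a' = a then \<Sum>b\<in>S. if b = c then lookup X (a, c) else 0 else 0)"
    by (auto intro!: sum.cong)
  also have "\<dots> = (if a \<in> S \<and> c \<in> S then lookup X (a, c) else 0)"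
    using assms(1) by simp
  also have "\<dots> = lookup X (a, c)"
    using assms(2) by (auto simp: in_keys_iff)
  finally show ?thesis .
qed

lemma omega_single_right: "omega u (Poly_Mapping.single c 1) = lookup u (opp c) * omega_sign c"
proof -
  have "omega u (Poly_Mapping.single c 1) = (\<Sum>a\<in>keys u. if a = opp c then lookup u (opp c) * omega_sign c else 0)"
    unfolding omega_def omega_basis_eq by (intro sum.cong refl) simp
  then show ?thesis by (simp add: in_keys_iff)
qed

lemma omega_single_left: "omega (Poly_Mapping.single c 1) u = - (lookup u (opp c) * omega_sign c)"
proof -
  have *: "c = opp b \<longleftrightarrow> b = opp c" for b by (metis opp_omega_sign(1))
  have "omega (Poly_Mapping.single c 1) u = (\<Sum>a\<in>keys u. if a = opp c then - (lookup u (opp c) * omega_sign c) else 0)"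
    unfolding omega_def omega_basis_eq *
    by (subst sum.swap) (intro sum.cong refl, simp)
  then show ?thesis by (simp add: in_keys_iff)
qed

lemma sp_entry:
  assumes "X \<in> sp n"
  shows "lookup X (opp c, b) * omega_sign c = lookup X (opp b, c) * (omega_sign b :: 'a::field)"
proof -
  have K: "keys X \<subseteq> idx_upto n \<times> idx_upto n" 
    and "omega (mat_vec X (Poly_Mapping.single b 1)) (Poly_Mapping.single c 1) +
      omega (Poly_Mapping.single b 1) (mat_vec X (Poly_Mapping.single c 1)) = 0"
    using assms by (auto simp: sp_def)
  then show ?thesis
    by (simp add: omega_single_left omega_single_right lookup_mat_vec[OF finite_idx_upto K])
qed

lemma weyl_act_eq:
  assumes "finite S" "keys X \<subseteq> S \<times> S"
  shows "weyl_act X p = scale (1/2) (\<Sum>a\<in>S. \<Sum>b\<in>S. scale (lookup X (a, b)) (weyl_gen a (weyl_dual b p)))"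
  by (simp add: weyl_act_def lin_ext_square[OF assms])

lemma weyl_act_gen_aux:
  "weyl_gen a (weyl_dual b (weyl_gen c p)) = weyl_gen c (weyl_gen a (weyl_dual b p)) +
     (if b = c then weyl_gen a p else 0) + scale (omega_basis a c) (weyl_dual b p)"
proof -
  have "weyl_dual b (weyl_gen c p) = weyl_gen c (weyl_dual b p) + (if b = c then p else 0)"
    by (auto simp: weyl_dual_eq weyl_gen_comm[of "opp b" c] weyl_gen_lin scale_add omega_basis_eq)
       (metis opp_omega_sign(1))+
  moreover have "weyl_gen a 0 = 0" using weyl_gen_lin(2)[of a 0 0] by simp
  ultimately show ?thesis
    by (auto simp: weyl_gen_lin weyl_gen_comm[of a c])
qed

lemma weyl_act_gen:
  fixes X :: "'a::field_char_0 fmat"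
  assumes X: "X \<in> sp n" and c: "c \<in> idx_upto n"
  shows "weyl_act X (weyl_gen c p) = weyl_gen c (weyl_act X p) +
     (\<Sum>a\<in>idx_upto n. scale (lookup X (a, c)) (weyl_gen a p))"
proof -
  let ?S = "idx_upto n"
  have K: "keys X \<subseteq> ?S \<times> ?S" using X by (auto simp: sp_def)
  have 1: "(\<Sum>a\<in>?S. \<Sum>b\<in>?S. scale (lookup X (a, b)) (if b = c then weyl_gen a p else 0)) =
     (\<Sum>a\<in>?S. scale (lookup X (a, c)) (weyl_gen a p))"
    using c by (simp add: if_distrib cong: if_cong)
  have "(\<Sum>a\<in>?S. \<Sum>b\<in>?S. scale (lookup X (a, b)) (scale (omega_basis a c) (weyl_dual b p))) =
     (\<Sum>b\<in>?S. \<Sum>a\<in>?S. if a = opp c then scale (lookup X (opp c, b) * omega_sign c) (weyl_dual b p) else 0)"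
    by (subst sum.swap) (auto intro!: sum.cong simp: omega_basis_eq)
  also have "\<dots> = (\<Sum>b\<in>?S. scale (lookup X (opp b, c)) (weyl_gen (opp b) p))"
    using c by (simp add: sp_entry[OF X] weyl_dual_eq mult.assoc)
  also have "\<dots> = (\<Sum>a\<in>?S. scale (lookup X (a, c)) (weyl_gen a p))"
    by (rule sum.reindex_bij_witness[of _ opp opp]) auto
  finally have 2: "(\<Sum>a\<in>?S. \<Sum>b\<in>?S. scale (lookup X (a, b)) (scale (omega_basis a c) (weyl_dual b p))) =
     (\<Sum>a\<in>?S. scale (lookup X (a, c)) (weyl_gen a p))" .
  show ?thesis
    unfolding weyl_act_eq[OF finite_idx_upto K] weyl_act_gen_aux scale_add sum.distrib 1 2
      weyl_gen_lin weyl_gen_sum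
    by (simp add: add.assoc flip: scale_add_left)
qed

lemma weyl_act_dual:
  fixes X :: "'a::field_char_0 fmat"
  assumes X: "X \<in> sp n" and b: "b \<in> idx_upto n"
  shows "weyl_act X (weyl_dual b p) = weyl_dual b (weyl_act X p) -
     (\<Sum>d\<in>idx_upto n. scale (lookup X (b, d)) (weyl_dual d p))"
proof -
  let ?S = "idx_upto n"
  have K: "keys X \<subseteq> ?S \<times> ?S" using X by (auto simp: sp_def)
  have lin: "weyl_act X (scale c q) = scale c (weyl_act X q)" for c q
    unfolding weyl_act_eq[OF finite_idx_upto K] scale_sum
    by (simp add: weyl_dual_eq weyl_gen_lin ac_simps)
  have *: "omega_sign b * lookup X (opp d, opp b) = - (lookup X (b, d) * omega_sign d)" for d
  proof -
    have "omega_sign b * lookup X (opp d, opp b) = omega_sign b * (lookup X (opp d, opp b) * omega_sign d) * omega_sign d"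
      by (simp add: mult.assoc)
    also have "\<dots> = omega_sign b * (- (lookup X (b, d) * omega_sign b)) * omega_sign d"
      using sp_entry[OF X, of d "opp b"] by simp
    also have "\<dots> = - (lookup X (b, d) * (omega_sign b * omega_sign b) * omega_sign d)"
      by (simp only: mult_minus_left mult_minus_right ac_simps)
    finally show ?thesis by simp
  qed
  have "scale (omega_sign b) (\<Sum>a\<in>?S. scale (lookup X (a, opp b)) (weyl_gen a p)) =
     (\<Sum>d\<in>?S. scale (omega_sign b * lookup X (opp d, opp b)) (weyl_gen (opp d) p))"
    unfolding scale_sum scale_scale by (rule sum.reindex_bij_witness[of _ opp opp]) auto
  also have "\<dots> = - (\<Sum>d\<in>?S. scale (lookup X (b, d)) (weyl_dual d p))"
    unfolding * weyl_dual_eq sum_negf[symmetric]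
    by (intro sum.cong refl poly_mapping_eqI) simp
  finally show ?thesis using b
    by (simp add: weyl_dual_eq[of b] lin weyl_act_gen[OF X] scale_add)
qed

lemma lookup_mat_mult:
  assumes S: "finite S" and X: "keys X \<subseteq> S \<times> S" and Y: "keys Y \<subseteq> S \<times> S"
  shows "lookup (mat_mult X Y) (a, d) = (\<Sum>b\<in>S. lookup X (a, b) * lookup Y (b, d))"
proof -
  have "lookup (mat_mult X Y) (a, d) = (\<Sum>a'\<in>S. \<Sum>b\<in>S. \<Sum>c\<in>S. \<Sum>d'\<in>S.
     if d' = d then if c = b then if a' = a then lookup X (a', b) * lookup Y (c, d') else 0 else 0 else 0)"
    unfolding mat_mult_def lin_ext_square[OF S X] lin_ext_square[OF S Y]
    by (auto simp: lookup_sum sum_distrib_left lookup_single when_def intro!: sum.cong)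
  also have "\<dots> = (\<Sum>a'\<in>S. if a' = a then \<Sum>b\<in>S. if d \<in> S then lookup X (a', b) * lookup Y (b, d) else 0 else 0)"
  proof (intro sum.cong refl)
    fix a' assume "a' \<in> S"
    show "(\<Sum>b\<in>S. \<Sum>c\<in>S. \<Sum>d'\<in>S.
        if d' = d then if c = b then if a' = a then lookup X (a', b) * lookup Y (c, d') else 0 else 0 else 0) =
      (if a' = a then \<Sum>b\<in>S. if d \<in> S then lookup X (a', b) * lookup Y (b, d) else 0 else 0)"
      using S by (cases "a' = a"; cases "d \<in> S") simp_all
  qed
  also have "\<dots> = (if a \<in> S then \<Sum>b\<in>S. if d \<in> S then lookup X (a, b) * lookup Y (b, d) else 0 else 0)"
    using S by simp
  also have "\<dots> = (\<Sum>b\<in>S. lookup X (a, b) * lookup Y (b, d))"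
  proof (cases "a \<in> S \<and> d \<in> S")
    case False
    then have "lookup X (a, b) * lookup Y (b, d) = 0" for b
      using X Y by (metis SigmaD1 SigmaD2 in_keys_iff mult_eq_0_iff subset_iff)
    then have "(\<Sum>b\<in>S. lookup X (a, b) * lookup Y (b, d)) = 0" by (intro sum.neutral ballI)
    with False show ?thesis by (auto intro: sum.neutral)
  qed simp
  finally show ?thesis .
qed

lemma weyl_act_mat_bracket:
  fixes X Y :: "'a::field_char_0 fmat"
  assumes X: "X \<in> sp n" and Y: "Y \<in> sp n"
  shows "weyl_act (mat_bracket X Y) p = weyl_act X (weyl_act Y p) - weyl_act Y (weyl_act X p)"
proof -
  let ?S = "idx_upto n"
  let ?Q = "\<lambda>a b. weyl_gen a (weyl_dual b p)"
  have KX: "keys X \<subseteq> ?S \<times> ?S" and KY: "keys Y \<subseteq> ?S \<times> ?S" using X Y by (auto simp: sp_def)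
  note L = lookup_mat_mult[OF finite_idx_upto]
  have "keys (mat_bracket X Y) \<subseteq> ?S \<times> ?S"
  proof
    fix x assume x: "x \<in> keys (mat_bracket X Y)"
    obtain a b where [simp]: "x = (a, b)" by (cases x)
    have "\<exists>c. lookup X (a, c) * lookup Y (c, b) \<noteq> 0 \<or> lookup Y (a, c) * lookup X (c, b) \<noteq> 0"
    proof (rule ccontr)
      assume "\<not> ?thesis"
      then have "lookup (mat_mult X Y) (a, b) = 0" "lookup (mat_mult Y X) (a, b) = 0"
        unfolding L[OF KX KY] L[OF KY KX] by (auto intro: sum.neutral)
      with x show False by (simp add: in_keys_iff mat_bracket_def lookup_minus)
    qed
    then show "x \<in> ?S \<times> ?S" using KX KY by (auto simp: in_keys_iff subset_iff)
  qed
  note KB = this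
  have minus: "weyl_gen a (q - r) = weyl_gen a q - weyl_gen a r" for a and q r :: "(nat, 'a) mpoly"
    by (metis weyl_gen_lin(1) add_diff_cancel_right' diff_add_cancel)
  have lin: "weyl_act X (scale c q) = scale c (weyl_act X q)" for c q
    unfolding weyl_act_eq[OF finite_idx_upto KX] scale_sum
    by (simp add: weyl_dual_eq weyl_gen_lin ac_simps)
  have add: "weyl_act X (q + r) = weyl_act X q + weyl_act X r" for q r
    unfolding weyl_act_eq[OF finite_idx_upto KX]
    by (simp add: weyl_dual_eq weyl_gen_lin sum.distrib scale_add)
  have Xsum: "weyl_act X (sum h A) = (\<Sum>x\<in>A. weyl_act X (h x))" for h and A :: "idx set"
    using lin[of 0 0] by (induction A rule: infinite_finite_induct) (auto simp: add)
  have "weyl_act X (weyl_act Y p) = scale (1/2) (\<Sum>a\<in>?S. \<Sum>b\<in>?S. scale (lookup Y (a, b))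
      (weyl_gen a (weyl_dual b (weyl_act X p)) - (\<Sum>d\<in>?S. scale (lookup X (b, d)) (?Q a d))
       + (\<Sum>c\<in>?S. scale (lookup X (c, a)) (?Q c b))))"
    unfolding weyl_act_eq[OF finite_idx_upto KY] lin Xsum
    by (intro arg_cong[of _ _ "scale (1/2)"] sum.cong refl arg_cong[of _ _ "scale (lookup Y _)"])
       (simp add: weyl_act_gen[OF X] weyl_act_dual[OF X] minus weyl_gen_lin weyl_gen_sum)
  also have "\<dots> = weyl_act Y (weyl_act X p)
     + scale (1/2) ((\<Sum>a\<in>?S. \<Sum>b\<in>?S. \<Sum>c\<in>?S. scale (lookup Y (a, b) * lookup X (c, a)) (?Q c b))
        - (\<Sum>a\<in>?S. \<Sum>b\<in>?S. \<Sum>d\<in>?S. scale (lookup Y (a, b) * lookup X (b, d)) (?Q a d)))"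
    unfolding weyl_act_eq[OF finite_idx_upto KY]
    by (simp add: scale_add scale_diff sum.distrib sum_subtractf scale_sum)
  also have "(\<Sum>a\<in>?S. \<Sum>b\<in>?S. \<Sum>c\<in>?S. scale (lookup Y (a, b) * lookup X (c, a)) (?Q c b)) =
     (\<Sum>c\<in>?S. \<Sum>b\<in>?S. scale (lookup (mat_mult X Y) (c, b)) (?Q c b))"
  proof -
    have "(\<Sum>a\<in>?S. \<Sum>b\<in>?S. \<Sum>c\<in>?S. scale (lookup Y (a, b) * lookup X (c, a)) (?Q c b)) =
      (\<Sum>a\<in>?S. \<Sum>c\<in>?S. \<Sum>b\<in>?S. scale (lookup Y (a, b) * lookup X (c, a)) (?Q c b))"
      by (rule sum.cong[OF refl]) (rule sum.swap)
    also have "\<dots> = (\<Sum>c\<in>?S. \<Sum>a\<in>?S. \<Sum>b\<in>?S. scale (lookup Y (a, b) * lookup X (c, a)) (?Q c b))"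
      by (rule sum.swap)
    also have "\<dots> = (\<Sum>c\<in>?S. \<Sum>b\<in>?S. \<Sum>a\<in>?S. scale (lookup Y (a, b) * lookup X (c, a)) (?Q c b))"
      by (rule sum.cong[OF refl]) (rule sum.swap)
    finally show ?thesis
      unfolding L[OF KX KY] scale_sum_left by (simp only: mult.commute)
  qed
  also have "(\<Sum>a\<in>?S. \<Sum>b\<in>?S. \<Sum>d\<in>?S. scale (lookup Y (a, b) * lookup X (b, d)) (?Q a d)) =
     (\<Sum>c\<in>?S. \<Sum>b\<in>?S. scale (lookup (mat_mult Y X) (c, b)) (?Q c b))"
    by (rule sum.cong[OF refl], subst sum.swap)
       (simp add: L[OF KY KX] scale_sum_left)
  also have "(\<Sum>c\<in>?S. \<Sum>b\<in>?S. scale (lookup (mat_mult X Y) (c, b)) (?Q c b)) - \<dots> =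
     (\<Sum>c\<in>?S. \<Sum>b\<in>?S. scale (lookup (mat_bracket X Y) (c, b)) (?Q c b))"
    unfolding mat_bracket_def lookup_minus scale_diff_left sum_subtractf ..
  finally show ?thesis
    by (simp add: weyl_act_eq[OF finite_idx_upto KB])
qed

end

theory Submission
  imports Defs "HOL-Combinatorics.Permutations"
begin

text \<open>
  Write \<open>M = S(V \<otimes> F\<^sup>v) \<otimes> V\<^sub>W\<close>. A matrix \<open>X \<in> sp_inf\<close> acts on \<open>M\<close> by a quadratic expression in the
  generators of a Weyl algebra: for every \<open>u \<in> V\<close> there are the multiplications \<open>Y\<^sub>k(u)\<close> and the
  derivations \<open>D\<^sub>k(u)\<close> with \<open>k < v\<close>, and the operator \<open>W(u)\<close> on \<open>V\<^sub>W\<close>. Their only nonzero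
  commutators are \<open>[D\<^sub>k(u), Y\<^sub>k(w)] = omega u w\<close> and \<open>[W(u), W(w)] = omega u w\<close> (\<open>heisenberg\<close>).
  With \<open>sp_inf\<close> identified with \<open>S\<^sup>2(V)\<close>, the product \<open>u w\<close> acts by \<open>\<Sum>\<^sub>k (Y\<^sub>k(u) D\<^sub>k(w) + Y\<^sub>k(w)
  D\<^sub>k(u)) + (W(u) W(w) + W(w) W(u)) / 2\<close> (\<open>act_op_sq\<close>). Classically, that is a symmetric matrix of
  rank at most \<open>2 v + 1\<close>, and over an algebraically closed field every such matrix arises. So the
  image of the moment map of \<open>M\<close> is the rank locus; the two inclusions make this precise.

  Both use that the points of the rank locus are the functionals that on every \<open>sp n\<close> are sums of
  \<open>2 v + 1\<close> squares \<open>Y \<mapsto> omega h (Y h)\<close> (\<open>rank_le_imp_sum_of_squares\<close>,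
  \<open>sum_of_squares_imp_rank_le\<close>). The scalar \<open>c\<close> in the definition of the locus is 0 for large \<open>n\<close>,
  since the eigenspaces for other eigenvalues are isotropic.

  The rank locus is contained in the variety because symbols of vanishing operators vanish. The
  symbol of an operator at a linear combination \<open>z\<close> of the generators is obtained by iterated
  commutators with \<open>z\<close> (\<open>has_symbol\<close>). If a tensor \<open>t + t'\<close> with top degree part \<open>t\<close> kills \<open>M\<close>,
  then its symbol is 0. This symbol is the value of \<open>t\<close> at the image of \<open>z\<close> under the moment map,
  and every point of the locus is such an image on the finitely many matrices in \<open>t\<close>
  (\<open>sum_of_squares_is_symbol\<close>, \<open>rank_le_vanishes\<close>).

  For the converse, elements of the annihilator are needed. For vectors \<open>u\<^sub>i\<close> that span an
  isotropic subspace all generators commute, so the minors of size \<open>2 v + 2\<close> of the matrix \<open>(u\<^sub>i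
  u\<^sub>j)\<close> act by 0 exactly, with no lower order corrections (\<open>isotropic_minor_acts_zero\<close>). It
  remains to see that these minors detect the rank: a symmetric form of rank greater than \<open>r\<close> on
  the infinite-dimensional space \<open>V\<close> has \<open>r + 1\<close> orthonormal vectors that span an isotropic
  subspace (\<open>isotropic_orthonormal_or_sum_of_squares\<close>). Hence the form \<open>\<xi>(u w)\<close> of a point \<open>\<xi>\<close> of
  the variety is a sum of \<open>2 v + 1\<close> squares (\<open>variety_imp_rank_le\<close>).
\<close>

section \<open>The algebra of linear operators\<close>

text \<open>
  As a type, the linear operators on a free vector space form an instance of \<^class>\<open>ring_1\<close>. Products
  in \<open>U(L)\<close> then act through products in a ring, and commutator identities become ring identities.
\<close>

typedef (overloaded) ('m, 'a::field) linop =
  "{f :: ('m \<Rightarrow>\<^sub>0 'a) \<Rightarrow> ('m \<Rightarrow>\<^sub>0 'a). (\<forall>p q. f (p + q) = f p + f q) \<and> (\<forall>c p. f (scale c p) = scale c (f p))}"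
  morphisms apply_op Abs_linop
  by (rule exI[of _ id]) simp

setup_lifting type_definition_linop

lemma apply_op_add: "apply_op D (p + q) = apply_op D p + apply_op D q"
  and apply_op_scale: "apply_op D (scale c p) = scale c (apply_op D p)"
  using apply_op[of D] by auto

lemma apply_op_zero [simp]: "apply_op D 0 = 0"
  using apply_op_scale[of D 0 0] by simp

instantiation linop :: (type, field) ring_1
begin

lift_definition zero_linop :: "('a, 'b) linop" is "\<lambda>_. 0" by simp
lift_definition one_linop :: "('a, 'b) linop" is "\<lambda>p. p" by simp
lift_definition plus_linop :: "('a, 'b) linop \<Rightarrow> ('a, 'b) linop \<Rightarrow> ('a, 'b) linop"
  is "\<lambda>f g p. f p + g p" by (simp add: scale_add)
lift_definition minus_linop :: "('a, 'b) linop \<Rightarrow> ('a, 'b) linop \<Rightarrow> ('a, 'b) linop"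
  is "\<lambda>f g p. f p - g p" by (simp add: scale_diff)
lift_definition uminus_linop :: "('a, 'b) linop \<Rightarrow> ('a, 'b) linop"
  is "\<lambda>f p. - f p" by (simp add: scale_minus)
lift_definition times_linop :: "('a, 'b) linop \<Rightarrow> ('a, 'b) linop \<Rightarrow> ('a, 'b) linop"
  is "\<lambda>f g p. f (g p)" by simp

instance
proof
  show "(0::('a, 'b) linop) \<noteq> 1"
  proof transfer
    have "(0 :: 'a \<Rightarrow>\<^sub>0 'b) \<noteq> Poly_Mapping.single undefined 1"
      by (metis lookup_single_eq lookup_zero zero_neq_one)
    then show "(\<lambda>_. 0) \<noteq> (\<lambda>p::'a \<Rightarrow>\<^sub>0 'b. p)" by metis
  qed
qed (transfer; simp add: fun_eq_iff algebra_simps)+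

end

lift_definition scal :: "'a::field \<Rightarrow> ('m, 'a) linop" is "scale"
  by (simp add: scale_add mult.commute)

lemma apply_op_simps [simp]:
  "apply_op 0 p = 0" "apply_op 1 p = p" "apply_op (D + E) p = apply_op D p + apply_op E p"
  "apply_op (D - E) p = apply_op D p - apply_op E p" "apply_op (- D) p = - apply_op D p"
  "apply_op (D * E) p = apply_op D (apply_op E p)" "apply_op (scal c) p = scale c p"
  by (transfer; simp)+

lemma linop_eqI: "(\<And>p. apply_op D p = apply_op E p) \<Longrightarrow> D = E"
  by transfer auto

lemma linop_eqI_basis: 
  assumes "\<And>m. apply_op D (Poly_Mapping.single m 1) = apply_op E (Poly_Mapping.single m 1)"
  shows "D = E"
  by (rule linop_eqI, rule linear_eqI[where f = "apply_op D" and g = "apply_op E"])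
     (simp_all add: apply_op_add apply_op_scale assms)

lemma scal_simps: "scal 0 = 0" "scal 1 = 1" "scal (c + d) = scal c + scal d" "scal (c * d) =
    scal c * scal d"
  "scal (c - d) = scal c - scal d" "scal (- c) = - scal c"
  by (rule linop_eqI; simp add: scale_add_left scale_diff_left poly_mapping_eqI)+

lemma scal_sum: "scal (sum f A) = (\<Sum>x\<in>A. scal (f x))"
  by (induction A rule: infinite_finite_induct) (auto simp: scal_simps)

lemma scal_central: "D * scal c = scal c * D"
  by (rule linop_eqI) (simp add: apply_op_scale)

lemma scal_left_commute: "D * (scal c * E) = scal c * (D * E)"
  by (metis scal_central mult.assoc)

lemma apply_op_sum_op [simp]: "apply_op (sum f A) p = (\<Sum>x\<in>A. apply_op (f x) p)"
  by (induction A rule: infinite_finite_induct) auto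

subsection \<open>Linear extension\<close>

definition lin_op :: "('b \<Rightarrow> ('m, 'a) linop) \<Rightarrow> ('b \<Rightarrow>\<^sub>0 'a::field) \<Rightarrow> ('m, 'a) linop" where
  "lin_op f p = (\<Sum>b\<in>keys p. scal (lookup p b) * f b)"

lemma apply_lin_op: "apply_op (lin_op f p) m = lin_ext (\<lambda>b. apply_op (f b) m) p"
  by (simp add: lin_op_def lin_ext_def)

lemma lin_op_add: "lin_op f (p + q) = lin_op f p + lin_op f q"
  and lin_op_scale: "lin_op f (scale c p) = scal c * lin_op f p"
  and lin_op_minus: "lin_op f (- p) = - lin_op f p"
  and lin_op_diff: "lin_op f (p - q) = lin_op f p - lin_op f q"
  and lin_op_single [simp]: "lin_op f (Poly_Mapping.single b c) = scal c * f b"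
  and lin_op_zero [simp]: "lin_op f 0 = 0"
  by (rule linop_eqI; simp add: apply_lin_op lin_ext_add lin_ext_scale lin_ext_minus lin_ext_diff)+

lemma lin_op_sum: "lin_op f (sum g A) = (\<Sum>x\<in>A. lin_op f (g x))"
  by (induction A rule: infinite_finite_induct) (auto simp: lin_op_add)

lemma lin_op_lin_ext: "lin_op f (lin_ext g p) = lin_op (\<lambda>b. lin_op f (g b)) p"
  by (simp add: lin_ext_def lin_op_sum lin_op_scale) (simp add: lin_op_def)

lemma lin_op_mult_right: "E * lin_op f p = lin_op (\<lambda>b. E * f b) p"
  by (simp add: lin_op_def sum_distrib_left scal_left_commute)

lemma lin_op_mult_left: "lin_op f p * E = lin_op (\<lambda>b. f b * E) p"
  by (simp add: lin_op_def sum_distrib_right mult.assoc)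

lemma lin_op_op_add: "lin_op (\<lambda>b. f b + g b) p = lin_op f p + lin_op g p"
  and lin_op_op_diff: "lin_op (\<lambda>b. f b - g b) p = lin_op f p - lin_op g p"
  by (simp_all add: lin_op_def algebra_simps sum.distrib sum_subtractf)

lemma lin_op_op_scal: "lin_op (\<lambda>b. scal c * f b) p = scal c * lin_op f p"
  unfolding lin_op_def sum_distrib_left by (intro sum.cong refl scal_left_commute)

lemma lin_op_op_sum: "lin_op (\<lambda>b. \<Sum>k\<in>A. f k b) p = (\<Sum>k\<in>A. lin_op (f k) p)"
  unfolding lin_op_def sum_distrib_left by (rule sum.swap)

section \<open>Commutators\<close>

definition comm :: "'r::ring \<Rightarrow> 'r \<Rightarrow> 'r" where "comm x y = x * y - y * x"

lemma comm_simps: 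
  "comm (x + y) z = comm x z + comm y z" "comm z (x + y) = comm z x + comm z y"
  "comm z (x * y) = comm z x * y + x * comm z y" "comm (x * y) z = x * comm y z + comm x z * y"
  "comm (x - y) z = comm x z - comm y z" "comm z (x - y) = comm z x - comm z y"
  "comm z (- x) = - comm z x" "comm (- x) z = - comm x z"
  "comm 0 z = 0" "comm z 0 = 0"
  by (simp_all add: comm_def algebra_simps)

lemma comm_sum: "comm z (sum f A) = (\<Sum>x\<in>A. comm z (f x))" "comm (sum f A) z = (\<Sum>x\<in>A. comm (f x) z)"
  by (simp_all add: comm_def sum_distrib_left sum_distrib_right sum_subtractf)

lemma comm_scal [simp]: "comm z (scal c) = 0" "comm (scal c) z = 0"
  by (simp_all add: comm_def scal_central)

lemma comm_scal_mult [simp]: "comm z (scal c * x) = scal c * comm z x" "comm (scal c * x) z =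
    scal c * comm x z"
  by (simp_all add: comm_simps)

lemma comm_antisym: "comm y x = - comm x y"
  by (simp add: comm_def)

lemma comm_lin_op: "comm z (lin_op f p) = lin_op (\<lambda>b. comm z (f b)) p"
  "comm (lin_op f p) z = lin_op (\<lambda>b. comm (f b) z) p"
  by (simp_all add: comm_def lin_op_mult_left lin_op_mult_right lin_op_op_diff)

section \<open>The symplectic form and the finitary symplectic matrices\<close>

lemma lin_ext_lin_ext: "lin_ext f (lin_ext g p) = lin_ext (\<lambda>b. lin_ext f (g b)) p"
  by (simp add: lin_ext_def[of g] lin_ext_sum lin_ext_scale) (simp add: lin_ext_def)

lemma omega_eq:
  assumes "finite S" "keys u \<subseteq> S"
  shows "omega u w = - (\<Sum>a\<in>S. lookup u a * lookup w (opp a) * omega_sign a)"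
proof -
  have opp_eq: "a = opp b \<longleftrightarrow> b = opp a" for a b by (metis opp_omega_sign(1))
  have "omega u w = (\<Sum>a\<in>keys u. \<Sum>b\<in>keys w. if b =
      opp a then - (lookup u a * lookup w b * omega_sign a) else 0)"
    unfolding omega_def omega_basis_eq by (intro sum.cong refl) (auto simp: opp_eq)
  also have "\<dots> = (\<Sum>a\<in>keys u. - (lookup u a * lookup w (opp a) * omega_sign a))"
    by (intro sum.cong refl) (simp add: in_keys_iff)
  also have "\<dots> = (\<Sum>a\<in>S. - (lookup u a * lookup w (opp a) * omega_sign a))"
    by (rule sum.mono_neutral_left) (use assms in \<open>auto simp: in_keys_iff\<close>)
  finally show ?thesis by (simp add: sum_negf)
qed

lemma omega_add_right: "omega u (w + x) = omega u w + omega u x"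
  and omega_scale_right: "omega u (scale c w) = c * omega u w"
  and omega_scale_left: "omega (scale c u) w = c * omega u w"
proof -
  show "omega u (w + x) = omega u w + omega u x" "omega u (scale c w) = c * omega u w"
    by (simp_all add: omega_eq[OF finite_keys order_refl] lookup_add algebra_simps sum.distrib
        sum_distrib_left)
  have "keys (scale c u) \<subseteq> keys u" by (auto simp: in_keys_iff)
  then show "omega (scale c u) w = c * omega u w"
    by (simp add: omega_eq[of "keys u"] algebra_simps sum_distrib_left)
qed

lemma omega_add_left: "omega (u + w) x = omega u x + omega w x"
proof -
  have "keys (u + w) \<subseteq> keys u \<union> keys w" by (rule Poly_Mapping.keys_add)
  then show ?thesis
    by (simp add: omega_eq[of "keys u \<union> keys w"] lookup_add algebra_simps sum.distrib)
qed

lemma omega_antisym: "omega w u = - omega u (w :: 'a::field fvec)"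
proof -
  let ?S = "keys u \<union> keys w \<union> opp ` (keys u \<union> keys w)"
  have S: "opp a \<in> ?S" if "a \<in> ?S" for a using that by (auto simp: image_iff)
  have "(\<Sum>a\<in>?S. lookup w a * lookup u (opp a) * omega_sign a) =
    (\<Sum>a\<in>?S. lookup w (opp a) * lookup u a * omega_sign (opp a))"
    by (rule sum.reindex_bij_witness[of _ opp opp]) (use S in auto)
  also have "\<dots> = - (\<Sum>a\<in>?S. lookup u a * lookup w (opp a) * omega_sign a)"
    by (simp add: sum_negf mult.commute)
  finally show ?thesis
    using omega_eq[of ?S w u] omega_eq[of ?S u w] by (auto simp: Un_assoc)
qed

lemma omega_zero [simp]: "omega 0 u = 0" "omega u 0 = 0"
  using omega_scale_left[of 0 0 u] omega_scale_right[of u 0 0] by simp_all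

lemma omega_minus: "omega (- u) w = - omega u w" "omega u (- w) = - omega u w"
  by (metis omega_add_left add_eq_0_iff omega_zero(1) add.right_inverse)
     (metis omega_add_right add_eq_0_iff omega_zero(2) add.right_inverse)

lemma omega_diff: "omega (u - w) x = omega u x - omega w x" "omega x (u - w) = omega x u - omega x w"
  using omega_add_left[of u "- w" x] omega_add_right[of x u "- w"] by (simp_all add: omega_minus)

lemma omega_sum_left: "omega (sum f A) x = (\<Sum>a\<in>A. omega (f a) x)"
  by (induction A rule: infinite_finite_induct) (auto simp: omega_add_left)

lemma omega_sum_right: "omega x (sum f A) = (\<Sum>a\<in>A. omega x (f a))"
  by (induction A rule: infinite_finite_induct) (auto simp: omega_add_right)

lemmas omega_linear = omega_add_left omega_add_right omega_scale_left omega_scale_right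
  omega_minus omega_diff omega_sum_left omega_sum_right

lemma omega_nondegenerate:
  assumes "\<And>x. omega u x = omega w x" shows "u = w"
proof (rule poly_mapping_eqI)
  fix a
  have "lookup u a * omega_sign (opp a) = lookup w a * omega_sign (opp a)"
    using assms[of "Poly_Mapping.single (opp a) 1"] by (simp add: omega_single_right)
  then show "lookup u a = lookup w a"
    by (metis mult.assoc mult.right_neutral opp_omega_sign(3))
qed

text \<open>
  The basis dual to the standard basis with respect to \<open>omega\<close>.
\<close>

definition dual_vec :: "idx \<Rightarrow> 'a::field fvec" where
  "dual_vec b = Poly_Mapping.single (opp b) (omega_sign b)"

lemma omega_dual_vec: "omega (dual_vec b) x = lookup x b"
proof -
  have "dual_vec b = scale (omega_sign b) (Poly_Mapping.single (opp b) (1::'a))"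
    by (simp add: dual_vec_def)
  then show ?thesis by (simp only: omega_scale_left omega_single_left) (simp add: mult.left_commute)
qed

lemma vec_expand: "finite S \<Longrightarrow> keys u \<subseteq> S \<Longrightarrow> u = (\<Sum>b\<in>S. scale (lookup u b) (Poly_Mapping.single b 1))"
  by (rule poly_mapping_eqI) (auto simp: lookup_sum lookup_single when_def in_keys_iff if_distrib cong:
      if_cong)

lemma scale_minus_left: "scale (- c) p = - scale c p"
  by (rule poly_mapping_eqI) simp

subsection \<open>Matrices as operators on vectors\<close>

lemma mat_vec_add: "mat_vec (X + Y) u = mat_vec X u + mat_vec Y u"
  and mat_vec_scale: "mat_vec (scale c X) u = scale c (mat_vec X u)"
  and mat_vec_minus: "mat_vec (- X) u = - mat_vec X u"
  and mat_vec_diff: "mat_vec (X - Y) u = mat_vec X u - mat_vec Y u"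
  and mat_vec_sum: "mat_vec (sum f A) u = (\<Sum>x\<in>A. mat_vec (f x) u)"
  by (simp_all add: mat_vec_def lin_ext_add lin_ext_scale lin_ext_minus lin_ext_diff lin_ext_sum)

lemma mat_vec_vec_add: "mat_vec X (u + w) = mat_vec X u + mat_vec X w"
  and mat_vec_vec_scale: "mat_vec X (scale c u) = scale c (mat_vec X u)"
  by (rule poly_mapping_eqI;
      auto simp: mat_vec_def lin_ext_def case_prod_unfold lookup_sum lookup_add lookup_single when_def
        algebra_simps sum_distrib_left sum.distrib[symmetric] intro!: sum.cong)+

lemma mat_vec_zero [simp]: "mat_vec X 0 = 0" "mat_vec 0 u = 0"
  using mat_vec_vec_scale[of X 0 0] by (simp_all add: mat_vec_def)

lemma mat_vec_vec_sum: "mat_vec X (sum f A) = (\<Sum>x\<in>A. mat_vec X (f x))"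
  by (induction A rule: infinite_finite_induct) (auto simp: mat_vec_vec_add)

lemma mat_vec_vec_diff: "mat_vec X (u - w) = mat_vec X u - mat_vec X w"
  by (metis mat_vec_vec_add add_diff_cancel_right' diff_add_cancel)

lemmas mat_vec_linear = mat_vec_add mat_vec_scale mat_vec_minus mat_vec_diff mat_vec_sum
  mat_vec_vec_add mat_vec_vec_scale mat_vec_vec_sum mat_vec_vec_diff

lemma mat_vec_expand:
  assumes "finite S" "keys u \<subseteq> S"
  shows "mat_vec X u = (\<Sum>b\<in>S. scale (lookup u b) (mat_vec X (Poly_Mapping.single b 1)))"
  using arg_cong[OF vec_expand[OF assms], of "mat_vec X"] by (simp only: mat_vec_vec_sum mat_vec_vec_scale)

lemma lookup_mat_vec_single: "lookup (mat_vec X (Poly_Mapping.single c 1)) a = lookup X (a, c)"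
proof (rule lookup_mat_vec)
  show "keys X \<subseteq> (fst ` keys X \<union> snd ` keys X) \<times> (fst ` keys X \<union> snd ` keys X)" by force
qed simp

lemma mat_eqI: "(\<And>u. mat_vec X u = mat_vec Y u) \<Longrightarrow> X = Y"
  by (rule poly_mapping_eqI) (metis lookup_mat_vec_single surj_pair)

lemma keys_mat_vec: "keys X \<subseteq> S \<times> S \<Longrightarrow> keys (mat_vec X u) \<subseteq> S"
proof
  fix a assume X: "keys X \<subseteq> S \<times> S" and "a \<in> keys (mat_vec X u)"
  then have "lookup (mat_vec X u) a \<noteq> 0" by (simp add: in_keys_iff)
  then have "(\<Sum>x\<in>keys X. lookup X x * (lookup u (snd x) when fst x = a)) \<noteq> 0"
    by (simp only: mat_vec_def lin_ext_def case_prod_unfold lookup_sum lookup_single lookup_scale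
        not_False_eq_True)
  then obtain x where "x \<in> keys X" "lookup X x * (lookup u (snd x) when fst x = a) \<noteq> 0"
    by (meson sum.neutral)
  with X show "a \<in> S" by (auto simp: when_def split: if_splits)
qed

lemma mat_vec_mat_mult: "mat_vec (mat_mult X Y) u = mat_vec X (mat_vec Y u)"
proof (rule linear_eqI[where f = "\<lambda>X. mat_vec (mat_mult X Y) u" and g =
    "\<lambda>X. mat_vec X (mat_vec Y u)"], goal_cases)
  case (5 m)
  show ?case
  proof (rule linear_eqI[where f = "\<lambda>Y. mat_vec (mat_mult _ Y) u" and g =
      "\<lambda>Y. mat_vec _ (mat_vec Y u)"], goal_cases)
    case (5 k)
    show ?case
      by (cases m; cases k) (auto simp: mat_mult_def mat_vec_def lookup_single when_def)
  qed (cases m; simp add: mat_mult_def mat_vec_linear lin_ext_add lin_ext_scale)+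
qed (simp_all add: mat_mult_def mat_vec_linear lin_ext_add lin_ext_scale)

lemma mat_vec_mat_bracket: "mat_vec (mat_bracket X Y) u = mat_vec X (mat_vec Y u) - mat_vec Y (mat_vec X u)"
  by (simp add: mat_bracket_def mat_vec_linear mat_vec_mat_mult)

lemma keys_matI:
  assumes "\<And>u. keys (mat_vec X u) \<subseteq> S" "\<And>b. b \<notin> S \<Longrightarrow> mat_vec X (Poly_Mapping.single b 1) = 0"
  shows "keys X \<subseteq> S \<times> S"
proof
  fix x assume "x \<in> keys X"
  then obtain a b where x: "x = (a, b)" "lookup (mat_vec X (Poly_Mapping.single b 1)) a \<noteq> 0"
    by (cases x) (auto simp: in_keys_iff lookup_mat_vec_single)
  with assms(1)[of "Poly_Mapping.single b 1"] assms(2)[of b] show "x \<in> S \<times> S"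
    by (cases "b \<in> S") (auto simp: in_keys_iff)
qed

lemma mat_vec_outside:
  assumes "keys X \<subseteq> S \<times> S" "b \<notin> S" shows "mat_vec X (Poly_Mapping.single b 1) = 0"
  by (rule poly_mapping_eqI) (use assms in \<open>auto simp: lookup_mat_vec_single in_keys_iff\<close>)

lemma sp_iff: "X \<in> sp n \<longleftrightarrow> keys X \<subseteq> idx_upto n \<times> idx_upto n \<and> (\<forall>u w. omega u (mat_vec X w) =
    - omega (mat_vec X u) w)"
  by (auto simp: sp_def eq_neg_iff_add_eq_0 add.commute)

lemma sp_keys: "X \<in> sp n \<Longrightarrow> keys X \<subseteq> idx_upto n \<times> idx_upto n"
  by (simp add: sp_iff)

lemma sp_omega: "X \<in> sp n \<Longrightarrow> omega u (mat_vec X w) = - omega (mat_vec X u) w"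
  by (simp add: sp_iff)

lemma sp_inf_omega: "X \<in> sp_inf \<Longrightarrow> omega u (mat_vec X w) = - omega (mat_vec X u) w"
  by (auto simp: sp_inf_def dest: sp_omega)

lemma idx_upto_mono: "m \<le> n \<Longrightarrow> idx_upto m \<subseteq> idx_upto n"
  by (auto simp: idx_upto_def)

lemma sp_mono: "m \<le> n \<Longrightarrow> sp m \<subseteq> sp n"
  using idx_upto_mono[of m n] by (auto simp: sp_def)

lemma finite_subset_idx_upto:
  assumes "finite S" shows "\<exists>n. S \<subseteq> idx_upto n"
  using assms
proof (induction S)
  case (insert a S)
  then obtain n where n: "S \<subseteq> idx_upto n" by auto
  obtain m where m: "a \<in> idx_upto m" by (cases a) (auto simp: idx_upto_def)
  show ?case
    using n m idx_upto_mono[of n "max m n"] idx_upto_mono[of m "max m n"]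
        by (intro exI[of _ "max m n"]) auto
qed auto

lemma sp_add: "X \<in> sp n \<Longrightarrow> Y \<in> sp n \<Longrightarrow> X + Y \<in> sp n"
  using Poly_Mapping.keys_add[of X Y] by (fastforce simp: sp_iff mat_vec_linear omega_linear)

lemma sp_scale: "X \<in> sp n \<Longrightarrow> scale c X \<in> sp n"
proof -
  have "keys (scale c X) \<subseteq> keys X" by (auto simp: in_keys_iff)
  then show "X \<in> sp n \<Longrightarrow> scale c X \<in> sp n" by (auto simp: sp_iff mat_vec_linear omega_linear)
qed

lemma sp_bracket: assumes X: "X \<in> sp n" and Y: "Y \<in> sp n" shows "mat_bracket X Y \<in> sp n"
proof -
  have "keys (mat_bracket X Y) \<subseteq> idx_upto n \<times> idx_upto n"
  proof (rule keys_matI)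
    show "keys (mat_vec (mat_bracket X Y) u) \<subseteq> idx_upto n" for u
    proof
      fix a assume a: "a \<in> keys (mat_vec (mat_bracket X Y) u)"
      show "a \<in> idx_upto n"
        using a keys_mat_vec[OF sp_keys[OF X], of "mat_vec Y u"] keys_mat_vec[OF sp_keys[OF Y], of
            "mat_vec X u"]
        using Poly_Mapping.keys_diff[of "mat_vec X (mat_vec Y u)" "mat_vec Y (mat_vec X u)"]
        by (auto simp: mat_vec_mat_bracket)
    qed
    show "mat_vec (mat_bracket X Y) (Poly_Mapping.single b 1) = 0" if "b \<notin> idx_upto n" for b
      using mat_vec_outside[OF sp_keys[OF X] that] mat_vec_outside[OF sp_keys[OF Y] that]
      by (simp add: mat_vec_mat_bracket)
  qed
  then show ?thesis
    by (simp add: sp_iff mat_vec_mat_bracket omega_linear sp_omega[OF X] sp_omega[OF Y])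
qed

lemma sp_inf_common: "X \<in> sp_inf \<Longrightarrow> Y \<in> sp_inf \<Longrightarrow> \<exists>n. X \<in> sp n \<and> Y \<in> sp n"
proof -
  assume "X \<in> sp_inf" "Y \<in> sp_inf"
  then obtain m n where "X \<in> sp m" "Y \<in> sp n" by (auto simp: sp_inf_def)
  then show ?thesis using sp_mono[of m "max m n"] sp_mono[of n "max m n"]
      by (intro exI[of _ "max m n"]) auto
qed

lemma sp_inf_add: "X \<in> sp_inf \<Longrightarrow> Y \<in> sp_inf \<Longrightarrow> X + Y \<in> sp_inf"
  using sp_inf_common[of X Y] sp_add by (auto simp: sp_inf_def)

lemma sp_inf_scale: "X \<in> sp_inf \<Longrightarrow> scale c X \<in> sp_inf"
  using sp_scale by (auto simp: sp_inf_def)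

lemma sp_inf_bracket: "X \<in> sp_inf \<Longrightarrow> Y \<in> sp_inf \<Longrightarrow> mat_bracket X Y \<in> sp_inf"
  using sp_inf_common[of X Y] sp_bracket by (auto simp: sp_inf_def)

text \<open>
  The rank one operator \<open>x \<mapsto> omega w x \<cdot> u\<close>: the sign and \<open>opp\<close> turn \<open>w\<close> into the row vector of
  \<open>omega w\<close>.
\<close>

definition outer :: "'a::field fvec \<Rightarrow> 'a fvec \<Rightarrow> 'a fmat" where
  "outer u w = lin_ext (\<lambda>a. lin_ext (\<lambda>b. Poly_Mapping.single (a, opp b) (omega_sign (opp b))) w) u"

lemma mat_vec_outer: "mat_vec (outer u w) x = scale (omega w x) u"
proof (rule poly_mapping_eqI)
  fix c
  have "lookup (mat_vec (outer u w) x) c =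
      (\<Sum>a\<in>keys u. lookup u a * (\<Sum>b\<in>keys w. lookup w b * - (omega_sign b * (if a =
          c then lookup x (opp b) else 0))))"
    unfolding outer_def mat_vec_def lin_ext_lin_ext lin_ext_single
    by (auto simp: lin_ext_def[of _ u] lin_ext_def[of _ w] lookup_sum lookup_single when_def
        intro!: sum.cong arg_cong2[where f = "(*)"])
  also have "\<dots> = (\<Sum>a\<in>keys u. if a = c then lookup u c * omega w x else 0)"
    by (intro sum.cong refl) (auto simp: omega_eq[OF finite_keys order_refl] sum_negf ac_simps)
  also have "\<dots> = lookup (scale (omega w x) u) c"
    by (simp add: in_keys_iff)
  finally show "lookup (mat_vec (outer u w) x) c = lookup (scale (omega w x) u) c" .
qed

text \<open>
  The image of the product \<open>u w\<close> under the isomorphism of \<open>S\<^sup>2(V)\<close> with the symplectic Lie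
  algebra. It lets a functional on \<open>sp_inf\<close> be read as a symmetric form on \<open>V\<close>.
\<close>

definition sq :: "'a::field fvec \<Rightarrow> 'a fvec \<Rightarrow> 'a fmat" where
  "sq u w = outer u w + outer w u"

lemma mat_vec_sq: "mat_vec (sq u w) x = scale (omega w x) u + scale (omega u x) w"
  by (simp add: sq_def mat_vec_linear mat_vec_outer)

lemma sq_linear: "sq (u + x) w = sq u w + sq x w" "sq (scale c u) w = scale c (sq u w)"
    "sq u (w + x) = sq u w + sq u x" "sq u (scale c w) = scale c (sq u w)"
  and sq_commute: "sq u w = sq w u"
  by (rule mat_eqI; simp add: mat_vec_sq mat_vec_linear omega_linear scale_add scale_add_left ac_simps)+

lemma sq_in_sp: assumes "u \<in> V_fin n" "w \<in> V_fin n" shows "sq u w \<in> sp n"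
proof -
  have K: "keys u \<subseteq> idx_upto n" "keys w \<subseteq> idx_upto n" using assms by (auto simp: V_fin_def)
  have z: "omega x (Poly_Mapping.single b 1) = 0" if "keys x \<subseteq> idx_upto n" "b \<notin> idx_upto n"
      for x :: "'a fvec" and b
  proof -
    have "opp b \<notin> keys x" using that by (metis opp_idx_upto subsetD)
    then show ?thesis by (simp add: omega_single_right in_keys_iff)
  qed
  have "keys (sq u w) \<subseteq> idx_upto n \<times> idx_upto n"
  proof (rule keys_matI)
    show "keys (mat_vec (sq u w) x) \<subseteq> idx_upto n" for x
    proof
      fix a assume "a \<in> keys (mat_vec (sq u w) x)"
      then have "a \<in> keys u \<union> keys w" by (auto simp: mat_vec_sq in_keys_iff lookup_add)
      with K show "a \<in> idx_upto n" by auto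
    qed
  qed (use K z in \<open>simp add: mat_vec_sq\<close>)
  moreover have "omega y (mat_vec (sq u w) x) = - omega (mat_vec (sq u w) y) x" for x y
    using omega_antisym[of y u] omega_antisym[of y w] by (simp add: mat_vec_sq omega_linear)
  ultimately show ?thesis by (simp add: sp_iff)
qed

lemma in_V_fin: "\<exists>n. u \<in> V_fin n"
  using finite_subset_idx_upto[of "keys u"] by (simp add: V_fin_def)

lemma V_fin_mono: "m \<le> n \<Longrightarrow> V_fin m \<subseteq> V_fin n"
  using idx_upto_mono[of m n] by (auto simp: V_fin_def)

lemma sq_in_sp_inf: "sq u w \<in> sp_inf"
proof -
  obtain m n where "u \<in> V_fin m" "w \<in> V_fin n" using in_V_fin by metis
  then have "sq u w \<in> sp (max m n)"
    using V_fin_mono[of m "max m n"] V_fin_mono[of n "max m n"] by (intro sq_in_sp) auto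
  then show ?thesis by (auto simp: sp_inf_def)
qed

text \<open>
  Applied to \<open>u\<close>, the first summand of \<open>sq (X b) (dual_vec b)\<close> gives \<open>X u\<close> in the sum over \<open>b\<close>
  because \<open>dual_vec b\<close> reads off the coordinate \<open>b\<close> of \<open>u\<close>; the second summand gives \<open>X u\<close> once
  more, because \<open>omega\<close> is invariant under \<open>X\<close>. This explains the factor \<open>1/2\<close>.
\<close>

lemma sp_expand:
  fixes X :: "'a::field_char_0 fmat"
  assumes X: "X \<in> sp n"
  shows "X = (\<Sum>b\<in>idx_upto n. scale (1/2) (sq (mat_vec X (Poly_Mapping.single b 1)) (dual_vec b)))" 
proof (rule mat_eqI)
  fix u
  let ?I = "idx_upto n"
  let ?e = "\<lambda>b. Poly_Mapping.single b 1 :: 'a fvec"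
  have out: "mat_vec X (?e b) = 0" if "b \<notin> ?I" for b
    by (rule mat_vec_outside[OF sp_keys[OF X] that])
  have 1: "mat_vec X u = (\<Sum>b\<in>?I. scale (lookup u b) (mat_vec X (?e b)))" for u
  proof -
    have "mat_vec X u = (\<Sum>b\<in>?I \<union> keys u. scale (lookup u b) (mat_vec X (?e b)))"
      by (rule mat_vec_expand) auto
    also have "\<dots> = (\<Sum>b\<in>?I. scale (lookup u b) (mat_vec X (?e b)))"
      by (rule sum.mono_neutral_right) (auto simp: out)
    finally show ?thesis .
  qed
  have 2: "(\<Sum>b\<in>?I. scale (omega (mat_vec X (?e b)) u) (dual_vec b)) = mat_vec X u"
  proof (rule omega_nondegenerate)
    fix x
    have "omega (\<Sum>b\<in>?I. scale (omega (mat_vec X (?e b)) u) (dual_vec b)) x = 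
       (\<Sum>b\<in>?I. omega (scale (lookup x b) (mat_vec X (?e b))) u)"
      by (simp add: omega_linear omega_dual_vec mult.commute)
    also have "\<dots> = omega (\<Sum>b\<in>?I. scale (lookup x b) (mat_vec X (?e b))) u"
      by (simp add: omega_linear)
    also have "(\<Sum>b\<in>?I. scale (lookup x b) (mat_vec X (?e b))) = mat_vec X x"
      using 1[of x] by simp
    finally show "omega (\<Sum>b\<in>?I. scale (omega (mat_vec X (?e b)) u) (dual_vec b)) x = omega (mat_vec X u) x"
      using sp_omega[OF X, of u x] omega_antisym[of "mat_vec X x" u] by simp
  qed
  have "mat_vec (\<Sum>b\<in>?I. scale (1/2) (sq (mat_vec X (?e b)) (dual_vec b))) u =
    scale (1/2) ((\<Sum>b\<in>?I. scale (lookup u b) (mat_vec X (?e b))) + 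
       (\<Sum>b\<in>?I. scale (omega (mat_vec X (?e b)) u) (dual_vec b)))"
    by (simp add: mat_vec_linear mat_vec_sq omega_dual_vec scale_sum scale_add sum.distrib)
  also have "\<dots> = mat_vec X u"
    unfolding 2 1[symmetric] by (simp flip: scale_add_left add: scale_add)
  finally show "mat_vec X u = mat_vec (\<Sum>b\<in>?I. scale (1/2) (sq (mat_vec X (?e b)) (dual_vec b))) u" ..
qed

text \<open>
  Statements that are linear in \<open>X \<in> sp_inf\<close> are proved below on the elements \<open>sq u w\<close> only, where
  the action on the module is an explicit quadratic expression.
\<close>

lemma sp_inf_induct [consumes 1, case_names sq add scale]:
  fixes X :: "'a::field_char_0 fmat"
  assumes "X \<in> sp_inf"
    and sq: "\<And>u w. P (sq u w)"
    and add: "\<And>X Y. X \<in> sp_inf \<Longrightarrow> Y \<in> sp_inf \<Longrightarrow> P X \<Longrightarrow> P Y \<Longrightarrow> P (X + Y)"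
    and scale: "\<And>c X. X \<in> sp_inf \<Longrightarrow> P X \<Longrightarrow> P (scale c X)"
  shows "P X"
proof -
  obtain n where n: "X \<in> sp n" using assms(1) by (auto simp: sp_inf_def)
  have z: "P 0" "0 \<in> sp_inf" using scale[OF sq_in_sp_inf sq, of 0] sp_inf_scale[OF sq_in_sp_inf, of 0] by
      auto
  have *: "(\<Sum>b\<in>A. scale (1/2) (sq (f b) (g b))) \<in> sp_inf \<and> P (\<Sum>b\<in>A. scale (1/2) (sq (f b) (g b)))"
    for A :: "idx set" and f g
    by (induction A rule: infinite_finite_induct)
       (auto simp: z intro!: sq scale add sp_inf_add sp_inf_scale sq_in_sp_inf)
  show ?thesis
    using *[of "\<lambda>b. mat_vec X (Poly_Mapping.single b 1)" dual_vec "idx_upto n"] sp_expand[OF n] by simp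
qed

lemma bracket_sq: "X \<in> sp_inf \<Longrightarrow> mat_bracket X (sq u w) = sq (mat_vec X u) w + sq u (mat_vec X w)"
  by (rule mat_eqI) (simp add: mat_vec_mat_bracket mat_vec_sq mat_vec_linear sp_inf_omega scale_minus_left)

section \<open>Symmetric forms on a symplectic space\<close>

global_interpretation vs: vector_space "scale :: 'a::field \<Rightarrow> ('b \<Rightarrow>\<^sub>0 'a) \<Rightarrow> ('b \<Rightarrow>\<^sub>0 'a)"
  by (rule vector_space_scale)

locale symmetric_form =
  fixes S :: "('b \<Rightarrow>\<^sub>0 'a::{alg_closed_field, field_char_0}) \<Rightarrow> ('b \<Rightarrow>\<^sub>0 'a) \<Rightarrow> 'a"
  assumes sym: "S x y = S y x"
    and add_right: "S x (y + z) = S x y + S x z"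
    and scale_right: "S x (scale c y) = c * S x y"
begin

lemma add_left: "S (x + y) z = S x z + S y z" 
  and scale_left: "S (scale c y) z = c * S y z"
  by (metis sym add_right, metis sym scale_right)

lemma zero [simp]: "S 0 x = 0" "S x 0 = 0"
  using scale_left[of 0 0 x] scale_right[of x 0 0] by simp_all

lemma diff: "S (x - y) z = S x z - S y z" "S z (x - y) = S z x - S z y"
  by (metis add_left add_diff_cancel_right' diff_add_cancel)
     (metis add_right add_diff_cancel_right' diff_add_cancel)

lemma sum_left: "S (sum f A) z = (\<Sum>a\<in>A. S (f a) z)"
  and sum_right: "S z (sum f A) = (\<Sum>a\<in>A. S z (f a))"
  by (induction A rule: infinite_finite_induct) (auto simp: add_left add_right)

lemmas linear = add_left add_right scale_left scale_right diff sum_left sum_right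

definition orthonormal :: "nat \<Rightarrow> (nat \<Rightarrow> ('b \<Rightarrow>\<^sub>0 'a)) \<Rightarrow> bool" where
  "orthonormal i u \<longleftrightarrow> (\<forall>j<i. \<forall>k<i. S (u j) (u k) = (if j = k then 1 else 0))"

definition sum_of_squares :: "nat \<Rightarrow> (nat \<Rightarrow> ('b \<Rightarrow>\<^sub>0 'a)) \<Rightarrow> bool" where
  "sum_of_squares r u \<longleftrightarrow> (\<forall>x y. S x y = (\<Sum>j<r. S x (u j) * S y (u j)))"

lemma polarize:
  assumes "\<And>x. x \<in> W \<Longrightarrow> S x x = 0" "x \<in> W" "y \<in> W" "x + y \<in> W"
  shows "S x y = 0"
proof -
  have "S (x + y) (x + y) = S x x + S y y + 2 * S x y"
    by (simp add: linear sym[of y x])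
  with assms show ?thesis by simp
qed

lemma normalize:
  assumes "S x x \<noteq> 0"
  obtains c where "S (scale c x) (scale c x) = 1" 
proof -
  obtain c where "c ^ 2 = 1 / S x x" using nth_root_exists[of 2] by auto
  with assms have "S (scale c x) (scale c x) = 1"
    by (simp add: linear power2_eq_square) (simp add: field_simps)
  then show thesis by (rule that)
qed

text \<open>
  Let \<open>p\<close> be the orthogonal projection to the complement \<open>W\<close> of the vectors \<open>u j\<close>. If \<open>W\<close> has no
  vector of norm different from 0, then \<open>S\<close> vanishes on \<open>W\<close> by polarization, and \<open>S (p x) (p y) =
  0\<close> is the claimed expansion. Otherwise such a vector is normalized by a square root in the
  field.
\<close>

lemma orthogonal_complement:
  assumes u: "orthonormal i u"
  shows "(\<exists>y. S y y = 1 \<and> (\<forall>j<i. S y (u j) = 0)) \<or> sum_of_squares i u"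
proof -
  define W where "W = {x. \<forall>j<i. S x (u j) = 0}"
  define p where "p x = x - (\<Sum>j<i. scale (S x (u j)) (u j))" for x
  have p: "p x \<in> W" for x
  proof -
    have "(\<Sum>j<i. S x (u j) * S (u j) (u k)) = S x (u k)" if k: "k < i" for k
    proof -
      have "(\<Sum>j<i. S x (u j) * S (u j) (u k)) = (\<Sum>j<i. if j = k then S x (u k) else 0)"
        using u k by (intro sum.cong) (auto simp: orthonormal_def)
      with k show ?thesis by simp
    qed
    then show ?thesis by (simp add: W_def p_def linear)
  qed
  show ?thesis
  proof (cases "\<exists>x\<in>W. S x x \<noteq> 0")
    case True
    then obtain x where x: "x \<in> W" "S x x \<noteq> 0" by blast
    then obtain c where "S (scale c x) (scale c x) = 1" using normalize by blast
    moreover have "S (scale c x) (u j) = 0" if "j < i" for j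
      using x that by (simp add: W_def linear)
    ultimately show ?thesis by blast
  next
    case False
    have "S (p x) (p y) = 0" for x y
    proof (rule polarize[of W])
      show "p x + p y \<in> W" using p[of x] p[of y] by (simp add: W_def linear)
    qed (use False p in auto)
    moreover have "S (p x) (p y) = S (p x) y" for x y
    proof -
      have "S (p x) (u j) = 0" if "j < i" for j using p[of x] that by (simp add: W_def)
      then show ?thesis by (subst (2) p_def) (simp add: linear)
    qed
    moreover have "S (p x) y = S x y - (\<Sum>j<i. S x (u j) * S y (u j))" for x y
      by (simp add: p_def linear sym[of "u _" y])
    ultimately have "S x y = (\<Sum>j<i. S x (u j) * S y (u j))" for x y by (metis eq_iff_diff_eq_0)
    then have "sum_of_squares i u" unfolding sum_of_squares_def by blast
    then show ?thesis ..
  qed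
qed

lemma sum_of_squares_pad:
  fixes u :: "nat \<Rightarrow> _"
  assumes "i \<le> r" "sum_of_squares i u"
  shows "\<exists>u. sum_of_squares r u"
  unfolding sum_of_squares_def
proof (intro exI allI)
  fix x y
  have "(\<Sum>j<r. S x (if j < i then u j else 0) * S y (if j < i then u j else 0)) =
    (\<Sum>j<i. S x (if j < i then u j else 0) * S y (if j < i then u j else 0))"
    by (rule sum.mono_neutral_right) (use assms(1) in auto)
  then show "S x y = (\<Sum>j<r. S x (if j < i then u j else 0) * S y (if j < i then u j else 0))"
    using assms(2)[unfolded sum_of_squares_def, rule_format, of x y] by simp
qed

lemma orthonormal_extend:
  assumes "orthonormal i u" "S y y = 1" "\<forall>j<i. S y (u j) = 0"
  shows "orthonormal (Suc i) (u(i := y))"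
  using assms by (auto simp: orthonormal_def less_Suc_eq sym[of "u _" y])

lemma orthonormal_or_sum_of_squares:
  "(\<exists>u. orthonormal (Suc r) u) \<or> (\<exists>u. sum_of_squares r u)"
proof -
  have "(\<exists>u. orthonormal i u) \<or> (\<exists>u. sum_of_squares r u)" if "i \<le> Suc r" for i
    using that
  proof (induction i)
    case 0
    show ?case by (simp add: orthonormal_def)
  next
    case (Suc i)
    show ?case
    proof (cases "\<exists>u. orthonormal i u")
      case True
      then obtain u where u: "orthonormal i u" by blast
      from orthogonal_complement[OF this] show ?thesis
        using orthonormal_extend[OF u] sum_of_squares_pad[of i r u] Suc.prems by auto
    qed (use Suc in auto)
  qed
  then show ?thesis by blast
qed

end

lemma omega_self [simp]: "omega u u = (0::'a::field_char_0)"
  using omega_antisym[of u u] by simp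

abbreviation linear_on :: "('b \<Rightarrow>\<^sub>0 'a::field) set \<Rightarrow> (('b \<Rightarrow>\<^sub>0 'a) \<Rightarrow> 'a) \<Rightarrow> bool" where
  "linear_on W l \<equiv> (\<forall>x\<in>W. \<forall>y\<in>W. l (x + y) = l x + l y) \<and> (\<forall>c. \<forall>x\<in>W. l (scale c x) = c * l x)"

text \<open>
  Finitely many linear conditions leave a hyperbolic pair if there is enough room. Each half of
  the index set supplies a pair that satisfies the first \<open>m\<close> conditions, and the second pair can
  be chosen orthogonal to a given vector \<open>a\<close> of the first one. If condition \<open>m\<close> fails on \<open>a\<close>, then
  subtracting multiples of \<open>a\<close> from the second pair enforces it there and, by orthogonality, does
  not change the value of \<open>omega\<close> on that pair.
\<close>

lemma hyperbolic_pair: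
  fixes W :: "'a::field_char_0 fvec set"
  assumes "vs.subspace W" "\<And>l. l < m \<Longrightarrow> linear_on W (L l)" "card I = 2 ^ m"
    "\<And>i. i \<in> I \<Longrightarrow> Poly_Mapping.single (Inl i) 1 \<in> W \<and> Poly_Mapping.single (Inr i) 1 \<in> W"
  shows "\<exists>z\<in>W. \<exists>z'\<in>W. omega z z' = 1 \<and> (\<forall>l<m. L l z = 0 \<and> L l z' = 0)"
  using assms
proof (induction m arbitrary: I W)
  case 0
  then obtain i where "I = {i}" by (auto simp: card_Suc_eq)
  with 0 show ?case
    by (intro bexI[of _ "Poly_Mapping.single (Inr i) 1"] bexI[of _ "Poly_Mapping.single (Inl i) 1"])
       (auto simp: omega_single_right opp_def omega_sign_def lookup_single when_def)
next
  case (Suc m)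
  let ?e = "\<lambda>a. Poly_Mapping.single a 1 :: 'a fvec"
  note W = Suc.prems(1) and lin = Suc.prems(2)
  have "2 ^ m \<le> card I" using Suc.prems(3) by simp
  then obtain I1 where I1: "I1 \<subseteq> I" "card I1 = 2 ^ m" by (metis obtain_subset_with_card_n)
  have I: "finite I" using Suc.prems(3) by (metis card.infinite power_not_zero zero_neq_numeral)
  define I2 where "I2 = I - I1"
  have I2: "card I2 = 2 ^ m" using I1 I Suc.prems(3) by (simp add: I2_def card_Diff_subset finite_subset)
  define W1 where "W1 = {x \<in> W. \<forall>i\<in>I2. omega x (?e (Inl i)) = 0 \<and> omega x (?e (Inr i)) = 0}"
  have "vs.subspace W1"
    using W unfolding vs.subspace_def W1_def by (auto simp: omega_linear)
  moreover have "?e (Inl i) \<in> W1 \<and> ?e (Inr i) \<in> W1" if "i \<in> I1" for i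
    using that I1 Suc.prems(4)[of i]
    by (auto simp: W1_def I2_def omega_single_right opp_def lookup_single when_def)
  moreover have "linear_on W1 (L l)" if "l < m" for l using lin[of l] that by (auto simp: W1_def)
  ultimately obtain z1 z1' where z1: "z1 \<in> W1" "z1' \<in> W1" "omega z1 z1' = 1" "\<forall>l<m. L l z1 = 0 \<and>
      L l z1' = 0"
    using Suc.IH[of W1 I1] I1(2) by blast
  show ?case
  proof (cases "L m z1 = 0 \<and> L m z1' = 0")
    case True
    with z1 show ?thesis by (auto simp: W1_def less_Suc_eq)
  next
    case False
    then obtain a where a: "a \<in> {z1, z1'}" "L m a \<noteq> 0" by auto
    define W2 where "W2 = {x \<in> W. omega x a = 0}"
    have "vs.subspace W2"
      using W unfolding vs.subspace_def W2_def by (auto simp: omega_linear)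
    moreover have "?e (Inl i) \<in> W2 \<and> ?e (Inr i) \<in> W2" if "i \<in> I2" for i
      using that I1 Suc.prems(4)[of i] a z1 omega_antisym[of a "?e (Inl i)"] omega_antisym[of a "?e (Inr
          i)"]
      by (auto simp: W1_def W2_def I2_def)
    moreover have "linear_on W2 (L l)" if "l < m" for l using lin[of l] that by (auto simp: W2_def)
    ultimately obtain z2 z2' where z2: "z2 \<in> W2" "z2' \<in> W2" "omega z2 z2' = 1" "\<forall>l<m. L l z2 = 0 \<and>
        L l z2' = 0"
      using Suc.IH[of W2 I2] I2 by blast
    define c c' where "c = - (L m z2 / L m a)" and "c' = - (L m z2' / L m a)"
    have aW: "a \<in> W" "\<forall>l<m. L l a = 0" using a(1) z1 by (auto simp: W1_def)
    have z2W: "z2 \<in> W" "z2' \<in> W" "omega z2 a = 0" "omega a z2' = 0"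
      using z2 omega_antisym[of a z2'] by (auto simp: W2_def)
    have in_W: "scale c a \<in> W" "scale c' a \<in> W" using aW W by (auto intro: vs.subspace_scale)
    show ?thesis
    proof (intro bexI conjI allI impI)
      show "omega (z2 + scale c a) (z2' + scale c' a) = 1" using z2 z2W by (simp add: omega_linear)
      fix l assume l: "l < Suc m"
      have "L l (z2 + scale c a) = L l z2 + c * L l a" "L l (z2' + scale c' a) = L l z2' + c' * L l a"
        using lin[OF l] aW z2W in_W by auto
      then show "L l (z2 + scale c a) = 0" "L l (z2' + scale c' a) = 0"
        using l z2 aW a(2) by (auto simp: less_Suc_eq c_def c'_def)
    qed (use z2W in_W W in \<open>auto intro: vs.subspace_add\<close>)
  qed
qed

locale symmetric_form_symplectic = symmetric_form S
  for S :: "'a::{alg_closed_field, field_char_0} fvec \<Rightarrow> 'a fvec \<Rightarrow> 'a"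
begin

definition isotropic :: "nat \<Rightarrow> (nat \<Rightarrow> 'a fvec) \<Rightarrow> bool" where
  "isotropic i u \<longleftrightarrow> (\<forall>j<i. \<forall>k<i. omega (u j) (u k) = 0)"

text \<open>
  Let \<open>W\<close> be the set of vectors that are orthogonal to all \<open>u j\<close> for both forms. A vector of \<open>W\<close>
  of norm different from 0 extends the system directly. If there is none, then \<open>S\<close> vanishes on
  \<open>W\<close>. The vector \<open>y\<close> may violate isotropy, but since the space is infinite-dimensional there is a
  hyperbolic pair \<open>z, z'\<close> in \<open>W\<close> that is orthogonal to \<open>y\<close> for both forms. Adding multiples of \<open>z\<close>
  to the \<open>u j\<close> and a multiple of \<open>z'\<close> to \<open>y\<close> changes no value of \<open>S\<close>, while \<open>omega z z' = 1\<close>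
  allows the values \<open>omega (u j) y\<close> to be cancelled.
\<close>

lemma isotropic_orthonormal_extend:
  assumes u: "orthonormal i u" "isotropic i u" and y: "S y y = 1" "\<forall>j<i. S y (u j) = 0"
  shows "\<exists>u. orthonormal (Suc i) u \<and> isotropic (Suc i) u"
proof -
  define W where "W = {z. \<forall>j<i. S z (u j) = 0 \<and> omega z (u j) = 0}"
  have uu: "S (u j) (u k) = (if j = k then 1 else 0)" "omega (u j) (u k) = 0" if "j < i" "k < i" for j k
    using u that by (auto simp: orthonormal_def isotropic_def)
  show ?thesis
  proof (cases "\<exists>z\<in>W. S z z \<noteq> 0")
    case True
    then obtain z where z: "z \<in> W" "S z z \<noteq> 0" by blast
    then obtain c where c: "S (scale c z) (scale c z) = 1" using normalize by blast
    have "orthonormal (Suc i) (u(i := scale c z))"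
      using z by (intro orthonormal_extend u c) (simp add: W_def linear)
    moreover have "isotropic (Suc i) (u(i := scale c z))"
      using z u omega_antisym[of z "u _"] by (auto simp: W_def isotropic_def less_Suc_eq omega_linear)
    ultimately show ?thesis by blast
  next
    case False
    \<comment> \<open>The conditions of orthogonality to the \<open>u j\<close> and to \<open>y\<close>, for both forms.\<close>
    define L where "L l = (if l < i then S (u l) else if l < 2 * i then omega (u (l - i))
       else if l = 2 * i then S y else omega y)" for l
    have "linear_on UNIV (L l)" for l
      unfolding L_def by (simp add: linear omega_linear)
    then obtain z z' where z: "omega z z' = 1" "\<forall>l<2 * i + 2. L l z = 0 \<and> L l z' = 0"
      using hyperbolic_pair[of UNIV "2 * i + 2" L "{..<2 ^ (2 * i + 2)}"] by auto
    have Sz: "S (u j) x = 0" "omega (u j) x = 0" "S x (u j) = 0" "omega x (u j) = 0" 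
      if j: "j < i" and x: "x \<in> {z, z'}" for x j
    proof -
      have "L j x = 0" "L (i + j) x = 0" using z(2) j x by auto
      with j show "S (u j) x = 0" "omega (u j) x = 0" by (auto simp: L_def)
      then show "S x (u j) = 0" "omega x (u j) = 0" using sym[of x "u j"] omega_antisym[of x "u j"] by auto
    qed
    have Sy: "S y x = 0" "omega y x = 0" "S x y = 0" "omega x y = 0" if x: "x \<in> {z, z'}" for x
    proof -
      have "L (2 * i) x = 0" "L (2 * i + 1) x = 0" using z(2) x by auto
      then show "S y x = 0" "omega y x = 0" by (auto simp: L_def)
      then show "S x y = 0" "omega x y = 0" using sym[of x y] omega_antisym[of x y] by auto
    qed
    have zz: "S x x' = 0" if "x \<in> {z, z'}" "x' \<in> {z, z'}" for x x'
    proof (rule polarize[of W])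
      show "x \<in> W" "x' \<in> W" "x + x' \<in> W" using that Sz by (auto simp: W_def linear omega_linear)
    qed (use False in auto)
    have zz': "omega z' z = -1" using z(1) omega_antisym[of z' z] by simp
    define w where "w j = (if j < i then u j + scale (omega (u j) y) z else y - z')" for j
    have "orthonormal (Suc i) w"
      unfolding orthonormal_def w_def less_Suc_eq
      by (auto simp: linear uu Sz Sy zz y sym[of "u _" y])
    moreover have "isotropic (Suc i) w"
      unfolding isotropic_def w_def less_Suc_eq
      by (auto simp: omega_linear uu Sz Sy zz z(1) zz' omega_antisym[of "u _" y])
    ultimately show ?thesis by blast
  qed
qed

text \<open>
  The dichotomy behind the inclusion of the variety in the rank locus: either \<open>S\<close> has rank at most
  \<open>r\<close>, or its rank exceeds \<open>r\<close> already on an isotropic subspace.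
\<close>

lemma isotropic_orthonormal_or_sum_of_squares:
  "(\<exists>u. orthonormal (Suc r) u \<and> isotropic (Suc r) u) \<or>
   (\<exists>u. sum_of_squares r u)"
proof -
  have "(\<exists>u. orthonormal i u \<and> isotropic i u) \<or> (\<exists>u. sum_of_squares r u)"
    if "i \<le> Suc r" for i
    using that
  proof (induction i)
    case 0
    show ?case by (simp add: orthonormal_def isotropic_def)
  next
    case (Suc i)
    show ?case
    proof (cases "\<exists>u. orthonormal i u \<and> isotropic i u")
      case True
      then obtain u where u: "orthonormal i u" "isotropic i u" by blast
      from orthogonal_complement[OF u(1)] show ?thesis
        using isotropic_orthonormal_extend[OF u] sum_of_squares_pad[of i r u] Suc.prems by auto
    qed (use Suc in auto)
  qed
  then show ?thesis by blast
qed

end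

section \<open>Symplectic matrices of bounded rank\<close>

lemma V_fin_subspace: "vs.subspace (V_fin n)"
  unfolding vs.subspace_def V_fin_def
  by (auto simp: in_keys_iff dest!: set_mp[OF Poly_Mapping.keys_add])

text \<open>
  Since \<open>vs.dim\<close> is 0 on spaces without a finite basis, a bound on \<open>rank_on\<close> is informative only
  together with the finiteness of the basis, which comes from that of \<open>V_fin n\<close>.
\<close>

lemma finite_rank_basis:
  fixes A :: "'a::field fvec \<Rightarrow> 'a fvec"
  assumes A: "A ` V_fin n \<subseteq> V_fin n"
  obtains B where "finite B" "vs.independent B" "A ` V_fin n \<subseteq> vs.span B" "card B = rank_on n A"
proof -
  obtain B where B: "B \<subseteq> A ` V_fin n" "vs.independent B" "A ` V_fin n \<subseteq> vs.span B" "card B = rank_on n A"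
    unfolding rank_on_def using vs.basis_exists by metis
  let ?E = "(\<lambda>b. Poly_Mapping.single b 1) ` idx_upto n :: 'a fvec set"
  have "B \<subseteq> vs.span ?E"
  proof
    fix x assume "x \<in> B"
    then have "keys x \<subseteq> idx_upto n" using B(1) A by (auto simp: V_fin_def)
    then have x: "x = (\<Sum>b\<in>idx_upto n. scale (lookup x b) (Poly_Mapping.single b 1))"
      by (intro vec_expand) auto
    show "x \<in> vs.span ?E"
      by (subst x) (intro vs.span_sum vs.span_scale vs.span_base imageI)
  qed
  then have "finite B" using vs.independent_span_bound[OF _ B(2), of ?E] by auto
  with B that show thesis by blast
qed

lemma mat_vec_cong_keys:
  assumes "keys X \<subseteq> S \<times> S" "\<And>b. b \<in> S \<Longrightarrow> lookup u b = lookup w b"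
  shows "mat_vec X u = mat_vec X w"
  using assms by (fastforce simp: mat_vec_def lin_ext_def case_prod_unfold intro!: sum.cong)

definition trunc :: "nat \<Rightarrow> 'a::field fvec \<Rightarrow> 'a fvec" where
  "trunc n u = (\<Sum>b\<in>idx_upto n. scale (lookup u b) (Poly_Mapping.single b 1))"

lemma lookup_trunc: "lookup (trunc n u) b = (if b \<in> idx_upto n then lookup u b else 0)"
  by (auto simp: trunc_def lookup_sum lookup_single when_def if_distrib cong: if_cong)

lemma trunc_in_V_fin: "trunc n u \<in> V_fin n"
  by (auto simp: V_fin_def in_keys_iff lookup_trunc split: if_splits)

lemma sp_trunc: "X \<in> sp n \<Longrightarrow> mat_vec X (trunc n u) = mat_vec X u"
  by (rule mat_vec_cong_keys[OF sp_keys]) (auto simp: lookup_trunc)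

lemma mat_trace_outer_sum:
  fixes Y :: "'a::field fmat" and h :: "nat \<Rightarrow> 'a fvec"
  shows "mat_trace (mat_mult (\<Sum>j<r. outer (h j) (h j)) Y) = (\<Sum>j<r. omega (h j) (mat_vec Y (h j)))"
proof -
  let ?Z = "mat_mult (\<Sum>j<r. outer (h j) (h j)) Y"
  let ?S = "\<Union>j<r. keys (h j)"
  have Z: "lookup ?Z (a, a) = (\<Sum>j<r. omega (h j) (mat_vec Y (Poly_Mapping.single a 1)) * lookup (h j) a)"
      for a
    by (simp add: lookup_mat_vec_single[symmetric] mat_vec_mat_mult mat_vec_sum mat_vec_outer lookup_sum)
  have "mat_trace ?Z = (\<Sum>a\<in>fst ` keys ?Z \<union> ?S. lookup ?Z (a, a))"
  proof -
    have "mat_trace ?Z = (\<Sum>x\<in>keys ?Z. if fst x = snd x then lookup ?Z x else 0)"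
      unfolding mat_trace_def case_prod_unfold prod.collapse ..
    also have "\<dots> = (\<Sum>x\<in>{x\<in>keys ?Z. fst x = snd x}. lookup ?Z x)"
      by (subst sum.inter_filter) auto
    also have "\<dots> = (\<Sum>a\<in>{a. (a, a) \<in> keys ?Z}. lookup ?Z (a, a))"
      by (rule sum.reindex_bij_witness[of _ "\<lambda>a. (a, a)" fst]) auto
    also have "\<dots> = (\<Sum>a\<in>fst ` keys ?Z \<union> ?S. lookup ?Z (a, a))"
    proof (rule sum.mono_neutral_left)
      show "{a. (a, a) \<in> keys ?Z} \<subseteq> fst ` keys ?Z \<union> ?S"
          by (metis (no_types, lifting) CollectD UnI1 fst_conv image_eqI subsetI)
      show "\<forall>a\<in>(fst ` keys ?Z \<union> ?S) - {a. (a, a) \<in> keys ?Z}. lookup ?Z (a, a) = 0"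
        unfolding in_keys_iff by blast
    qed simp
    finally show ?thesis .
  qed
  also have "\<dots> = (\<Sum>j<r. \<Sum>a\<in>fst ` keys ?Z \<union> ?S. omega (h j) (scale (lookup (h j) a) (mat_vec Y
      (Poly_Mapping.single a 1))))"
    unfolding Z by (subst sum.swap) (simp add: omega_linear mult.commute)
  also have "\<dots> = (\<Sum>j<r. omega (h j) (mat_vec Y (h j)))"
    unfolding omega_sum_right[symmetric]
    by (intro sum.cong refl arg_cong[of _ _ "omega _"] mat_vec_expand[symmetric]) auto
  finally show ?thesis .
qed

text \<open>
  For \<open>X\<close> in the symplectic Lie algebra, \<open>omega (X x) y\<close> is a symmetric form. If \<open>u 0, \<dots>, u r\<close> are
  orthonormal for it, then pairing with the \<open>u k\<close> shows that the \<open>X (u j)\<close> are independent,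
  against the bound on the rank. So the form is a sum of \<open>r\<close> squares \<open>omega (X x) (u j)\<^sup>2\<close>, and
  \<open>omega\<close> is nondegenerate.
\<close>

lemma sp_outer_sum:
  fixes X :: "'a::{alg_closed_field, field_char_0} fmat" and r :: nat
  assumes X: "X \<in> sp n" and rank: "rank_on n (mat_vec X) \<le> r"
  shows "\<exists>h::nat \<Rightarrow> _. X = (\<Sum>j<r. outer (h j) (h j))"
proof -
  have antisym: "omega (mat_vec X x) y = omega (mat_vec X y) x" for x y
    using sp_omega[OF X, of y x] omega_antisym[of "mat_vec X x" y] by simp
  interpret symmetric_form_symplectic "\<lambda>x y. omega (mat_vec X x) y"
    by unfold_locales (rule antisym, simp_all add: omega_linear)
  have "\<not> orthonormal (Suc r) u" for u
  proof
    assume u: "orthonormal (Suc r) u"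
    have uu: "omega (mat_vec X (u j)) (u k) = (if j = k then 1 else 0)" if "j \<le> r" "k \<le> r" for j k
      using u that by (auto simp: orthonormal_def less_Suc_eq_le)
    let ?f = "\<lambda>j. mat_vec X (u j)"
    have inj: "inj_on ?f {..r}"
      by (rule inj_onI) (use uu in \<open>metis atMost_iff zero_neq_one\<close>)
    obtain B where B: "finite B" "mat_vec X ` V_fin n \<subseteq> vs.span B" "card B = rank_on n (mat_vec X)"
    proof (rule finite_rank_basis)
      show "mat_vec X ` V_fin n \<subseteq> V_fin n" using keys_mat_vec[OF sp_keys[OF X]] by (auto simp: V_fin_def)
    qed
    have "vs.independent (?f ` {..r})"
    proof (rule vs.independent_if_scalars_zero)
      fix c x assume sum: "(\<Sum>x\<in>?f ` {..r}. scale (c x) x) = 0" and "x \<in> ?f ` {..r}"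
      then obtain k where k: "k \<le> r" "x = ?f k" by auto
      have "0 = omega (\<Sum>j\<le>r. scale (c (?f j)) (?f j)) (u k)"
        using sum by (simp add: sum.reindex[OF inj])
      also have "\<dots> = (\<Sum>j\<le>r. if j = k then c (?f k) else 0)"
        unfolding omega_linear by (intro sum.cong) (auto simp: uu k)
      finally show "c x = 0" using k by simp
    qed simp
    moreover have "?f ` {..r} \<subseteq> vs.span B"
    proof
      fix x assume "x \<in> ?f ` {..r}"
      then obtain j where "x = mat_vec X (trunc n (u j))" by (auto simp: sp_trunc[OF X])
      then show "x \<in> vs.span B" using B(2) trunc_in_V_fin by blast
    qed
    ultimately have "card (?f ` {..r}) \<le> card B" using vs.independent_span_bound[OF B(1)] by blast
    then show False using rank B(3) inj by (simp add: card_image)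
  qed
  then obtain u where "sum_of_squares r u" using orthonormal_or_sum_of_squares[of r] by blast
  then have u: "omega (mat_vec X x) y = (\<Sum>j<r. omega (mat_vec X x) (u j) * omega (mat_vec X y) (u j))"
      for x y
    unfolding sum_of_squares_def by blast
  have "X = (\<Sum>j<r. outer (mat_vec X (u j)) (mat_vec X (u j)))"
  proof (rule mat_eqI, rule omega_nondegenerate)
    fix x y
    show "omega (mat_vec X x) y = omega (mat_vec (\<Sum>j<r. outer (mat_vec X (u j)) (mat_vec X (u j))) x) y"
      by (subst u) (simp add: mat_vec_sum mat_vec_outer omega_linear antisym[of "u _"])
  qed
  then show ?thesis by (intro exI)
qed

text \<open>
  An eigenspace for \<open>c \<noteq> 0\<close> is isotropic, because \<open>omega u (X w) = - omega (X u) w\<close>. But a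
  subspace that is defined by \<open>r\<close> linear conditions contains a hyperbolic pair as soon as \<open>n\<close> is
  large.
\<close>

lemma eigenvalue_zero:
  fixes X :: "'a::field_char_0 fmat"
  assumes X: "X \<in> sp n" and rank: "rank_on n (\<lambda>u. mat_vec X u - scale c u) \<le> r" and n: "2 ^ r \<le> n"
  shows "c = 0"
proof -
  let ?A = "\<lambda>u. mat_vec X u - scale c u"
  have "?A ` V_fin n \<subseteq> V_fin n"
  proof (clarify, rule vs.subspace_diff[OF V_fin_subspace])
    fix u :: "'a fvec" assume "u \<in> V_fin n"
    then show "scale c u \<in> V_fin n" by (rule vs.subspace_scale[OF V_fin_subspace])
    show "mat_vec X u \<in> V_fin n" using keys_mat_vec[OF sp_keys[OF X]] by (simp add: V_fin_def)
  qed
  then obtain B where B: "finite B" "vs.independent B" "?A ` V_fin n \<subseteq> vs.span B" "card B = rank_on n ?A"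
    by (rule finite_rank_basis)
  obtain b where b: "bij_betw b {..<card B} B" using B(1) ex_bij_betw_nat_finite[of B]
      by (auto simp: atLeast0LessThan)
  define L where "L l u = vs.representation B (?A u) (b l)" for l u
  have lin: "linear_on (V_fin n) (L l)" for l
  proof -
    have "?A (x + y) = ?A x + ?A y" "?A (scale d x) = scale d (?A x)" for x y d
      by (simp_all add: mat_vec_linear scale_add scale_diff mult.commute)
    moreover have "?A x \<in> vs.span B" if "x \<in> V_fin n" for x using B(3) that by auto
    ultimately show ?thesis
      by (simp add: L_def vs.representation_add[OF B(2)] vs.representation_scale[OF B(2)])
  qed
  have "2 ^ card B \<le> (2::nat) ^ r" using rank B(4) by (intro power_increasing) auto
  then have "2 ^ card B \<le> card {..<n}" unfolding card_lessThan using n by (rule le_trans)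
  then obtain I where I: "I \<subseteq> {..<n}" "card I = 2 ^ card B" by (metis obtain_subset_with_card_n)
  obtain z z' where z: "z \<in> V_fin n" "z' \<in> V_fin n" "omega z z' = 1" "\<forall>l<card B. L l z = 0 \<and> L l z' = 0"
  proof -
    have "Poly_Mapping.single (Inl i) 1 \<in> V_fin n \<and> Poly_Mapping.single (Inr i) 1 \<in> V_fin n" if "i \<in> I"
        for i
      using I(1) that by (auto simp: V_fin_def idx_upto_def)
    from hyperbolic_pair[of "V_fin n" "card B" L I, OF V_fin_subspace lin I(2) this] show thesis
      using that by blast
  qed
  have eig: "mat_vec X x = scale c x" if "x \<in> {z, z'}" for x
  proof -
    have "vs.representation B (?A x) d = 0" if "d \<in> B" for d
    proof -
      obtain l where "l < card B" "d = b l" using bij_betw_imp_surj_on[OF b] \<open>d \<in> B\<close> by blast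
      then show ?thesis using z(4) \<open>x \<in> {z, z'}\<close> by (auto simp: L_def)
    qed
    moreover have "?A x \<in> vs.span B" using B(3) z that by auto
    ultimately have "?A x = 0" using vs.sum_representation_eq[OF B(2) _ B(1) order_refl, of "?A x"] by simp
    then show ?thesis by simp
  qed
  have "omega z (scale c z') = - omega (scale c z) z'" using sp_omega[OF X, of z z'] by (simp add: eig)
  then show "c = 0" using z(3) by (simp add: omega_linear)
qed

text \<open>
  This lemma and the next one describe the rank locus without matrices and without the scalar \<open>c\<close>:
  its points are the functionals that on each \<open>sp n\<close> have the form \<open>Y \<mapsto> \<Sum>\<^sub>j omega (h j) (Y (h j))\<close>
  with \<open>r\<close> summands. For small \<open>n\<close> the scalar may be different from 0, so the matrix is taken from
  a larger \<open>sp m\<close>.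
\<close>

lemma rank_le_imp_sum_of_squares:
  fixes \<xi> :: "'a::{alg_closed_field, field_char_0} fmat \<Rightarrow> 'a"
  assumes \<xi>: "\<xi> \<in> sp_inf_rank_le r"
  shows "\<exists>h. \<forall>Y\<in>sp n. \<xi> Y = (\<Sum>j<r. omega (h j) (mat_vec Y (h j)))"
proof -
  define m where "m = max n (2 ^ r)"
  obtain X where X: "X \<in> sp_rank_le m r" "restrict \<xi> (sp m) = trace_dual m X"
    using \<xi> by (auto simp: sp_inf_rank_le_def)
  then obtain c where c: "X \<in> sp m" "rank_on m (\<lambda>u. mat_vec X u - scale c u) \<le> r"
    by (auto simp: sp_rank_le_def)
  then have "c = 0" by (rule eigenvalue_zero) (simp add: m_def)
  with c obtain h where h: "X = (\<Sum>j<r. outer (h j) (h j))" using sp_outer_sum[of X m r] by auto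
  have "\<xi> Y = (\<Sum>j<r. omega (h j) (mat_vec Y (h j)))" if "Y \<in> sp n" for Y
  proof -
    have "Y \<in> sp m" using that sp_mono[of n m] by (auto simp: m_def)
    then have "\<xi> Y = mat_trace (mat_mult X Y)"
      using fun_cong[OF X(2), of Y] by (simp add: trace_dual_def)
    then show ?thesis by (simp add: h mat_trace_outer_sum)
  qed
  then show ?thesis by blast
qed

text \<open>
  The values \<open>omega (h j) (Y (h j))\<close> with \<open>Y \<in> sp n\<close> depend only on the components of the \<open>h j\<close> in
  \<open>V_fin n\<close>; with \<open>h j\<close> replaced by these components, the sum of the \<open>outer (h j) (h j)\<close>
  represents the functional.
\<close>

lemma sum_of_squares_imp_rank_le:
  fixes \<xi> :: "'a::field_char_0 fmat \<Rightarrow> 'a"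
  assumes \<xi>: "\<xi> \<in> dual_space sp_inf"
    and h: "\<And>n. \<exists>h. \<forall>Y\<in>sp n. \<xi> Y = (\<Sum>j<r. omega (h j) (mat_vec Y (h j)))"
  shows "\<xi> \<in> sp_inf_rank_le r"
proof -
  have "restrict \<xi> (sp n) \<in> trace_dual n ` sp_rank_le n r" for n
  proof -
    obtain h where h: "\<And>Y. Y \<in> sp n \<Longrightarrow> \<xi> Y = (\<Sum>j<r. omega (h j) (mat_vec Y (h j)))" using h by blast
    define t where "t j = trunc n (h j)" for j
    let ?X = "\<Sum>j<r. outer (t j) (t j)"
    have t: "t j \<in> V_fin n" for j by (simp add: t_def trunc_in_V_fin)
    have outer: "outer u u = scale (1/2) (sq u u)" for u :: "'a fvec"
      by (simp add: sq_def scale_add flip: scale_add_left)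
    have outer_in: "outer (t j) (t j) \<in> sp n" for j unfolding outer by (intro sp_scale sq_in_sp t)
    have zero: "(0 :: 'a fmat) \<in> sp n" by (simp add: sp_iff)
    have X: "?X \<in> sp n"
      by (induction r) (simp_all add: zero outer_in sp_add)
    have "(\<lambda>u. mat_vec ?X u - scale 0 u) ` V_fin n \<subseteq> vs.span (t ` {..<r})"
    proof (clarify)
      fix x
      have "(\<Sum>j<r. scale (omega (t j) x) (t j)) \<in> vs.span (t ` {..<r})"
        by (intro vs.span_sum vs.span_scale vs.span_base) simp
      then show "mat_vec ?X x - scale 0 x \<in> vs.span (t ` {..<r})"
        by (simp add: mat_vec_sum mat_vec_outer)
    qed
    then have "rank_on n (\<lambda>u. mat_vec ?X u - scale 0 u) \<le> card (t ` {..<r})"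
      unfolding rank_on_def by (rule vs.dim_le_card) simp
    also have "\<dots> \<le> r" using card_image_le[of "{..<r}" t] by simp
    finally have mem: "?X \<in> sp_rank_le n r" using X unfolding sp_rank_le_def by blast
    have "restrict \<xi> (sp n) = trace_dual n ?X"
    proof (rule ext)
      fix Y
      have "omega (h j) (mat_vec Y (h j)) = omega (t j) (mat_vec Y (t j))" if "Y \<in> sp n" for j
        using sp_trunc[OF that, of "h j"] sp_omega[OF that, of "h j" "t j"] sp_omega[OF that, of "t j"
            "t j"]
        by (simp add: t_def)
      then show "restrict \<xi> (sp n) Y = trace_dual n ?X Y"
        by (simp add: trace_dual_def mat_trace_outer_sum h restrict_def)
    qed
    with mem show ?thesis by (rule rev_image_eqI)
  qed
  with \<xi> show ?thesis by (simp add: sp_inf_rank_le_def)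
qed

section \<open>Heisenberg operators on the module\<close>

subsection \<open>Operators on a tensor product\<close>

lemma tensor_single: "tensor (Poly_Mapping.single a 1) (Poly_Mapping.single b 1) =
    Poly_Mapping.single (a, b) 1"
  by (simp add: tensor_def)

lemma tensor_linear:
  "tensor (f + f') g = tensor f g + tensor f' g" "tensor (scale c f) g = scale c (tensor f g)"
  "tensor f (g + g') = tensor f g + tensor f g'" "tensor f (scale c g) = scale c (tensor f g)"
  unfolding tensor_def lin_ext_add lin_ext_scale
  subgoal by (rule refl)
  subgoal by (rule refl)
  subgoal by (simp add: lin_ext_def[of _ f] scale_add sum.distrib)
  subgoal by (simp add: lin_ext_def[of _ f] scale_sum mult.commute)
  done

lift_definition left_op :: "('m, 'a::field) linop \<Rightarrow> ('m \<times> 'n, 'a) linop" is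
  "\<lambda>T. lin_ext (\<lambda>(a, b). tensor (T (Poly_Mapping.single a 1)) (Poly_Mapping.single b 1))"
  by (simp add: lin_ext_add lin_ext_scale)

lift_definition right_op :: "('n, 'a::field) linop \<Rightarrow> ('m \<times> 'n, 'a) linop" is
  "\<lambda>T. lin_ext (\<lambda>(a, b). tensor (Poly_Mapping.single a 1) (T (Poly_Mapping.single b 1)))"
  by (simp add: lin_ext_add lin_ext_scale)

lemma apply_left_op: "apply_op (left_op T) (tensor f g) = tensor (apply_op T f) g"
proof (rule linear_eqI[where f = "\<lambda>f. apply_op (left_op T) (tensor f g)" and g =
    "\<lambda>f. tensor (apply_op T f) g"], goal_cases)
  case (5 a)
  show ?case
  proof (rule linear_eqI[where f = "\<lambda>g. apply_op (left_op T) (tensor (Poly_Mapping.single a 1) g)"],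
      goal_cases)
    case (5 b)
    show ?case by (simp add: tensor_single left_op.rep_eq)
  qed (simp_all add: tensor_linear apply_op_add apply_op_scale)
qed (simp_all add: tensor_linear apply_op_add apply_op_scale)

lemma apply_right_op: "apply_op (right_op T) (tensor f g) = tensor f (apply_op T g)"
proof (rule linear_eqI[where f = "\<lambda>f. apply_op (right_op T) (tensor f g)" and g =
    "\<lambda>f. tensor f (apply_op T g)"], goal_cases)
  case (5 a)
  show ?case
  proof (rule linear_eqI[where f = "\<lambda>g. apply_op (right_op T) (tensor (Poly_Mapping.single a 1) g)"],
      goal_cases)
    case (5 b)
    show ?case by (simp add: tensor_single right_op.rep_eq)
  qed (simp_all add: tensor_linear apply_op_add apply_op_scale)
qed (simp_all add: tensor_linear apply_op_add apply_op_scale)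

lemma linop_eqI_tensor:
  assumes "\<And>f g. apply_op D (tensor f g) = apply_op E (tensor f g)" shows "D = E"
proof (rule linop_eqI_basis)
  fix m :: "'a \<times> 'c"
  show "apply_op D (Poly_Mapping.single m 1) = apply_op E (Poly_Mapping.single m 1)"
    using assms[of "Poly_Mapping.single (fst m) 1" "Poly_Mapping.single (snd m) 1"]
        by (simp add: tensor_single)
qed

lemma left_op_hom:
  "left_op (S + T) = left_op S + left_op T" "left_op (S * T) = left_op S * left_op T"
  "left_op (scal c) = scal c" 
  by (rule linop_eqI_tensor; simp add: apply_left_op tensor_linear)+

lemma right_op_hom:
  "right_op (S + T) = right_op S + right_op T" "right_op (S * T) = right_op S * right_op T"
  "right_op (scal c) = scal c" 
  by (rule linop_eqI_tensor; simp add: apply_right_op tensor_linear)+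

lemma left_op_zero [simp]: "left_op 0 = 0" "left_op 1 = 1" 
  and right_op_zero [simp]: "right_op 0 = 0" "right_op 1 = 1" 
  using left_op_hom(3)[of 0] right_op_hom(3)[of 0] left_op_hom(3)[of 1] right_op_hom(3)[of 1]
  by (simp_all add: scal_simps)

lemma left_op_sum: "left_op (sum f A) = (\<Sum>x\<in>A. left_op (f x))"
  by (induction A rule: infinite_finite_induct) (auto simp: left_op_hom)

lemma right_op_sum: "right_op (sum f A) = (\<Sum>x\<in>A. right_op (f x))"
  by (induction A rule: infinite_finite_induct) (auto simp: right_op_hom)

lemma left_op_lin_op: "left_op (lin_op f p) = lin_op (\<lambda>b. left_op (f b)) p"
  and right_op_lin_op: "right_op (lin_op f p) = lin_op (\<lambda>b. right_op (f b)) p"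
  by (simp_all add: lin_op_def left_op_sum right_op_sum left_op_hom right_op_hom)

lemma comm_left_left: "comm (left_op S) (left_op T) = left_op (comm S T)"
  by (rule linop_eqI_tensor)
     (simp add: comm_def apply_left_op, metis tensor_linear(1) add_diff_cancel_right' diff_add_cancel)

lemma comm_right_right: "comm (right_op S) (right_op T) = right_op (comm S T)"
  by (rule linop_eqI_tensor)
     (simp add: comm_def apply_right_op, metis tensor_linear(3) add_diff_cancel_right' diff_add_cancel)

lemma comm_left_right: "comm (left_op S) (right_op T) = 0" "comm (right_op T) (left_op S) = 0"
  by (rule linop_eqI_tensor; simp add: comm_def apply_left_op apply_right_op)+

subsection \<open>The Heisenberg relations\<close>

lift_definition pvar_op :: "'i \<Rightarrow> ('i \<Rightarrow>\<^sub>0 nat, 'a::field) linop" is "\<lambda>i p. pvar i * p"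
  by (simp add: distrib_left mult_scale)

lift_definition pdiff_op :: "'i \<Rightarrow> ('i \<Rightarrow>\<^sub>0 nat, 'a::field) linop" is "pdiff"
  by (simp add: pdiff_add pdiff_scale)

lift_definition weyl_op :: "idx \<Rightarrow> (nat \<Rightarrow>\<^sub>0 nat, 'a::field) linop" is weyl_gen
  by (simp add: weyl_gen_lin)

lemma comm_pdiff_pvar: "comm (pdiff_op i) (pvar_op j) = (if i = j then 1 else 0)"
  and comm_pvar_pvar: "comm (pvar_op i) (pvar_op j) = 0"
  and comm_pdiff_pdiff: "comm (pdiff_op i) (pdiff_op j) = 0"
  by (rule linop_eqI; simp add: comm_def pdiff_op.rep_eq pvar_op.rep_eq pdiff_pvar pdiff_commute[of i j]
      mult.left_commute)+

lemma comm_weyl_op: "comm (weyl_op a) (weyl_op b) = scal (omega_basis a b)"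
  by (rule linop_eqI) (simp add: comm_def weyl_op.rep_eq weyl_gen_comm[of a b])

type_synonym 'a module_op = "((idx \<times> nat \<Rightarrow>\<^sub>0 nat) \<times> (nat \<Rightarrow>\<^sub>0 nat), 'a) linop"

text \<open>
  The three families of operators that generate the Weyl algebra of the module: multiplication by
  the variable \<open>u \<otimes> e\<^sub>k\<close>, the derivation dual to it, and the element \<open>u\<close> of the Weyl algebra
  acting on the second tensor factor. The sign in \<open>D_op\<close> identifies \<open>V\<close> with its dual by \<open>omega\<close>,
  so that all nonzero commutators are values of \<open>omega\<close> and all three families are equivariant.
\<close>

definition Y_op :: "nat \<Rightarrow> 'a fvec \<Rightarrow> 'a::field module_op" where
  "Y_op k = lin_op (\<lambda>a. left_op (pvar_op (a, k)))"

definition D_op :: "nat \<Rightarrow> 'a fvec \<Rightarrow> 'a::field module_op" where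
  "D_op k = lin_op (\<lambda>a. scal (omega_sign (opp a)) * left_op (pdiff_op (opp a, k)))"

definition W_op :: "'a fvec \<Rightarrow> 'a::field module_op" where
  "W_op = lin_op (\<lambda>a. right_op (weyl_op a))"

lemma comm_lin_op_lin_op: "comm (lin_op f u) (lin_op g w) = lin_op (\<lambda>a. lin_op (\<lambda>b. comm (f a) (g b)) w) u"
  by (simp only: comm_lin_op(2)) (simp only: comm_lin_op(1))

lemma comm_lin_op_omega:
  assumes "\<And>a b. comm (f a) (g b) = scal (omega_basis a b)"
  shows "comm (lin_op f u) (lin_op g w) = scal (omega u w)"
  unfolding comm_lin_op_lin_op assms
  unfolding lin_op_def omega_def scal_sum sum_distrib_left
  by (simp add: mult.assoc flip: scal_simps(4))

lemma comm_lin_op_zero: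
  assumes "\<And>a b. comm (f a) (g b) = 0"
  shows "comm (lin_op f u) (lin_op g w) = 0"
  by (simp add: comm_lin_op_lin_op assms) (simp add: lin_op_def)

lemma heisenberg:
  "comm (D_op k u) (Y_op l w) = (if k = l then scal (omega u w) else 0)"
  "comm (Y_op k u) (D_op l w) = (if k = l then scal (omega u w) else 0)"
  "comm (W_op u) (W_op w) = scal (omega u w)"
  "comm (Y_op k u) (Y_op l w) = 0" "comm (D_op k u) (D_op l w) = 0"
  "comm (Y_op k u) (W_op w) = 0" "comm (D_op k u) (W_op w) = 0"
  "comm (W_op w) (Y_op k u) = 0" "comm (W_op w) (D_op k u) = 0"
proof -
  have DY: "comm (D_op k u) (Y_op l w) = (if k = l then scal (omega u w) else 0)" for k l u w
  proof (cases "k = l")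
    case True
    have "comm (D_op k u) (Y_op k w) = scal (omega u w)"
      unfolding D_op_def Y_op_def
    proof (rule comm_lin_op_omega)
      \<comment> \<open>On basis vectors, the sign in \<open>D_op\<close> is the sign in \<open>omega_basis\<close>.\<close>
      fix a b :: idx
      have "opp a = b \<longleftrightarrow> a = opp b" by (metis opp_omega_sign(1))
      then show "comm (scal (omega_sign (opp a)) * left_op (pdiff_op (opp a, k))) (left_op (pvar_op (b,
          k))) = scal (omega_basis a b)"
        by (simp add: comm_left_left comm_pdiff_pvar omega_basis_eq scal_simps comm_simps)
    qed
    with True show ?thesis by simp
  next
    case False
    then show ?thesis unfolding D_op_def Y_op_def
      by (simp add: comm_lin_op_zero comm_left_left comm_pdiff_pvar)
  qed
  show "comm (D_op k u) (Y_op l w) = (if k = l then scal (omega u w) else 0)" by (rule DY)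
  have "comm (Y_op k u) (D_op l w) = - (if l = k then scal (omega w u) else 0)"
    by (simp only: comm_antisym[of "Y_op k u"] DY)
  then show "comm (Y_op k u) (D_op l w) = (if k = l then scal (omega u w) else 0)"
    using omega_antisym[of w u] by (auto simp: scal_simps)
  show "comm (W_op u) (W_op w) = scal (omega u w)"
    unfolding W_op_def by (rule comm_lin_op_omega) (simp add: comm_right_right comm_weyl_op right_op_hom)
qed (unfold Y_op_def D_op_def W_op_def, (rule comm_lin_op_zero,
      simp add: comm_left_left comm_left_right comm_pvar_pvar comm_pdiff_pdiff)+)

lemma gen_op_linear:
  "Y_op k (u + w) = Y_op k u + Y_op k w" "Y_op k (scale c u) = scal c * Y_op k u" "Y_op k 0 = 0"
  "D_op k (u + w) = D_op k u + D_op k w" "D_op k (scale c u) = scal c * D_op k u" "D_op k 0 = 0"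
  "W_op (u + w) = W_op u + W_op w" "W_op (scale c u) = scal c * W_op u" "W_op 0 = 0"
  by (simp_all add: Y_op_def D_op_def W_op_def lin_op_add lin_op_scale)

subsection \<open>The action of the symplectic Lie algebra\<close>

definition act_op :: "nat \<Rightarrow> 'a::field fmat \<Rightarrow> 'a module_op" where
  "act_op v = lin_op (\<lambda>(a, b).
     (\<Sum>k<v. left_op (pvar_op (a, k)) * left_op (pdiff_op (b, k)))
      + scal (1/2) * (right_op (weyl_op a) * (scal (omega_sign b) * right_op (weyl_op (opp b)))))"

lemma apply_act_op: "apply_op (act_op v X) = tensor_act (sym_act v) weyl_act X"
proof -
  define S :: "(idx \<times> nat \<Rightarrow>\<^sub>0 nat, 'a) linop"
      where "S = lin_op (\<lambda>(a, b). \<Sum>k<v. pvar_op (a, k) * pdiff_op (b, k)) X"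
  define W :: "(nat \<Rightarrow>\<^sub>0 nat, 'a) linop" where "W =
      scal (1/2) * lin_op (\<lambda>(a, b). weyl_op a * (scal (omega_sign b) * weyl_op (opp b))) X"
  have S: "apply_op S p = sym_act v X p" for p
    by (simp add: S_def sym_act_def apply_lin_op case_prod_unfold pvar_op.rep_eq pdiff_op.rep_eq)
  have W: "apply_op W p = weyl_act X p" for p
    by (simp add: W_def weyl_act_def apply_lin_op case_prod_unfold weyl_op.rep_eq weyl_dual_eq)
  have "act_op v X = left_op S + right_op W"
    by (simp add: act_op_def S_def W_def left_op_lin_op right_op_lin_op left_op_hom right_op_hom left_op_sum
        case_prod_unfold lin_op_op_add lin_op_op_scal)
  then show ?thesis
    by (simp add: fun_eq_iff tensor_act_def left_op.rep_eq right_op.rep_eq case_prod_unfold S W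
        lin_ext_def scale_add sum.distrib)
qed

lemma act_op_linear: "act_op v (X + Y) = act_op v X + act_op v Y" "act_op v (scale c X) =
    scal c * act_op v X"
  by (simp_all add: act_op_def lin_op_add lin_op_scale)

lemma lin_op_times: "lin_op f u * lin_op g w = lin_op (\<lambda>a. lin_op (\<lambda>b. f a * g b) w) u"
  by (simp only: lin_op_mult_left) (simp only: lin_op_mult_right)

lemma act_op_outer: "act_op v (outer u w) = (\<Sum>k<v. Y_op k u * D_op k w) + scal (1/2) * (W_op u * W_op w)"
proof -
  have [simp]: "scal c * scal d = scal (c * d)" for c d :: 'a by (simp add: scal_simps)
  have sign: "scal (- omega_sign b) * (scal (1/2) * (A * (scal (- omega_sign b) * B))) =
      scal (1/2) * (A * B)"
    for A B :: "'a module_op" and b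
  proof -
    have "scal (- omega_sign b) * (scal (1/2) * (A * (scal (- omega_sign b) * B))) =
      (scal (- omega_sign b) * scal (1/2) * scal (- omega_sign b)) * (A * B)"
      by (simp only: scal_left_commute[of A] mult.assoc)
    also have "scal (- omega_sign b) * scal (1/2) * scal (- omega_sign b) = (scal (1/2) :: 'a module_op)"
      by (simp add: mult.commute)
    finally show ?thesis .
  qed
  show ?thesis
    unfolding act_op_def outer_def lin_op_lin_ext Y_op_def D_op_def W_op_def lin_op_times
    by (simp add: sign distrib_left sum_distrib_left scal_left_commute[of "left_op _"] lin_op_op_add
        lin_op_op_sum lin_op_op_scal
          flip: scal_simps(4))
qed

lemma act_op_sq: "act_op v (sq u w) =
    (\<Sum>k<v. Y_op k u * D_op k w + Y_op k w * D_op k u) + scal (1/2) * (W_op u * W_op w + W_op w * W_op u)"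
  by (simp add: sq_def act_op_linear act_op_outer sum.distrib distrib_left)

text \<open>
  On \<open>sq x y\<close> this follows from the Heisenberg relations alone: the commutator of a quadratic
  expression with \<open>u\<close> pairs \<open>u\<close> with one factor and keeps the other, which is the action of \<open>sq x
  y\<close> on \<open>u\<close>.
\<close>

lemma comm_act_op:
  fixes X :: "'a::field_char_0 fmat"
  assumes "X \<in> sp_inf"
  shows "k < v \<Longrightarrow> comm (act_op v X) (Y_op k u) = Y_op k (mat_vec X u)"
    and "k < v \<Longrightarrow> comm (act_op v X) (D_op k u) = D_op k (mat_vec X u)"
    and "comm (act_op v X) (W_op u) = W_op (mat_vec X u)"
  using assms
proof (induction X rule: sp_inf_induct)
  case (sq x y)
  have d: "(\<Sum>l<v. if l = k then c * f l else 0) = c * f k" if "k < v" for c and f :: "nat \<Rightarrow> 'a module_op"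
    using that by simp
  {
    case 1
    then show ?case
      by (simp add: act_op_sq comm_simps comm_sum heisenberg mat_vec_sq gen_op_linear sum.distrib
          scal_central
          if_distrib[of "\<lambda>z. z * _"] if_distrib[of "\<lambda>z. _ * z"] cong: if_cong)
  next
    case 2
    then show ?case
      by (simp add: act_op_sq comm_simps comm_sum heisenberg mat_vec_sq gen_op_linear sum.distrib
          scal_central
          if_distrib[of "\<lambda>z. z * _"] if_distrib[of "\<lambda>z. _ * z"] add.commute cong: if_cong)
  next
    case 3
    have h: "scal (1/2) * (A + A) = A" for A :: "'a module_op"
      by (rule linop_eqI) (simp add: scale_add flip: scale_add_left)
    have "comm (act_op v (sq x y)) (W_op u) =
        scal (1/2) * ((scal (omega y u) * W_op x + scal (omega x u) * W_op y) + (scal (omega y u) * W_op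
            x + scal (omega x u) * W_op y))"
      by (simp add: act_op_sq comm_simps comm_sum heisenberg scal_central ac_simps)
    then show ?case unfolding h by (simp add: mat_vec_sq gen_op_linear)
  }
qed (auto simp: act_op_linear comm_simps mat_vec_linear gen_op_linear)

text \<open>
  The commutator with \<open>act_op v X\<close> is a derivation; by equivariance it replaces \<open>u\<close> and \<open>w\<close> in
  \<open>act_op v (sq u w)\<close> by \<open>X u\<close> and \<open>X w\<close>, as the bracket with \<open>X\<close> does.
\<close>

lemma act_op_bracket:
  fixes X Y :: "'a::field_char_0 fmat"
  assumes X: "X \<in> sp_inf" and Y: "Y \<in> sp_inf"
  shows "act_op v (mat_bracket X Y) = act_op v X * act_op v Y - act_op v Y * act_op v X"
proof -
  have "comm (act_op v X) (act_op v Y) = act_op v (mat_bracket X Y)"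
    using Y
  proof (induction Y rule: sp_inf_induct)
    case (sq u w)
    show ?case
      by (simp add: act_op_sq bracket_sq[OF X] act_op_linear comm_simps comm_sum comm_act_op[OF X]
          sum.distrib algebra_simps)
  next
    case (add Y Z)
    have "mat_bracket X (Y + Z) = mat_bracket X Y + mat_bracket X Z"
      by (rule mat_eqI) (simp add: mat_vec_mat_bracket mat_vec_linear)
    with add show ?case by (simp add: act_op_linear comm_simps)
  next
    case (scale c Y)
    have "mat_bracket X (scale c Y) = scale c (mat_bracket X Y)"
      by (rule mat_eqI) (simp add: mat_vec_mat_bracket mat_vec_linear scale_diff)
    with scale show ?case by (simp add: act_op_linear comm_simps)
  qed
  then show ?thesis by (simp add: comm_def)
qed

section \<open>Symbols by iterated commutators\<close>

text \<open>
  Let \<open>z\<close> be a linear combination of Heisenberg operators. If \<open>D\<close> is a polynomial of degree at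
  most \<open>d\<close> in the Heisenberg operators, then each commutator with \<open>z\<close> lowers the degree, and the
  \<open>d\<close>-fold commutator is \<open>fact d\<close> times the value at \<open>z\<close> of the principal symbol of \<open>D\<close>. Taking
  this as the definition avoids normal forms and filtrations on the Weyl algebra, and it makes
  evident that an operator that vanishes has symbol 0.
\<close>

definition has_symbol :: "('m, 'a::field_char_0) linop \<Rightarrow> nat \<Rightarrow> ('m, 'a) linop \<Rightarrow> 'a \<Rightarrow> bool" where
  "has_symbol z d D c \<longleftrightarrow> (comm z ^^ d) D = scal (fact d * c)"

lemma funpow_comm_linear:
  "(comm z ^^ n) (D + E) = (comm z ^^ n) D + (comm z ^^ n) (E :: ('m, 'a::field_char_0) linop)"
  "(comm z ^^ n) (scal c * D) = scal c * (comm z ^^ n) D" "(comm z ^^ n) 0 = 0"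
  by (induction n) (simp_all add: comm_simps)

lemma has_symbol_add: "has_symbol z d D c \<Longrightarrow> has_symbol z d E e \<Longrightarrow> has_symbol z d (D + E) (c + e)"
  by (simp add: has_symbol_def funpow_comm_linear distrib_left scal_simps)

lemma has_symbol_scal: "has_symbol z d D c \<Longrightarrow> has_symbol z d (scal e * D) (e * c)"
  by (simp add: has_symbol_def funpow_comm_linear mult.left_commute scal_simps)

lemma has_symbol_sum:
  "(\<And>x. x \<in> A \<Longrightarrow> has_symbol z d (D x) (c x)) \<Longrightarrow> has_symbol z d (sum D A) (sum c A)"
proof (induction A rule: infinite_finite_induct)
  case (insert x A)
  then show ?case by (simp add: has_symbol_add)
qed (simp_all add: has_symbol_def funpow_comm_linear scal_simps)

lemma has_symbol_comm: "has_symbol z (Suc d) D c \<longleftrightarrow> has_symbol z d (comm z D) (of_nat (Suc d) * c)"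
  by (simp add: has_symbol_def funpow_Suc_right mult.assoc mult.left_commute del: funpow.simps)

text \<open>
  Symbols are multiplicative by the Leibniz rule. The induction on \<open>d + e\<close> applies the derivation
  once, \<open>[z, D E] = [z, D] E + D [z, E]\<close>, and the two contributions \<open>d c c'\<close> and \<open>e c c'\<close> add up
  to \<open>(d + e) c c'\<close>, so binomial coefficients do not appear.
\<close>

lemma has_symbol_mult:
  "has_symbol z d D c \<Longrightarrow> has_symbol z e E c' \<Longrightarrow> has_symbol z (d + e) (D * E) (c * c')"
proof (induction "d + e" arbitrary: d e D E c c')
  case 0
  then show ?case by (simp add: has_symbol_def scal_simps)
next
  case (Suc n)
  show ?case
  proof (cases "d = 0 \<or> e = 0")
    case True
    then show ?thesis
    proof
      assume [simp]: "d = 0"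
      then have "D = scal c" using Suc.prems by (simp add: has_symbol_def)
      with Suc.prems show ?thesis by (simp add: has_symbol_scal)
    next
      assume [simp]: "e = 0"
      then have "E = scal c'" using Suc.prems by (simp add: has_symbol_def)
      with Suc.prems show ?thesis using has_symbol_scal[of z d D c c']
          by (simp add: scal_central mult.commute)
    qed
  next
    case False
    then obtain d' e' where [simp]: "d = Suc d'" "e = Suc e'" by (metis not0_implies_Suc)
    have n: "n = d' + e" "n = d + e'" using Suc.hyps(2) by simp_all
    have "has_symbol z n (comm z D * E) (of_nat d * c * c')"
      unfolding n(1) using Suc.prems by (intro Suc.hyps(1) n) (simp_all add: has_symbol_comm)
    moreover have "has_symbol z n (D * comm z E) (c * (of_nat e * c'))"
      unfolding n(2) using Suc.prems by (intro Suc.hyps(1) n) (simp_all add: has_symbol_comm)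
    ultimately have "has_symbol z n (comm z (D * E)) (of_nat d * c * c' + c * (of_nat e * c'))"
      unfolding comm_simps by (rule has_symbol_add)
    also have "of_nat d * c * c' + c * (of_nat e * c') = of_nat (Suc n) * (c * c')"
      by (simp only: Suc.hyps(2)) (simp add: algebra_simps)
    finally show ?thesis by (simp only: has_symbol_comm flip: Suc.hyps(2))
  qed
qed

lemma has_symbol_higher:
  assumes "has_symbol z d D c" "d < e" shows "has_symbol z e D 0"
proof -
  obtain k where e: "e = k + Suc d" using assms(2) by (metis add.commute add_Suc_right less_iff_Suc_add)
  have "(comm z ^^ Suc d) D = 0" using assms(1) by (simp add: has_symbol_def)
  then show ?thesis by (simp only: has_symbol_def e funpow_add o_apply funpow_comm_linear mult_zero_right
      scal_simps)
qed

lemma has_symbol_prod_list: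
  assumes "\<And>x. x \<in> set w \<Longrightarrow> has_symbol z d (R x) (\<mu> x)"
  shows "has_symbol z (length w * d) (prod_list (map R w)) (prod_list (map \<mu> w))"
  using assms
proof (induction w)
  case Nil
  show ?case by (simp add: has_symbol_def scal_simps)
next
  case (Cons x w)
  then show ?case by (auto intro: has_symbol_mult)
qed

section \<open>Operators that preserve the module\<close>

abbreviation module_space :: "nat \<Rightarrow> ((idx \<times> nat \<Rightarrow>\<^sub>0 nat) \<times> (nat \<Rightarrow>\<^sub>0 nat) \<Rightarrow>\<^sub>0 'a::field) set" where
  "module_space v \<equiv> tensor_space (sym_module v) UNIV"

text \<open>
  The module is only a subspace of the space on which the operators are defined: it involves the
  variables \<open>(a, k)\<close> with \<open>k < v\<close>. Iterated commutators with \<open>z\<close> of an operator that kills the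
  module kill it again, provided that \<open>z\<close> maps the module to itself.
\<close>

definition preserves :: "('m, 'a::field) linop \<Rightarrow> ('m \<Rightarrow>\<^sub>0 'a) set \<Rightarrow> bool" where
  "preserves D M \<longleftrightarrow> (\<forall>m\<in>M. apply_op D m \<in> M)"

lemma module_space_subspace: "vs.subspace (module_space v)"
  unfolding tensor_space_def by (rule vs.subspace_span)

lemma preserves_add: "vs.subspace M \<Longrightarrow> preserves D M \<Longrightarrow> preserves E M \<Longrightarrow> preserves (D + E) M"
  by (simp add: preserves_def vs.subspace_add)

lemma preserves_sum: "vs.subspace M \<Longrightarrow> (\<And>x. x \<in> A \<Longrightarrow> preserves (f x) M) \<Longrightarrow> preserves (sum f A) M"
  by (simp add: preserves_def vs.subspace_sum)

lemma preserves_scal: "vs.subspace M \<Longrightarrow> preserves D M \<Longrightarrow> preserves (scal c * D) M"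
  by (simp add: preserves_def vs.subspace_scale)

lemma preserves_lin_op: "vs.subspace M \<Longrightarrow> (\<And>b. preserves (f b) M) \<Longrightarrow> preserves (lin_op f u) M"
  unfolding lin_op_def by (intro preserves_sum preserves_scal)

lemma preserves_tensor_spaceI:
  fixes D :: "('m \<times> 'n, 'a::field) linop"
  assumes "\<And>f g. f \<in> M \<Longrightarrow> apply_op D (tensor f g) \<in> tensor_space M UNIV"
  shows "preserves D (tensor_space M UNIV)"
  unfolding preserves_def
proof
  fix m assume m: "m \<in> tensor_space M (UNIV :: ('n \<Rightarrow>\<^sub>0 'a) set)"
  show "apply_op D m \<in> tensor_space M UNIV"
    using m unfolding tensor_space_def
  proof (induction rule: vs.span_induct_alt)
    case (step c x y)
    then show ?case
      using assms by (auto simp: apply_op_add apply_op_scale tensor_space_def intro!: vs.span_add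
          vs.span_scale)
  qed (simp add: vs.span_zero)
qed

lemma preserves_left_op:
  assumes "preserves T M" shows "preserves (left_op T) (tensor_space M UNIV)"
  by (rule preserves_tensor_spaceI)
     (use assms in \<open>auto simp: apply_left_op preserves_def tensor_space_def intro!: vs.span_base\<close>)

lemma preserves_right_op: "preserves (right_op T) (tensor_space M UNIV)"
  by (rule preserves_tensor_spaceI)
     (auto simp: apply_right_op tensor_space_def intro!: vs.span_base)

lemma preserves_pvar_op: 
  assumes "k < v" shows "preserves (pvar_op (a, k)) (sym_module v)"
  unfolding preserves_def
proof
  fix p :: "(idx \<times> nat, 'a) mpoly" assume p: "p \<in> sym_module v"
  show "apply_op (pvar_op (a, k)) p \<in> sym_module v"
    unfolding sym_module_def
  proof (intro CollectI ballI)
    fix m assume "m \<in> keys (apply_op (pvar_op (a, k)) p)"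
    then have "m \<in> keys (pvar (a, k) * p)" by (simp add: pvar_op.rep_eq)
    then obtain m' where m: "m' \<in> keys p" "m = Poly_Mapping.single (a, k) 1 + m'"
      using Poly_Mapping.keys_mult[of "pvar (a, k)" p] by (auto simp: pvar_def)
    then have "keys m' \<subseteq> UNIV \<times> {..<v}" using p by (auto simp: sym_module_def)
    moreover have "keys m \<subseteq> {(a, k)} \<union> keys m'"
      unfolding m(2) using Poly_Mapping.keys_add[of "Poly_Mapping.single (a, k) 1" m'] by auto
    ultimately show "keys m \<subseteq> UNIV \<times> {..<v}" using assms by auto
  qed
qed

lemma preserves_pdiff_op: "preserves (pdiff_op i) (sym_module v)"
  unfolding preserves_def
proof
  fix p :: "(idx \<times> nat, 'a) mpoly" assume p: "p \<in> sym_module v"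
  show "apply_op (pdiff_op i) p \<in> sym_module v"
    unfolding sym_module_def
  proof (intro CollectI ballI)
    fix m assume "m \<in> keys (apply_op (pdiff_op i) p)"
    then have "(\<Sum>m'\<in>keys p. lookup p m' * (of_nat (lookup m' i) when m' - Poly_Mapping.single i 1 = m)) \<noteq> 0"
      by (simp only: pdiff_op.rep_eq pdiff_def lin_ext_def lookup_sum lookup_scale lookup_single
          in_keys_iff not_False_eq_True)
    then obtain m' where "m' \<in> keys p" "lookup p m' * (of_nat (lookup m' i) when m' - Poly_Mapping.single
        i 1 = m) \<noteq> 0"
      by (rule sum.not_neutral_contains_not_neutral)
    then have "m' \<in> keys p" "m' - Poly_Mapping.single i 1 = m" by (auto simp: when_def split: if_splits)
    moreover from this have "keys m \<subseteq> keys m'" by (auto simp: in_keys_iff lookup_minus)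
    ultimately show "keys m \<subseteq> UNIV \<times> {..<v}" using p by (auto simp: sym_module_def)
  qed
qed

lemma preserves_gen_op:
  "k < v \<Longrightarrow> preserves (Y_op k u) (module_space v)" "preserves (D_op k u) (module_space v)" 
  "preserves (W_op u) (module_space v)"
  unfolding Y_op_def D_op_def W_op_def
  by (intro preserves_lin_op preserves_scal module_space_subspace preserves_left_op preserves_right_op
      preserves_pvar_op preserves_pdiff_op; assumption)+

lemma preserves_comm_funpow_zero:
  assumes z: "preserves z M" and D: "\<And>m. m \<in> M \<Longrightarrow> apply_op D m = 0" and m: "m \<in> M"
  shows "apply_op ((comm z ^^ n) D) m = 0"
  using m
proof (induction n arbitrary: m)
  case (Suc n)
  then show ?case using z by (simp add: comm_def preserves_def)
qed (simp add: D)

lemma module_space_nonzero: "\<exists>m\<in>module_space v. m \<noteq> (0 :: _ \<Rightarrow>\<^sub>0 'a::field)"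
proof
  show "tensor (Poly_Mapping.single 0 1) (Poly_Mapping.single 0 1) \<in> module_space v"
    unfolding tensor_space_def
    by (intro vs.span_base CollectI exI[of _ "Poly_Mapping.single 0 1"] conjI refl) (simp_all add:
        sym_module_def)
  show "tensor (Poly_Mapping.single 0 1) (Poly_Mapping.single 0 1) \<noteq> (0 :: _ \<Rightarrow>\<^sub>0 'a)"
    unfolding tensor_single by (metis lookup_single_eq lookup_zero zero_neq_one)
qed

lemma symbol_of_annihilating_operator:
  assumes "has_symbol z d D c" "preserves z M" "\<And>m. m \<in> M \<Longrightarrow> apply_op D m = 0" "\<exists>m\<in>M. m \<noteq> 0"
  shows "c = 0"
proof -
  obtain m where m: "m \<in> M" "m \<noteq> 0" using assms(4) by blast
  have "scale (fact d * c) m = 0"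
    using preserves_comm_funpow_zero[OF assms(2,3) m(1), of d] assms(1) by (simp add: has_symbol_def)
  then have "fact d * c = 0" using m(2) by (auto simp: poly_mapping_eq_iff fun_eq_iff)
  then show ?thesis by simp
qed

section \<open>The moment map\<close>

lemma sum_lessThan_double_Suc:
  fixes f :: "nat \<Rightarrow> 'b::comm_monoid_add"
  shows "(\<Sum>j<2 * v + 1. f j) = (\<Sum>k<v. f k) + (\<Sum>k<v. f (v + k)) + f (2 * v)"
proof -
  have "(\<Sum>j<v + n. f j) = (\<Sum>k<v. f k) + (\<Sum>k<n. f (v + k))" for n
    by (induction n) (simp_all add: ac_simps)
  from this[of v] show ?thesis by (simp add: mult_2)
qed

text \<open>
  The map from \<open>z\<close> to the functional that sends \<open>Y\<close> to the symbol of \<open>act_op v Y\<close> at \<open>z\<close> is the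
  moment map of the module, and its image is the whole set of sums of \<open>2 v + 1\<close> squares. The
  double commutator of \<open>act_op v Y\<close> with \<open>z\<close> is \<open>-2 \<Sum>\<^sub>k omega (q k) (Y (p k)) - omega u (Y u)\<close>.
  Over an algebraically closed field, two squares form a product \<open>h\<^sup>2 + h'\<^sup>2 = (h + i h') (h - i
  h')\<close>, so each pair \<open>p k, q k\<close> accounts for two squares and \<open>u\<close> for the last one.
\<close>

lemma sum_of_squares_is_symbol:
  fixes h :: "nat \<Rightarrow> 'a::{alg_closed_field, field_char_0} fvec"
  shows "\<exists>z. preserves z (module_space v) \<and>
     (\<forall>Y\<in>sp_inf. has_symbol z 2 (act_op v Y) (\<Sum>j<2 * v + 1. omega (h j) (mat_vec Y (h j))))"
proof -
  obtain i s :: 'a where i: "i ^ 2 = -1" and s: "s ^ 2 = -2"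
    using nth_root_exists[of 2] by (metis zero_less_numeral)
  \<comment> \<open>The signs make up for the minus signs in the double commutator, and \<open>s\<^sup>2 = -2\<close> for the missing factor 2.\<close>
  define p q where "p k = h k + scale i (h (v + k))" and "q k = scale i (h (v + k)) - h k" for k
  define u where "u = scale s (h (2 * v))"
  define z where "z = (\<Sum>k<v. Y_op k (p k) + D_op k (q k)) + W_op u"
  have "preserves z (module_space v)"
    unfolding z_def by (intro preserves_add preserves_sum preserves_gen_op module_space_subspace) auto
  moreover have "has_symbol z 2 (act_op v Y) (\<Sum>j<2 * v + 1. omega (h j) (mat_vec Y (h j)))" if Y: "Y \<in>
      sp_inf" for Y
  proof -
    let ?Y = "mat_vec Y"
    have symm: "omega x (?Y y) = omega y (?Y x)" for x y
      using sp_inf_omega[OF Y, of x y] omega_antisym[of "?Y x" y] by simp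
    have "comm z (act_op v Y) = - comm (act_op v Y) z" by (rule comm_antisym)
    also have "comm (act_op v Y) z = (\<Sum>k<v. Y_op k (?Y (p k)) + D_op k (?Y (q k))) + W_op (?Y u)"
      unfolding z_def by (simp add: comm_simps comm_sum comm_act_op[OF Y])
    finally have 1: "comm z (act_op v Y) = - ((\<Sum>k<v. Y_op k (?Y (p k)) + D_op k (?Y (q k))) + W_op (?Y
        u))" .
    have zY: "comm z (Y_op k x) = scal (omega (q k) x)" and zD: "comm z (D_op k x) = scal (omega (p k) x)"
      if "k < v" for k x
      using that by (simp_all add: z_def comm_simps comm_sum heisenberg)
    have zW: "comm z (W_op x) = scal (omega u x)" for x
      by (simp add: z_def comm_simps comm_sum heisenberg)
    have "comm z (comm z (act_op v Y)) = - ((\<Sum>k<v. scal (omega (q k) (?Y (p k))) + scal (omega (p k) (?Y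
        (q k)))) + scal (omega u (?Y u)))"
      unfolding 1 by (simp add: comm_simps comm_sum zY zD zW)
    also have "\<dots> = scal (- ((\<Sum>k<v. omega (q k) (?Y (p k)) + omega (p k) (?Y (q k))) + omega u (?Y u)))"
      by (simp add: scal_simps scal_sum)
    also have "- ((\<Sum>k<v. omega (q k) (?Y (p k)) + omega (p k) (?Y (q k))) + omega u (?Y u)) =
       2 * (\<Sum>j<2 * v + 1. omega (h j) (?Y (h j)))"
    proof -
      have ii: "i * (i * x) = - x" and ss: "s * (s * x) = - 2 * x" for x
        using i s by (simp_all add: power2_eq_square flip: mult.assoc)
      have pq: "omega (q k) (?Y (p k)) + omega (p k) (?Y (q k)) =
          - 2 * (omega (h k) (?Y (h k)) + omega (h (v + k)) (?Y (h (v + k))))" for k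
        by (simp add: p_def q_def mat_vec_linear omega_linear ii symm[of "h (v + k)" "h k"] algebra_simps)
      have u: "omega u (?Y u) = - 2 * omega (h (2 * v)) (?Y (h (2 * v)))"
        by (simp add: u_def mat_vec_linear omega_linear ss)
      have sum: "(\<Sum>j<2 * v + 1. omega (h j) (?Y (h j))) =
         (\<Sum>k<v. omega (h k) (?Y (h k))) + (\<Sum>k<v. omega (h (v + k)) (?Y (h (v + k)))) + omega (h (2 * v))
             (?Y (h (2 * v)))"
        by (rule sum_lessThan_double_Suc)
      show ?thesis
        unfolding sum pq u sum_distrib_left[symmetric] sum.distrib by (simp add: algebra_simps)
    qed
    finally show ?thesis by (simp add: has_symbol_def numeral_2_eq_2)
  qed
  ultimately show ?thesis by blast
qed

section \<open>Determinants of commuting operators\<close>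

lemma prod_list_sum:
  fixes h :: "'i \<Rightarrow> 'l \<Rightarrow> 'r::semiring_1"
  assumes "finite A"
  shows "prod_list (map (\<lambda>i. \<Sum>l\<in>A. h i l) is) =
    (\<Sum>ls | set ls \<subseteq> A \<and> length ls = length is. prod_list (map2 h is ls))"
proof (induction "is")
  case (Cons i "is")
  let ?L = "\<lambda>n. {ls. set ls \<subseteq> A \<and> length ls = n}"
  have "?L (Suc (length is)) = (\<lambda>(l, ls). l # ls) ` (A \<times> ?L (length is))"
    by (auto simp: length_Suc_conv image_iff)
  moreover have "inj_on (\<lambda>(l, ls). l # ls) (A \<times> ?L (length is))" by (auto simp: inj_on_def)
  ultimately have "(\<Sum>ls\<in>?L (Suc (length is)). prod_list (map2 h (i # is) ls)) =
     (\<Sum>(l, ls)\<in>A \<times> ?L (length is). h i l * prod_list (map2 h is ls))"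
    by (simp add: sum.reindex case_prod_unfold)
  also have "\<dots> = (\<Sum>l\<in>A. h i l) * (\<Sum>ls\<in>?L (length is). prod_list (map2 h is ls))"
    by (simp add: sum.cartesian_product sum_product)
  finally show ?case using Cons by simp
next
  case Nil
  have "{ls. set ls \<subseteq> A \<and> length ls = length []} = {[]}" by auto
  then show ?case by simp
qed

lemma prod_list_mult_commuting:
  fixes a b :: "'i \<Rightarrow> 'r::monoid_mult"
  assumes "\<And>p q. p \<in> set ps \<Longrightarrow> q \<in> set ps \<Longrightarrow> b p * a q = a q * b p"
  shows "prod_list (map (\<lambda>p. a p * b p) ps) = prod_list (map a ps) * prod_list (map b ps)"
  using assms
proof (induction ps)
  case (Cons p ps)
  have "b p * prod_list (map a qs) = prod_list (map a qs) * b p" if "set qs \<subseteq> set (p # ps)" for qs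
    using that
  proof (induction qs)
    case (Cons q qs)
    have "b p * a q = a q * b p" using \<open>set (q # qs) \<subseteq> set (p # ps)\<close>
        by (intro \<open>\<And>p' q. p' \<in> set (p # ps) \<Longrightarrow> q \<in> set (p # ps) \<Longrightarrow> b p' * a q = a q * b p'\<close>) auto
    with Cons.IH Cons.prems(1) show ?case by (simp add: mult.assoc) (metis mult.assoc)
  qed simp
  from this[of ps] have c: "b p * (prod_list (map a ps) * B) = prod_list (map a ps) * (b p * B)" for B
    by (metis mult.assoc set_subset_Cons)
  show ?case using Cons by (simp add: mult.assoc c)
qed simp

lemma prod_list_permute_commuting:
  fixes xs ys :: "'r::monoid_mult list"
  assumes "mset xs = mset ys" "\<And>x y. x \<in> set xs \<Longrightarrow> y \<in> set xs \<Longrightarrow> x * y = y * x"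
  shows "prod_list xs = prod_list ys"
proof -
  have "fold (*) (rev xs) = fold (*) (rev ys)"
  proof (rule fold_multiset_equiv)
    fix x y assume "x \<in> set (rev xs)" "y \<in> set (rev xs)"
    then have "x * y = y * x" using assms(2) by simp
    then show "(*) x \<circ> (*) y = (*) y \<circ> (*) x" by (simp add: fun_eq_iff flip: mult.assoc)
  qed (use assms(1) in simp)
  then show ?thesis by (simp add: prod_list.eq_foldr foldr_conv_fold)
qed

lemma linop_eq_minus_self:
  fixes D :: "('m, 'a::field_char_0) linop"
  assumes "D = - D" shows "D = 0"
proof (rule linop_eqI, rule poly_mapping_eqI)
  fix p k
  have "apply_op D p = - apply_op D p" using arg_cong[OF assms, of "\<lambda>D. apply_op D p"] by simp
  then have "lookup (apply_op D p) k = - lookup (apply_op D p) k" by (metis lookup_uminus)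
  then have "2 * lookup (apply_op D p) k = 0" by (simp only: mult_2) (metis add.right_inverse)
  then show "lookup (apply_op D p) k = lookup (apply_op 0 p) k" by simp
qed

text \<open>
  The determinant of a product of an \<open>r \<times> s\<close> matrix and an \<open>s \<times> r\<close> matrix is 0 if \<open>s < r\<close>. Expand
  the product of the sums over \<open>l\<close>: each choice \<open>ls\<close> of the summation indices repeats some value
  in two rows \<open>p\<close>, \<open>q\<close>, and composing \<open>\<pi>\<close> with the transposition of \<open>p\<close> and \<open>q\<close> changes the sign
  but not the product of the commuting factors \<open>B\<close>.
\<close>

lemma det_commuting_eq_zero:
  fixes A B :: "nat \<Rightarrow> nat \<Rightarrow> ('m, 'a::field_char_0) linop"
  assumes AB: "\<And>i j l l'. i < r \<Longrightarrow> j < r \<Longrightarrow> B i l * A j l' = A j l' * B i l"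
    and BB: "\<And>i j l l'. i < r \<Longrightarrow> j < r \<Longrightarrow> B i l * B j l' = B j l' * B i l"
    and "s < r"
  shows "(\<Sum>\<pi> | \<pi> permutes {..<r}. scal (of_int (sign \<pi>)) * prod_list (map (\<lambda>i. \<Sum>l<s. A i l * B (\<pi> i) l)
      [0..<r])) = 0"
proof -
  let ?P = "{\<pi>. \<pi> permutes {..<r}}" and ?L = "{ls. set ls \<subseteq> {..<s} \<and> length ls = length [0..<r]}"
  let ?a = "\<lambda>ls. prod_list (map (\<lambda>i. A i (ls ! i)) [0..<r])"
  let ?b = "\<lambda>\<pi> ls. prod_list (map (\<lambda>i. B (\<pi> i) (ls ! i)) [0..<r])"
  have in_r: "\<pi> i < r" if "\<pi> \<in> ?P" "i < r" for \<pi> i using that permutes_in_image[of \<pi> "{..<r}" i] by auto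
  have prod: "prod_list (map (\<lambda>i. \<Sum>l<s. A i l * B (\<pi> i) l) [0..<r]) =
      (\<Sum>ls\<in>?L. ?a ls * ?b \<pi> ls)" if \<pi>: "\<pi> \<in> ?P" for \<pi>
  proof -
    have "prod_list (map2 (\<lambda>i l. A i l * B (\<pi> i) l) [0..<r] ls) = ?a ls * ?b \<pi> ls" if "ls \<in> ?L" for ls
    proof -
      have "map2 (\<lambda>i l. A i l * B (\<pi> i) l) [0..<r] ls = map (\<lambda>i. A i (ls ! i) * B (\<pi> i) (ls ! i)) [0..<r]"
        using that by (intro nth_equalityI) auto
      moreover have "prod_list (map (\<lambda>i. A i (ls ! i) * B (\<pi> i) (ls ! i)) [0..<r]) = ?a ls * ?b \<pi> ls"
        by (rule prod_list_mult_commuting) (use AB in_r[OF \<pi>] in auto)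
      ultimately show ?thesis by simp
    qed
    then show ?thesis by (subst prod_list_sum) (auto intro!: sum.cong)
  qed
  have zero: "(\<Sum>\<pi>\<in>?P. scal (of_int (sign \<pi>)) * ?b \<pi> ls) = 0" if ls: "ls \<in> ?L" for ls
  proof -
    have "\<not> inj_on ((!) ls) {..<r}"
    proof
      assume "inj_on ((!) ls) {..<r}"
      then have "card {..<r} \<le> card {..<s}" using ls by (intro card_inj_on_le) (auto simp: subset_iff)
      then show False using \<open>s < r\<close> by simp
    qed
    then obtain p q where pq: "p < r" "q < r" "p \<noteq> q" "ls ! p = ls ! q" by (auto simp: inj_on_def)
    let ?\<tau> = "transpose p q"
    have \<tau>: "?\<tau> permutes {..<r}" using pq by (intro permutes_swap_id) auto
    have b: "?b (\<pi> \<circ> ?\<tau>) ls = ?b \<pi> ls" if \<pi>: "\<pi> \<in> ?P" for \<pi>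
    proof -
      have eq: "map (\<lambda>i. B ((\<pi> \<circ> ?\<tau>) i) (ls ! i)) [0..<r] = map (\<lambda>i. B (\<pi> i) (ls ! i)) (map ?\<tau> [0..<r])"
        using pq by (auto simp: transpose_def)
      have m: "mset (map ?\<tau> [0..<r]) = mset [0..<r]"
      proof -
        have "mset (map ?\<tau> [0..<r]) = image_mset ?\<tau> (mset_set {..<r})" by (simp add: atLeast0LessThan)
        also have "\<dots> = mset_set (?\<tau> ` {..<r})"
          using \<tau> by (intro image_mset_mset_set permutes_inj_on)
        finally show ?thesis using \<tau> by (simp add: permutes_image atLeast0LessThan)
      qed
      have perm: "prod_list (map f (map ?\<tau> [0..<r])) = prod_list (map f [0..<r])"
        if "\<And>i j. i < r \<Longrightarrow> j < r \<Longrightarrow> f i * f j = f j * f i" for f :: "nat \<Rightarrow> ('m, 'a) linop"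
      proof (rule prod_list_permute_commuting)
        show "mset (map f (map ?\<tau> [0..<r])) = mset (map f [0..<r])" using m by (simp only: mset_map)
        have "?\<tau> i < r" if "i < r" for i using pq that by (auto simp: transpose_def)
        then show "x * y = y * x" if "x \<in> set (map f (map ?\<tau> [0..<r]))"
            "y \<in> set (map f (map ?\<tau> [0..<r]))" for x y
          using that \<open>\<And>i j. i < r \<Longrightarrow> j < r \<Longrightarrow> f i * f j = f j * f i\<close> by auto
      qed
      show ?thesis unfolding eq by (rule perm) (use BB in_r[OF \<pi>] in auto)
    qed
    have "(\<Sum>\<pi>\<in>?P. scal (of_int (sign \<pi>)) * ?b \<pi> ls) =
        (\<Sum>\<pi>\<in>?P. scal (of_int (sign (\<pi> \<circ> ?\<tau>))) * ?b (\<pi> \<circ> ?\<tau>) ls)"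
      by (rule sum.reindex_bij_witness[of _ "\<lambda>\<pi>. \<pi> \<circ> ?\<tau>" "\<lambda>\<pi>. \<pi> \<circ> ?\<tau>"])
         (use \<tau> in \<open>auto simp: comp_assoc intro: permutes_compose\<close>)
    also have "\<dots> = (\<Sum>\<pi>\<in>?P. - (scal (of_int (sign \<pi>)) * ?b \<pi> ls))"
    proof (rule sum.cong[OF refl])
      fix \<pi> assume \<pi>: "\<pi> \<in> ?P"
      have "sign (\<pi> \<circ> ?\<tau>) = - sign \<pi>"
        using \<pi> \<tau> pq by (subst sign_compose) (auto simp: permutation_permutes sign_swap_id intro!: exI[of
            _ "{..<r}"])
      then show "scal (of_int (sign (\<pi> \<circ> ?\<tau>))) * ?b (\<pi> \<circ> ?\<tau>) ls = - (scal (of_int (sign \<pi>)) * ?b \<pi> ls)"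
        by (simp only: b[OF \<pi>]) (simp add: scal_simps)
    qed
    also have "\<dots> = - (\<Sum>\<pi>\<in>?P. scal (of_int (sign \<pi>)) * ?b \<pi> ls)" by (simp add: sum_negf)
    finally show ?thesis by (rule linop_eq_minus_self)
  qed
  have "(\<Sum>\<pi>\<in>?P. scal (of_int (sign \<pi>)) * prod_list (map (\<lambda>i. \<Sum>l<s. A i l * B (\<pi> i) l) [0..<r])) =
     (\<Sum>\<pi>\<in>?P. \<Sum>ls\<in>?L. ?a ls * (scal (of_int (sign \<pi>)) * ?b \<pi> ls))"
    by (intro sum.cong refl) (simp only: prod sum_distrib_left scal_left_commute)
  also have "\<dots> = (\<Sum>ls\<in>?L. ?a ls * (\<Sum>\<pi>\<in>?P. scal (of_int (sign \<pi>)) * ?b \<pi> ls))"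
    by (subst sum.swap) (simp only: sum_distrib_left)
  also have "\<dots> = 0" using zero by (intro sum.neutral) simp
  finally show ?thesis .
qed

text \<open>
  By these operators, the matrix with the entries \<open>act_op v (sq (u i) (u j))\<close> is a product of
  matrices with \<open>2 v + 1\<close> columns and rows: \<open>v\<close> indices for \<open>Y D\<close>, \<open>v\<close> for \<open>D Y\<close> and one for \<open>W
  W\<close>.
\<close>

definition row_op :: "nat \<Rightarrow> 'a fvec \<Rightarrow> nat \<Rightarrow> 'a::field module_op" where
  "row_op v u l = (if l < v then Y_op l u else if l < 2 * v then D_op (l - v) u else W_op u)"

definition col_op :: "nat \<Rightarrow> 'a fvec \<Rightarrow> nat \<Rightarrow> 'a::field module_op" where
  "col_op v u l = (if l < v then D_op l u else if l < 2 * v then Y_op (l - v) u else W_op u)"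

lemma act_op_sq_isotropic:
  fixes u w :: "'a::field_char_0 fvec"
  assumes "omega u w = 0"
  shows "act_op v (sq u w) = (\<Sum>l<2 * v + 1. row_op v u l * col_op v w l)"
proof -
  have c: "comm (D_op k u) (Y_op k w) = 0" "comm (W_op w) (W_op u) = 0" for k
    using assms(1) omega_antisym[of w u] by (simp_all add: heisenberg scal_simps)
  have DY: "Y_op k w * D_op k u = D_op k u * Y_op k w" for k using c(1)[of k] by (simp add: comm_def)
  have WW: "W_op w * W_op u = W_op u * W_op w" using c(2) by (simp add: comm_def)
  have h: "scal (1/2) * (A + A) = A" for A :: "'a module_op"
    by (rule linop_eqI) (simp add: scale_add flip: scale_add_left)
  have "(\<Sum>l<2 * v + 1. row_op v u l * col_op v w l) =
      (\<Sum>l<v. row_op v u l * col_op v w l) + (\<Sum>l<v. row_op v u (v + l) * col_op v w (v + l)) + row_op v u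
          (2 * v) * col_op v w (2 * v)"
    by (rule sum_lessThan_double_Suc)
  also have "\<dots> = (\<Sum>l<v. Y_op l u * D_op l w) + (\<Sum>l<v. D_op l u * Y_op l w) + W_op u * W_op w"
    by (intro arg_cong2[where f = "(+)"] sum.cong) (auto simp: row_op_def col_op_def)
  also have "\<dots> = act_op v (sq u w)"
    by (simp add: act_op_sq WW h DY sum.distrib)
  finally show ?thesis ..
qed

text \<open>
  On an isotropic subspace all Heisenberg operators commute. So the symmetric matrix of the
  operators \<open>act_op v (sq (u i) (u j))\<close> has rank at most \<open>2 v + 1\<close> in the classical sense, and its
  larger minors vanish without correction terms of lower order.
\<close>

lemma isotropic_minor_acts_zero:
  fixes u :: "nat \<Rightarrow> 'a::field_char_0 fvec"
  assumes iso: "\<And>i j. i < r \<Longrightarrow> j < r \<Longrightarrow> omega (u i) (u j) = 0" and r: "2 * v + 1 < r"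
  shows "(\<Sum>\<pi> | \<pi> permutes {..<r}. scal (of_int (sign \<pi>)) * prod_list (map (act_op v) (map (\<lambda>i. sq (u i)
      (u (\<pi> i))) [0..<r]))) = 0"
proof -
  have comm0: "comm (col_op v (u i) l) (row_op v (u j) l') = 0"
      "comm (col_op v (u i) l) (col_op v (u j) l') = 0" if "i < r" "j < r" for i j l l'
    using iso[OF that] by (simp_all add: row_op_def col_op_def heisenberg scal_simps)
  have "(\<Sum>\<pi> | \<pi> permutes {..<r}. scal (of_int (sign \<pi>)) * prod_list (map (\<lambda>i. \<Sum>l<2*v+1. row_op v (u i) l
      * col_op v (u (\<pi> i)) l) [0..<r])) = 0"
    by (rule det_commuting_eq_zero[of r "\<lambda>i. col_op v (u i)" "\<lambda>i. row_op v (u i)" "2 * v + 1", OF _ _ r])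
       (use comm0 in \<open>simp_all add: comm_def\<close>)
  moreover have "prod_list (map (act_op v) (map (\<lambda>i. sq (u i) (u (\<pi> i))) [0..<r])) =
     prod_list (map (\<lambda>i. \<Sum>l<2*v+1. row_op v (u i) l * col_op v (u (\<pi> i)) l) [0..<r])"
         if "\<pi> permutes {..<r}" for \<pi>
  proof -
    have "act_op v (sq (u i) (u (\<pi> i))) = (\<Sum>l<2*v+1. row_op v (u i) l * col_op v (u (\<pi> i)) l)" if "i < r"
        for i
      using permutes_in_image[OF \<open>\<pi> permutes {..<r}\<close>, of i] that
      by (intro act_op_sq_isotropic iso) auto
    then show ?thesis unfolding map_map comp_def by (intro arg_cong[of _ _ prod_list] map_cong refl) auto
  qed
  ultimately show ?thesis by simp
qed

section \<open>Evaluation of tensors\<close>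

text \<open>
  Both the action of a tensor on a module (\<open>apply_ev\<close>) and its evaluation at a functional
  (\<open>ev_scal\<close>) are of this form, so that one argument shows that both are well defined on the
  quotients \<open>U(L)\<close> and \<open>S(L)\<close>.
\<close>

definition ev :: "('x \<Rightarrow> ('m, 'a::field) linop) \<Rightarrow> ('x list \<Rightarrow>\<^sub>0 'a) \<Rightarrow> ('m, 'a) linop" where
  "ev R = lin_op (\<lambda>w. prod_list (map R w))"

lemma ev_linear: "ev R (s + t) = ev R s + ev R t" "ev R (s - t) = ev R s - ev R t"
  "ev R (scale c t) = scal c * ev R t" "ev R (- t) = - ev R t" "ev R 0 = 0"
  by (simp_all add: ev_def lin_op_add lin_op_diff lin_op_scale lin_op_minus)

lemma ev_gen: "ev R (gen x) = R x"
  by (simp add: ev_def gen_def scal_simps)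

lemma ev_mult: "ev R (free_mult s t) = ev R s * ev R t"
  by (simp add: ev_def free_mult_def lin_op_lin_ext lin_op_times scal_simps)

lemma apply_ev: "apply_op (ev R t) m = free_act (\<lambda>x. apply_op (R x)) t m"
proof -
  have "apply_op (prod_list (map R w)) m = foldr (\<lambda>x. apply_op (R x)) w m" for w
    by (induction w) simp_all
  then show ?thesis by (simp add: ev_def free_act_def apply_lin_op)
qed

lemma ev_scal: "ev (\<lambda>x. scal (\<xi> x)) t = (scal (free_eval \<xi> t) :: ('m, 'a::field) linop)"
proof -
  have "prod_list (map (\<lambda>x. scal (\<xi> x)) w) = (scal (prod_list (map \<xi> w)) :: ('m, 'a) linop)" for w
    by (induction w) (simp_all add: scal_simps)
  then show ?thesis by (simp add: ev_def lin_op_def free_eval_def scal_sum scal_simps)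
qed

lemma scal_inject [simp]: "scal c = (scal d :: ('m, 'a::field) linop) \<longleftrightarrow> c = d"
proof
  assume "scal c = (scal d :: ('m, 'a) linop)"
  then have "scale c (Poly_Mapping.single undefined 1 :: 'm \<Rightarrow>\<^sub>0 'a) =
      scale d (Poly_Mapping.single undefined 1)"
    by (metis apply_op_simps(7))
  then have "lookup (scale c (Poly_Mapping.single undefined 1 :: 'm \<Rightarrow>\<^sub>0 'a)) undefined =
     lookup (scale d (Poly_Mapping.single undefined 1 :: 'm \<Rightarrow>\<^sub>0 'a)) undefined" by simp
  then show "c = d" by (simp only: lookup_scale lookup_single_eq mult_1_right)
qed simp

lemma free_carrier: "t \<in> carrier (free_algebra G) \<longleftrightarrow> keys t \<subseteq> lists G"
  by (simp add: free_algebra_def)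

lemma free_add: "s \<oplus>\<^bsub>free_algebra G\<^esub> t = s + t" and free_mul: "s \<otimes>\<^bsub>free_algebra G\<^esub> t = free_mult s t"
  and free_zero: "\<zero>\<^bsub>free_algebra G\<^esub> = 0"
  by (simp_all add: free_algebra_def)

lemma free_carrier_closed:
  "s \<in> carrier (free_algebra G) \<Longrightarrow> t \<in> carrier (free_algebra G) \<Longrightarrow> s + t \<in> carrier (free_algebra G)"
  "t \<in> carrier (free_algebra G) \<Longrightarrow> scale c t \<in> carrier (free_algebra G)"
  "t \<in> carrier (free_algebra G) \<Longrightarrow> - t \<in> carrier (free_algebra G)"
  "s \<in> carrier (free_algebra G) \<Longrightarrow> t \<in> carrier (free_algebra G) \<Longrightarrow> s - t \<in> carrier (free_algebra G)"
  "s \<in> carrier (free_algebra G) \<Longrightarrow> t \<in> carrier (free_algebra G) \<Longrightarrow> free_mult s t \<in> carrier (free_algebra G)"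
  "0 \<in> carrier (free_algebra G)"
  "x \<in> G \<Longrightarrow> gen x \<in> carrier (free_algebra G)"
proof -
  show "s + t \<in> carrier (free_algebra G)" if "s \<in> carrier (free_algebra G)" "t \<in> carrier (free_algebra G)"
    using that Poly_Mapping.keys_add[of s t] by (auto simp: free_carrier)
  show "scale c t \<in> carrier (free_algebra G)" if "t \<in> carrier (free_algebra G)"
    using that by (auto simp: free_carrier in_keys_iff)
  show "- t \<in> carrier (free_algebra G)" if "t \<in> carrier (free_algebra G)"
    using that by (auto simp: free_carrier in_keys_iff)
  show "s - t \<in> carrier (free_algebra G)" if "s \<in> carrier (free_algebra G)" "t \<in> carrier (free_algebra G)"
    using that Poly_Mapping.keys_diff[of s t] by (auto simp: free_carrier)
  show "free_mult s t \<in> carrier (free_algebra G)"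
      if "s \<in> carrier (free_algebra G)" "t \<in> carrier (free_algebra G)"
    using that ring.ring_simprules(5)[OF ring_free_algebra] by (metis free_mul)
  show "0 \<in> carrier (free_algebra G)" "x \<in> G \<Longrightarrow> gen x \<in> carrier (free_algebra G)"
    by (auto simp: free_carrier gen_def)
qed

lemma free_minus:
  assumes "t \<in> carrier (free_algebra G)" shows "\<ominus>\<^bsub>free_algebra G\<^esub> t = - t"
proof -
  interpret ring "free_algebra G" by (rule ring_free_algebra)
  show ?thesis
    by (rule minus_equality) (use assms free_carrier_closed in \<open>auto simp: free_add free_zero\<close>)
qed

lemma ideal_ev_kernel: "ideal {t \<in> carrier (free_algebra G). ev R t = 0} (free_algebra G)"
proof (rule idealI[OF ring_free_algebra])
  interpret ring "free_algebra G" by (rule ring_free_algebra)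
  show "subgroup {t \<in> carrier (free_algebra G). ev R t = 0} (add_monoid (free_algebra G))"
  proof (rule add.subgroupI)
    show "{t \<in> carrier (free_algebra G). ev R t = 0} \<noteq> {}"
      using free_carrier_closed(6) ev_linear(5) by blast
  qed (auto simp: free_add free_minus ev_linear free_carrier_closed)
qed (auto simp: free_mul ev_mult free_carrier_closed)

lemma genideal_ev:
  assumes "S \<subseteq> carrier (free_algebra G)" "\<And>s. s \<in> S \<Longrightarrow> ev R s = 0"
    and "t \<in> genideal (free_algebra G) S"
  shows "ev R t = 0"
proof -
  have "genideal (free_algebra G) S \<subseteq> {t \<in> carrier (free_algebra G). ev R t = 0}"
    by (rule ring.genideal_minimal[OF ring_free_algebra ideal_ev_kernel]) (use assms in auto)
  with assms(3) show ?thesis by auto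
qed

lemma coset_image:
  assumes "ideal I (free_algebra G)" "\<And>i. i \<in> I \<Longrightarrow> ev R i = 0"
  shows "ev R ` (I +>\<^bsub>free_algebra G\<^esub> t) = {ev R t}"
proof -
  have "0 \<in> I" using additive_subgroup.zero_closed[OF ideal.axioms(1)[OF assms(1)]] by (simp add: free_zero)
  then show ?thesis using assms(2) by (auto simp: a_r_coset_def' free_add ev_linear)
qed

section \<open>The associated variety of an annihilator\<close>

lemma dual_space_linear:
  assumes "\<xi> \<in> dual_space L"
  shows "x \<in> L \<Longrightarrow> y \<in> L \<Longrightarrow> \<xi> (x + y) = \<xi> x + \<xi> y" "x \<in> L \<Longrightarrow> \<xi> (scale c x) = c * \<xi> x"
  using assms by (auto simp: dual_space_def)

locale lie_representation =
  fixes L :: "('b \<Rightarrow>\<^sub>0 'a::field) set" and br :: "('b \<Rightarrow>\<^sub>0 'a) \<Rightarrow> ('b \<Rightarrow>\<^sub>0 'a) \<Rightarrow> ('b \<Rightarrow>\<^sub>0 'a)"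
    and R :: "('b \<Rightarrow>\<^sub>0 'a) \<Rightarrow> ('m, 'a) linop"
  assumes closed: "x \<in> L \<Longrightarrow> y \<in> L \<Longrightarrow> x + y \<in> L" "x \<in> L \<Longrightarrow> scale c x \<in> L" "x \<in> L \<Longrightarrow> y \<in> L \<Longrightarrow> br x y \<in> L"
    and rep: "x \<in> L \<Longrightarrow> y \<in> L \<Longrightarrow> R (x + y) = R x + R y" "x \<in> L \<Longrightarrow> R (scale c x) = scal c * R x"
      "x \<in> L \<Longrightarrow> y \<in> L \<Longrightarrow> R (br x y) = R x * R y - R y * R x"
begin

abbreviation "F \<equiv> free_algebra L"
abbreviation "action \<equiv> (\<lambda>x. apply_op (R x))"

lemma relations_carrier: 
  "linear_relations L \<union> lie_relations L br \<subseteq> carrier F" "linear_relations L \<union> comm_relations L \<subseteq> carrier F"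
  by (auto simp: linear_relations_def lie_relations_def comm_relations_def intro!: free_carrier_closed
      closed)

lemma ideals: "ideal (env_ideal L br) F" "ideal (sym_ideal L) F"
  unfolding env_ideal_def sym_ideal_def
  by (intro ring.genideal_ideal[OF ring_free_algebra] relations_carrier)+

lemma ev_env_ideal: "t \<in> env_ideal L br \<Longrightarrow> ev R t = 0"
  unfolding env_ideal_def
  by (erule genideal_ev[OF relations_carrier(1), rotated])
     (auto simp: linear_relations_def lie_relations_def ev_linear ev_gen ev_mult rep)

lemma free_eval_sym_ideal:
  assumes \<xi>: "\<xi> \<in> dual_space L" and t: "t \<in> sym_ideal L"
  shows "ev (\<lambda>x. scal (\<xi> x) :: (unit, 'a) linop) t = 0"
proof (rule genideal_ev[OF relations_carrier(2) _ t[unfolded sym_ideal_def]])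
  fix r assume "r \<in> linear_relations L \<union> comm_relations L"
  then consider x y where "x \<in> L" "y \<in> L" "r = gen (x + y) - gen x - gen y"
    | c x where "x \<in> L" "r = gen (scale c x) - scale c (gen x)"
    | x y where "r = free_mult (gen x) (gen y) - free_mult (gen y) (gen x)"
    unfolding linear_relations_def comm_relations_def by blast
  then show "ev (\<lambda>x. scal (\<xi> x) :: (unit, 'a) linop) r = 0"
  proof cases
    case 1
    then show ?thesis by (simp add: ev_linear ev_gen dual_space_linear[OF \<xi>] scal_simps)
  next
    case 2
    then show ?thesis by (simp add: ev_linear ev_gen dual_space_linear[OF \<xi>] scal_simps)
  next
    case 3
    show ?thesis unfolding 3 ev_linear ev_mult ev_gen by (subst scal_central) (rule diff_self)
  qed
qed

lemma ev_env_class: "ev R ` env_class L br t = {ev R t}"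
  unfolding env_class_def by (rule coset_image[OF ideals(1)]) (rule ev_env_ideal)

lemma env_act_class: "env_act action (env_class L br t) m = apply_op (ev R t) m"
proof -
  have "(\<lambda>t. apply_op (ev R t) m) ` (env_class L br t) = (\<lambda>D. apply_op D m) ` ev R ` (env_class L br t)"
    by (simp add: image_image)
  also have "\<dots> = {apply_op (ev R t) m}"
    unfolding ev_env_class by simp
  finally show ?thesis by (simp add: env_act_def flip: apply_ev)
qed

lemma sym_eval_class: "\<xi> \<in> dual_space L \<Longrightarrow> sym_eval \<xi> (sym_class L t) = free_eval \<xi> t"
proof -
  assume \<xi>: "\<xi> \<in> dual_space L"
  let ?R = "\<lambda>x. scal (\<xi> x) :: (unit, 'a) linop"
  have *: "ev ?R ` sym_class L t = {ev ?R t}"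
    unfolding sym_class_def using free_eval_sym_ideal[OF \<xi>] by (intro coset_image ideals)
  have "free_eval \<xi> s = free_eval \<xi> t" if "s \<in> sym_class L t" for s
  proof -
    have "ev ?R s = ev ?R t" using * that by blast
    then show ?thesis by (simp add: ev_scal)
  qed
  moreover have "0 \<in> sym_ideal L" 
    using additive_subgroup.zero_closed[OF ideal.axioms(1)[OF ideals(2)]] by (simp add: free_zero)
  then have "t \<in> sym_class L t" by (auto simp: sym_class_def a_r_coset_def' free_add)
  ultimately have "free_eval \<xi> ` sym_class L t = {free_eval \<xi> t}" by blast
  then show ?thesis by (simp add: sym_eval_def)
qed

lemma class_hom: "ring_hom_ring F (env_algebra L br) (env_class L br)"
    "ring_hom_ring F (sym_algebra L) (sym_class L)"
proof -
  have "env_class L br = (+>\<^bsub>F\<^esub>) (env_ideal L br)" "sym_class L = (+>\<^bsub>F\<^esub>) (sym_ideal L)"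
    by (simp_all add: fun_eq_iff env_class_def sym_class_def)
  then show "ring_hom_ring F (env_algebra L br) (env_class L br)"
      "ring_hom_ring F (sym_algebra L) (sym_class L)"
    unfolding env_algebra_def sym_algebra_def
    using ideal.rcos_ring_hom_ring[OF ideals(1)] ideal.rcos_ring_hom_ring[OF ideals(2)] by (simp_all only:)
qed

lemma env_algebra_carrier: "carrier (env_algebra L br) = env_class L br ` carrier F"
  by (auto simp: env_algebra_def FactRing_def A_RCOSETS_def' env_class_def)

lemma env_class_diff:
  assumes "s \<in> carrier F" "t \<in> carrier F"
  shows "env_class L br s \<ominus>\<^bsub>env_algebra L br\<^esub> env_class L br t = env_class L br (s - t)"
proof -
  interpret ring_hom_ring F "env_algebra L br" "env_class L br" by (rule class_hom)
  show ?thesis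
    using assms free_carrier_closed(3)[OF assms(2)]
    by (simp add: a_minus_def free_minus free_add flip: hom_a_inv hom_add)
qed

lemma env_class_eqD: 
  assumes "env_class L br s = env_class L br t" shows "ev R s = ev R t"
proof -
  have "ev R ` env_class L br s = ev R ` env_class L br t" using assms by simp
  then show ?thesis unfolding ev_env_class by simp
qed

lemma gr_component_annihilator:
  "gr_component L br (annihilator L br action M) k =
     {sym_class L t | t. t \<in> carrier F \<and> (\<forall>w\<in>keys t. length w = k) \<and>
       (\<exists>t'\<in>carrier F. (\<forall>w\<in>keys t'. length w < k) \<and> (\<forall>m\<in>M. apply_op (ev R (t + t')) m = 0))}"
proof -
  have iff: "(\<exists>u\<in>annihilator L br action M. env_class L br t \<ominus>\<^bsub>env_algebra L br\<^esub> u \<in> env_less L br k) \<longleftrightarrow>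
    (\<exists>t'\<in>carrier F. (\<forall>w\<in>keys t'. length w < k) \<and> (\<forall>m\<in>M. apply_op (ev R (t + t')) m = 0))" (is "?l \<longleftrightarrow> ?r")
    if t: "t \<in> carrier F" for t
  proof
    assume ?l
    then obtain u t' where u: "u \<in> annihilator L br action M" 
      and t': "t' \<in> carrier F" "\<forall>w\<in>keys t'. length w < k"
      and eq: "env_class L br t \<ominus>\<^bsub>env_algebra L br\<^esub> u = env_class L br t'"
      by (auto simp: env_less_def)
    obtain s where s: "s \<in> carrier F" "u = env_class L br s"
      using u by (auto simp: annihilator_def env_algebra_carrier)
    have "ev R (t - s) = ev R t'"
      by (rule env_class_eqD) (use eq env_class_diff[OF t s(1)] s(2) in simp)
    then have "ev R (t + (- t')) = ev R s" by (simp add: ev_linear algebra_simps)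
    moreover have "apply_op (ev R s) m = 0" if "m \<in> M" for m
      using u that s(2) by (auto simp: annihilator_def env_act_class)
    moreover have "keys (- t') = keys t'" by (auto simp: in_keys_iff)
    ultimately show ?r using t' free_carrier_closed(3)[OF t'(1)] by (intro bexI[of _ "- t'"]) auto
  next
    assume ?r
    then obtain t' where t': "t' \<in> carrier F" "\<forall>w\<in>keys t'. length w < k"
        "\<forall>m\<in>M. apply_op (ev R (t + t')) m = 0"
      by blast
    have "env_class L br (t + t') \<in> annihilator L br action M"
      using t'(3) imageI[OF free_carrier_closed(1)[OF t t'(1)]]
      by (auto simp: annihilator_def env_act_class env_algebra_carrier)
    moreover have "env_class L br t \<ominus>\<^bsub>env_algebra L br\<^esub> env_class L br (t + t') = env_class L br (- t')"
      using env_class_diff[OF t free_carrier_closed(1)[OF t t'(1)]] by simp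
    moreover have "env_class L br (- t') \<in> env_less L br k"
    proof -
      have "keys (- t') = keys t'" by (auto simp: in_keys_iff)
      then show ?thesis using t' free_carrier_closed(3)[OF t'(1)] by (auto simp: env_less_def)
    qed
    ultimately show ?l by metis
  qed
  show ?thesis
    unfolding gr_component_def by (intro Collect_cong ex_cong1 conj_cong refl) (rule iff)
qed

text \<open>
  This description eliminates the quotient algebras: \<open>\<xi>\<close> is in the variety iff it kills the top
  degree part \<open>t\<close> of every tensor \<open>t + t'\<close> that annihilates the module. The zero set of the ideal
  \<open>gr I\<close> is determined by the homogeneous components, because the tensors killed by \<open>\<xi>\<close> are closed
  under addition.
\<close>

theorem assoc_variety_annihilator:
  "\<xi> \<in> assoc_variety L br (annihilator L br action M) \<longleftrightarrow> \<xi> \<in> dual_space L \<and>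
     (\<forall>k. \<forall>t\<in>carrier F. \<forall>t'\<in>carrier F. (\<forall>w\<in>keys t. length w = k) \<longrightarrow> (\<forall>w\<in>keys t'. length w < k) \<longrightarrow>
        (\<forall>m\<in>M. apply_op (ev R (t + t')) m = 0) \<longrightarrow> free_eval \<xi> t = 0)"
  (is "?l \<longleftrightarrow> _ \<and> ?r")
proof (cases "\<xi> \<in> dual_space L")
  case \<xi>: True
  interpret ring_hom_ring F "sym_algebra L" "sym_class L" by (rule class_hom)
  let ?gr = "gr_component L br (annihilator L br action M)"
  have "?l" if "?r"
  proof -
    let ?Z = "{sym_class L t | t. t \<in> carrier F \<and> free_eval \<xi> t = 0}"
    have Z: "s \<in> ?Z" if "s \<in> ?gr k" for s k
      using that \<open>?r\<close> unfolding gr_component_annihilator by blast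
    have Z_carrier: "?Z \<subseteq> carrier (sym_algebra L)" by auto
    have Z_add: "x \<oplus>\<^bsub>sym_algebra L\<^esub> y \<in> ?Z" if xy: "x \<in> ?Z" "y \<in> ?Z" for x y
    proof -
      obtain s t where st: "s \<in> carrier F" "free_eval \<xi> s = 0" "x = sym_class L s"
        "t \<in> carrier F" "free_eval \<xi> t = 0" "y = sym_class L t" using xy by blast
      have "scal (free_eval \<xi> (s + t)) = (scal (free_eval \<xi> s + free_eval \<xi> t) :: (unit, 'a) linop)"
        unfolding scal_simps ev_scal[symmetric] ev_linear ..
      then have "free_eval \<xi> (s + t) = 0" using st by simp
      moreover have "x \<oplus>\<^bsub>sym_algebra L\<^esub> y = sym_class L (s + t)"
        using st by (simp add: free_add flip: hom_add)
      ultimately show ?thesis using st free_carrier_closed(1) by blast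
    qed
    have fin: "finsum (sym_algebra L) s {..d} \<in> ?Z" if "\<And>k. k \<le> d \<Longrightarrow> s k \<in> ?Z" for s and d :: nat
      using that
    proof (induction d)
      case 0
      then show ?case using Z_carrier by (subst S.finsum_0) auto
    next
      case (Suc d)
      have "s \<in> {..Suc d} \<rightarrow> carrier (sym_algebra L)" using Suc.prems Z_carrier by blast
      then have "finsum (sym_algebra L) s {..Suc d} =
          s (Suc d) \<oplus>\<^bsub>sym_algebra L\<^esub> finsum (sym_algebra L) s {..d}"
        by (rule S.finsum_Suc)
      moreover have "s (Suc d) \<oplus>\<^bsub>sym_algebra L\<^esub> finsum (sym_algebra L) s {..d} \<in> ?Z"
        by (rule Z_add[OF Suc.prems[OF order_refl] Suc.IH[OF Suc.prems]]) simp
      ultimately show ?case by (simp only:)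
    qed
    have "sym_eval \<xi> f = 0" if f: "f \<in> gr_ideal L br (annihilator L br action M)" for f
    proof -
      have "f \<in> ?Z" using f fin Z unfolding gr_ideal_def by blast
      then show ?thesis using sym_eval_class[OF \<xi>] by auto
    qed
    then show ?thesis using \<xi> by (simp add: assoc_variety_def)
  qed
  moreover have "?r" if "?l"
  proof (intro allI ballI impI)
    fix k t t' assume t: "t \<in> carrier F" "t' \<in> carrier F" "\<forall>w\<in>keys t. length w = k"
        "\<forall>w\<in>keys t'. length w < k"
      "\<forall>m\<in>M. apply_op (ev R (t + t')) m = 0"
    have t_gr: "sym_class L t \<in> ?gr k" unfolding gr_component_annihilator using t by blast
    have zero_gr: "\<zero>\<^bsub>sym_algebra L\<^esub> \<in> ?gr j" for j
    proof -
      have "sym_class L 0 \<in> ?gr j" unfolding gr_component_annihilator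
        using free_carrier_closed(6)[of L] by (intro CollectI exI[of _ 0] conjI bexI[of _ 0]) (auto simp:
            ev_linear)
      then show ?thesis using hom_zero by (simp add: free_zero)
    qed
    \<comment> \<open>A single component, seen as an element of the graded ideal with all other components 0.\<close>
    let ?s = "\<lambda>j. if j = k then sym_class L t else \<zero>\<^bsub>sym_algebra L\<^esub>"
    have "finsum (sym_algebra L) ?s {..k} = sym_class L t"
      using S.add.finprod_singleton_swap[of k "{..k}" "\<lambda>_. sym_class L t"] t(1) by simp
    moreover have "finsum (sym_algebra L) ?s {..k} \<in> gr_ideal L br (annihilator L br action M)"
      unfolding gr_ideal_def using t_gr zero_gr by (intro CollectI exI[of _ ?s] exI[of _ k]) auto
    ultimately have "sym_eval \<xi> (sym_class L t) = 0" using \<open>?l\<close> by (simp add: assoc_variety_def)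
    then show "free_eval \<xi> t = 0" using sym_eval_class[OF \<xi>] by simp
  qed
  ultimately show ?thesis using \<xi> by blast
qed (simp add: assoc_variety_def)

end

section \<open>The variety and the rank locus\<close>

lemma lie_representation_act_op:
  "lie_representation sp_inf mat_bracket (act_op v :: 'a::field_char_0 fmat \<Rightarrow> _)"
  by unfold_locales (simp_all add: sp_inf_add sp_inf_scale sp_inf_bracket act_op_linear act_op_bracket)

lemma tensor_act_eq: "tensor_act (sym_act v) weyl_act = (\<lambda>X. apply_op (act_op v X))"
  by (simp add: fun_eq_iff apply_act_op)

text \<open>
  Each letter has degree 2, so words of length less than \<open>k\<close> do not contribute to the symbol of
  degree \<open>2 k\<close>, and words of length \<open>k\<close> contribute the product of the symbols of their letters.
\<close>

lemma has_symbol_ev: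
  fixes R :: "'x \<Rightarrow> ('m, 'a::field_char_0) linop"
  assumes R: "\<And>x. x \<in> L \<Longrightarrow> has_symbol z 2 (R x) (\<mu> x)"
    and t: "t \<in> carrier (free_algebra L)" "\<forall>w\<in>keys t. length w = k"
    and t': "t' \<in> carrier (free_algebra L)" "\<forall>w\<in>keys t'. length w < k"
  shows "has_symbol z (k * 2) (ev R (t + t')) (free_eval \<mu> t)"
proof -
  have w: "has_symbol z (length w * 2) (prod_list (map R w)) (prod_list (map \<mu> w))" if "w \<in> lists L" for w
    using that R by (intro has_symbol_prod_list) auto
  have "has_symbol z (k * 2) (ev R t) (free_eval \<mu> t)"
    unfolding ev_def lin_op_def free_eval_def
  proof (intro has_symbol_sum has_symbol_scal)
    fix u assume "u \<in> keys t"
    then have "u \<in> lists L" "length u = k" using t by (auto simp: free_carrier)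
    then show "has_symbol z (k * 2) (prod_list (map R u)) (prod_list (map \<mu> u))" using w by blast
  qed
  moreover have "has_symbol z (k * 2) (ev R t') (\<Sum>w\<in>keys t'. lookup t' w * 0)"
    unfolding ev_def lin_op_def
  proof (intro has_symbol_sum has_symbol_scal)
    fix u assume u: "u \<in> keys t'"
    then have "u \<in> lists L" "length u * 2 < k * 2" using t' by (auto simp: free_carrier)
    then show "has_symbol z (k * 2) (prod_list (map R u)) 0" using w has_symbol_higher by blast
  qed
  ultimately have "has_symbol z (k * 2) (ev R t + ev R t') (free_eval \<mu> t + (\<Sum>w\<in>keys t'. lookup t' w * 0))"
    by (rule has_symbol_add)
  then show ?thesis by (simp add: ev_linear)
qed


lemma finite_subset_sp:
  assumes "finite A" "A \<subseteq> sp_inf" shows "\<exists>n. A \<subseteq> sp n"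
  using assms
proof (induction A)
  case (insert X A)
  then obtain m n where "A \<subseteq> sp m" "X \<in> sp n" by (auto simp: sp_inf_def)
  then show ?case
    using sp_mono[of m "max m n"] sp_mono[of n "max m n"] by (intro exI[of _ "max m n"]) auto
qed simp

text \<open>
  Only finitely many matrices occur in \<open>t\<close>; on an \<open>sp n\<close> that contains them, \<open>\<xi>\<close> is a point of the
  image of the moment map. The value of \<open>t\<close> at \<open>\<xi>\<close> is therefore the symbol at some \<open>z\<close> of an
  operator that kills the module.
\<close>

lemma rank_le_vanishes:
  fixes \<xi> :: "'a::{alg_closed_field, field_char_0} fmat \<Rightarrow> 'a"
  assumes \<xi>: "\<xi> \<in> sp_inf_rank_le (2 * v + 1)"
    and t: "t \<in> carrier (free_algebra sp_inf)" "\<forall>w\<in>keys t. length w = k"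
    and t': "t' \<in> carrier (free_algebra sp_inf)" "\<forall>w\<in>keys t'. length w < k"
    and zero: "\<And>m. m \<in> module_space v \<Longrightarrow> apply_op (ev (act_op v) (t + t')) m = 0"
  shows "free_eval \<xi> t = 0"
proof -
  have "finite (\<Union>w\<in>keys t. set w)" "(\<Union>w\<in>keys t. set w) \<subseteq> sp_inf" using t(1) by (auto simp: free_carrier)
  then obtain n where n: "(\<Union>w\<in>keys t. set w) \<subseteq> sp n" using finite_subset_sp by blast
  obtain h where h: "\<And>Y. Y \<in> sp n \<Longrightarrow> \<xi> Y = (\<Sum>j<2 * v + 1. omega (h j) (mat_vec Y (h j)))"
    using rank_le_imp_sum_of_squares[OF \<xi>, of n] by blast
  let ?\<mu> = "\<lambda>Y. \<Sum>j<2 * v + 1. omega (h j) (mat_vec Y (h j))"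
  obtain z where z: "preserves z (module_space v)" "\<And>Y. Y \<in> sp_inf \<Longrightarrow> has_symbol z 2 (act_op v Y) (?\<mu> Y)"
    using sum_of_squares_is_symbol[of v h] by blast
  have "has_symbol z (k * 2) (ev (act_op v) (t + t')) (free_eval ?\<mu> t)"
    by (rule has_symbol_ev[OF z(2) t t'])
  then have "free_eval ?\<mu> t = 0"
    by (rule symbol_of_annihilating_operator[OF _ z(1) zero module_space_nonzero])
  moreover have map_eq: "map \<xi> w = map ?\<mu> w" if "w \<in> keys t" for w
    using n h that by (intro map_cong refl) blast
  have "free_eval \<xi> t = free_eval ?\<mu> t"
    unfolding free_eval_def by (intro sum.cong refl) (simp only: map_eq)
  ultimately show ?thesis by simp
qed

lemma symmetric_form_of_functional:
  fixes \<xi> :: "'a::{alg_closed_field, field_char_0} fmat \<Rightarrow> 'a"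
  assumes "\<xi> \<in> dual_space sp_inf"
  shows "symmetric_form_symplectic (\<lambda>u w. \<xi> (sq u w))"
  by unfold_locales (simp_all add: sq_linear sq_in_sp_inf dual_space_linear[OF assms] sq_commute)

text \<open>
  On \<open>V_fin n\<close> the functional \<open>x \<mapsto> \<xi> (sq x (u j))\<close> is \<open>omega (g j)\<close> for some \<open>g j\<close>. Inserting this
  in the expansion of \<open>Y\<close> in elements \<open>sq\<close> gives \<open>\<xi> Y = - (1/2) \<Sum>\<^sub>j omega (g j) (Y (g j))\<close>, and
  the constant is absorbed by a square root \<open>s\<close> of \<open>- (1/2)\<close>.
\<close>

lemma functional_sum_of_squares:
  fixes \<xi> :: "'a::{alg_closed_field, field_char_0} fmat \<Rightarrow> 'a"
  assumes \<xi>: "\<xi> \<in> dual_space sp_inf"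
    and u: "\<And>x y. \<xi> (sq x y) = (\<Sum>j<r. \<xi> (sq x (u j)) * \<xi> (sq y (u j)))"
  shows "\<exists>h. \<forall>Y\<in>sp n. \<xi> Y = (\<Sum>j<r. omega (h j) (mat_vec Y (h j)))"
proof -
  interpret symmetric_form_symplectic "\<lambda>u w. \<xi> (sq u w)"
    by (rule symmetric_form_of_functional[OF \<xi>])
  let ?I = "idx_upto n"
  let ?e = "\<lambda>b. Poly_Mapping.single b 1 :: 'a fvec"
  define g where "g j = (\<Sum>b\<in>?I. scale (\<xi> (sq (?e b) (u j))) (dual_vec b))" for j
  have g: "omega (g j) x = \<xi> (sq x (u j))" if "x \<in> V_fin n" for j x
  proof -
    have x: "x = (\<Sum>b\<in>?I. scale (lookup x b) (?e b))" using that by (intro vec_expand) (auto simp: V_fin_def)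
    have "\<xi> (sq x (u j)) = (\<Sum>b\<in>?I. lookup x b * \<xi> (sq (?e b) (u j)))"
      by (subst x) (simp only: linear)
    then show ?thesis by (simp add: g_def omega_linear omega_dual_vec mult.commute)
  qed
  have dual_in: "dual_vec b \<in> V_fin n" if "b \<in> ?I" for b using that by (simp add: V_fin_def dual_vec_def)
  have g_in: "g j \<in> V_fin n" for j
    unfolding g_def by (intro vs.subspace_sum vs.subspace_scale V_fin_subspace dual_in)
  obtain s :: 'a where s: "s ^ 2 = - (1/2)" using nth_root_exists[of 2] by (metis zero_less_numeral)
  have "\<xi> Y = (\<Sum>j<r. omega (scale s (g j)) (mat_vec Y (scale s (g j))))" if Y: "Y \<in> sp n" for Y
  proof -
    let ?Y = "mat_vec Y"
    have Y_in: "?Y x \<in> V_fin n" for x using keys_mat_vec[OF sp_keys[OF Y]] by (simp add: V_fin_def)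
    have \<xi>_sum: "(\<Sum>b\<in>A. scale c (sq (f b) (f' b))) \<in> sp_inf \<and> \<xi> (\<Sum>b\<in>A. scale c (sq (f b) (f' b))) =
        c * (\<Sum>b\<in>A. \<xi> (sq (f b) (f' b)))"
      if "finite A" for A :: "idx set" and f f' c
      using that
    proof (induction A)
      case empty
      have "(0 :: 'a fmat) = scale 0 (sq 0 0)" by simp
      then show ?case using dual_space_linear(2)[OF \<xi> sq_in_sp_inf, of 0 0 0] sp_inf_scale[OF
          sq_in_sp_inf, of 0 0 0] by simp
    next
      case (insert b A)
      then show ?case
        by (simp add: dual_space_linear[OF \<xi>] sq_in_sp_inf sp_inf_scale sp_inf_add distrib_left)
    qed
    have "\<xi> Y = 1/2 * (\<Sum>b\<in>?I. \<xi> (sq (?Y (?e b)) (dual_vec b)))"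
      using sp_expand[OF Y] \<xi>_sum[OF finite_idx_upto, of "1/2" "\<lambda>b. ?Y (?e b)" dual_vec n] by simp
    also have "(\<Sum>b\<in>?I. \<xi> (sq (?Y (?e b)) (dual_vec b))) =
        (\<Sum>b\<in>?I. \<Sum>j<r. omega (g j) (?Y (?e b)) * - lookup (g j) b)"
    proof (intro sum.cong refl)
      fix b assume b: "b \<in> ?I"
      have "omega (g j) (dual_vec b) = - lookup (g j) b" for j
        using omega_antisym[of "g j" "dual_vec b"] by (simp add: omega_dual_vec)
      then show "\<xi> (sq (?Y (?e b)) (dual_vec b)) = (\<Sum>j<r. omega (g j) (?Y (?e b)) * - lookup (g j) b)"
        by (subst u) (simp add: g[OF Y_in, symmetric] g[OF dual_in[OF b], symmetric])
    qed
    also have "\<dots> = (\<Sum>j<r. - omega (g j) (\<Sum>b\<in>?I. scale (lookup (g j) b) (?Y (?e b))))"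
      by (subst sum.swap) (simp add: omega_linear sum_negf mult.commute)
    also have "\<dots> = (\<Sum>j<r. - omega (g j) (?Y (g j)))"
      using g_in mat_vec_expand[OF finite_idx_upto, of "g _" n Y] by (simp add: V_fin_def)
    also have "1/2 * \<dots> = (\<Sum>j<r. s ^ 2 * omega (g j) (?Y (g j)))"
      by (simp add: s sum_distrib_left)
    finally show ?thesis by (simp add: omega_linear mat_vec_linear power2_eq_square mult.assoc)
  qed
  then show ?thesis by (intro exI[of _ "\<lambda>j. scale s (g j)"] ballI)
qed

lemma free_eval_linear:
  "free_eval \<xi> (s + t) = free_eval \<xi> s + free_eval \<xi> t" "free_eval \<xi> (scale c t) = c * free_eval \<xi> t"
      "free_eval \<xi> 0 = 0"
proof -
  have "(scal (free_eval \<xi> (s + t)) :: (unit, 'a) linop) = scal (free_eval \<xi> s + free_eval \<xi> t)"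
    "(scal (free_eval \<xi> (scale c t)) :: (unit, 'a) linop) = scal (c * free_eval \<xi> t)"
    unfolding scal_simps by (simp_all add: ev_linear flip: ev_scal)
  then show "free_eval \<xi> (s + t) = free_eval \<xi> s + free_eval \<xi> t" "free_eval \<xi> (scale c t) =
      c * free_eval \<xi> t" by simp_all
qed (simp add: free_eval_def)

lemma free_eval_sum: "free_eval \<xi> (sum f A) = (\<Sum>a\<in>A. free_eval \<xi> (f a))"
  by (induction A rule: infinite_finite_induct) (auto simp: free_eval_linear)

lemma ev_sum: "ev R (sum f A) = (\<Sum>a\<in>A. ev R (f a))"
  by (induction A rule: infinite_finite_induct) (auto simp: ev_linear)

lemma keys_sum_subset: "(\<And>a. a \<in> A \<Longrightarrow> keys (f a) \<subseteq> B) \<Longrightarrow> keys (sum f A) \<subseteq> B"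
proof (induction A rule: infinite_finite_induct)
  case (insert a A)
  then show ?case using Poly_Mapping.keys_add[of "f a" "sum f A"] by fastforce
qed simp_all

text \<open>
  If the form \<open>\<xi> (sq u w)\<close> is not a sum of \<open>2 v + 1\<close> squares, there is an isotropic system of \<open>2 v
  + 2\<close> vectors that is orthonormal for it. The determinant of the elements \<open>sq (u i) (u j)\<close>, as a
  homogeneous tensor, annihilates the module, while its value at \<open>\<xi>\<close> is the determinant of the
  identity matrix.
\<close>

lemma variety_imp_rank_le:
  fixes \<xi> :: "'a::{alg_closed_field, field_char_0} fmat \<Rightarrow> 'a"
  assumes \<xi>: "\<xi> \<in> dual_space sp_inf"
    and van: "\<And>k t. t \<in> carrier (free_algebra sp_inf) \<Longrightarrow> \<forall>w\<in>keys t. length w = k \<Longrightarrow> ev (act_op v) t = 0 \<Longrightarrow>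
        free_eval \<xi> t = 0"
  shows "\<xi> \<in> sp_inf_rank_le (2 * v + 1)"
proof -
  interpret symmetric_form_symplectic "\<lambda>u w. \<xi> (sq u w)"
    by (rule symmetric_form_of_functional[OF \<xi>])
  define r where "r = Suc (2 * v + 1)"
  have no: "\<not> (orthonormal r u \<and> isotropic r u)" for u
  proof
    assume "orthonormal r u \<and> isotropic r u"
    then have on: "\<And>i j. i < r \<Longrightarrow> j < r \<Longrightarrow> \<xi> (sq (u i) (u j)) = (if i = j then 1 else 0)"
      and iso: "\<And>i j. i < r \<Longrightarrow> j < r \<Longrightarrow> omega (u i) (u j) = 0"
      unfolding orthonormal_def isotropic_def by blast+
    let ?w = "\<lambda>\<pi>. map (\<lambda>i. sq (u i) (u (\<pi> i))) [0..<r]"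
    let ?P = "{\<pi>. \<pi> permutes {..<r}}"
    define t where "t = (\<Sum>\<pi>\<in>?P. scale (of_int (sign \<pi>)) (Poly_Mapping.single (?w \<pi>) (1::'a)))"
    have keys: "keys t \<subseteq> ?w ` ?P" unfolding t_def by (rule keys_sum_subset) auto
    have "t \<in> carrier (free_algebra sp_inf)" using keys sq_in_sp_inf unfolding free_carrier by fastforce
    moreover have "\<forall>w\<in>keys t. length w = r" using keys by auto
    moreover have "ev (act_op v) t = 0"
    proof -
      have "ev (act_op v) t = (\<Sum>\<pi>\<in>?P. scal (of_int (sign \<pi>)) * prod_list (map (act_op v) (?w \<pi>)))"
        unfolding t_def ev_sum ev_linear by (simp only: ev_def lin_op_single scal_simps mult_1_left)
      also have "\<dots> = 0" by (rule isotropic_minor_acts_zero[OF iso]) (simp_all add: r_def)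
      finally show ?thesis .
    qed
    ultimately have "free_eval \<xi> t = 0" by (rule van)
    have w: "free_eval \<xi> (Poly_Mapping.single (?w \<pi>) 1) = (if \<pi> = id then 1 else 0)" if \<pi>: "\<pi> \<in> ?P" for \<pi>
    proof -
      have "free_eval \<xi> (Poly_Mapping.single (?w \<pi>) 1) =
          prod_list (map (\<lambda>i. \<xi> (sq (u i) (u (\<pi> i)))) [0..<r])"
        by (simp only: free_eval_def) (simp add: comp_def)
      also have "\<dots> = (\<Prod>i<r. \<xi> (sq (u i) (u (\<pi> i))))"
        by (simp only: prod.distinct_set_conv_list[OF distinct_upt, symmetric] set_upt atLeast0LessThan)
      also have "\<dots> = (\<Prod>i<r. if \<pi> i = i then 1 else 0)"
      proof (intro prod.cong refl)
        fix i assume "i \<in> {..<r}"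
        then show "\<xi> (sq (u i) (u (\<pi> i))) = (if \<pi> i = i then 1 else 0)"
          using on[of i "\<pi> i"] permutes_in_image[of \<pi> "{..<r}" i] \<pi> by auto
      qed
      also have "\<dots> = (if \<pi> = id then 1 else 0)"
      proof (cases "\<pi> = id")
        case False
        then obtain i where i: "\<pi> i \<noteq> i" by (auto simp: fun_eq_iff)
        then have "i \<in> {..<r}" using \<pi> permutes_not_in[of \<pi> "{..<r}" i] by auto
        with i have "(\<Prod>i<r. if \<pi> i = i then 1 else (0::'a)) = 0" by (intro prod_zero) auto
        with False show ?thesis by simp
      qed simp
      finally show ?thesis .
    qed
    have "free_eval \<xi> t = (\<Sum>\<pi>\<in>?P. of_int (sign \<pi>) * (if \<pi> = id then 1 else 0))"
      unfolding t_def free_eval_sum free_eval_linear by (intro sum.cong refl) (simp only: w)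
    also have "\<dots> = (\<Sum>\<pi>\<in>?P. if \<pi> = id then 1 else 0)" by (intro sum.cong) (auto simp: sign_id)
    also have "\<dots> = 1" using finite_permutations[of "{..<r}"] permutes_id[of "{..<r}"] by simp
    finally show False using \<open>free_eval \<xi> t = 0\<close> by simp
  qed
  then obtain u where "sum_of_squares (2 * v + 1) u"
      using isotropic_orthonormal_or_sum_of_squares[of "2 * v + 1"]
    unfolding r_def by blast
  then have "\<xi> (sq x y) = (\<Sum>j<2 * v + 1. \<xi> (sq x (u j)) * \<xi> (sq y (u j)))" for x y
    unfolding sum_of_squares_def by blast
  then show ?thesis
    by (intro sum_of_squares_imp_rank_le[OF \<xi>] functional_sum_of_squares[OF \<xi>])
qed

theorem proposition8p3:
  fixes v :: nat
  shows "assoc_variety sp_inf mat_bracket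
           (annihilator sp_inf mat_bracket (tensor_act (sym_act v) weyl_act)
             (tensor_space (sym_module v) UNIV))
         = (sp_inf_rank_le (2 * v + 1) ::
             ('a::{alg_closed_field, field_char_0} fmat \<Rightarrow> 'a) set)"
proof -
  interpret lie_representation sp_inf mat_bracket "act_op v :: 'a fmat \<Rightarrow> _"
    by (rule lie_representation_act_op)
  show ?thesis
    unfolding tensor_act_eq
  proof (intro Set.set_eqI iffI)
    fix \<xi> :: "'a fmat \<Rightarrow> 'a"
    assume "\<xi> \<in> assoc_variety sp_inf mat_bracket (annihilator sp_inf mat_bracket action (module_space v))"
    then have \<xi>: "\<xi> \<in> dual_space sp_inf"
      and van: "\<And>k t t'. t \<in> carrier F \<Longrightarrow> t' \<in> carrier F \<Longrightarrow> \<forall>w\<in>keys t. length w = k \<Longrightarrow> \<forall>w\<in>keys t'. length w < k \<Longrightarrow>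
        \<forall>m\<in>module_space v. apply_op (ev (act_op v) (t + t')) m = 0 \<Longrightarrow> free_eval \<xi> t = 0"
      unfolding assoc_variety_annihilator by blast+
    show "\<xi> \<in> sp_inf_rank_le (2 * v + 1)"
    proof (rule variety_imp_rank_le[OF \<xi>])
      fix k t
      assume "t \<in> carrier F" "\<forall>w\<in>keys t. length w = k" "ev (act_op v) t = 0"
      then show "free_eval \<xi> t = 0" by (intro van[of t 0 k]) (auto simp: free_carrier)
    qed
  next
    fix \<xi> :: "'a fmat \<Rightarrow> 'a"
    assume \<xi>: "\<xi> \<in> sp_inf_rank_le (2 * v + 1)"
    then have "\<xi> \<in> dual_space sp_inf" by (simp add: sp_inf_rank_le_def)
    then show "\<xi> \<in> assoc_variety sp_inf mat_bracket (annihilator sp_inf mat_bracket action (module_space v))"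
      unfolding assoc_variety_annihilator
    proof (intro conjI allI ballI impI)
      fix k t t'
      assume "t \<in> carrier F" "t' \<in> carrier F" "\<forall>w\<in>keys t. length w = k" "\<forall>w\<in>keys t'. length w < k"
        and "\<forall>m\<in>module_space v. apply_op (ev (act_op v) (t + t')) m = 0"
      then show "free_eval \<xi> t = 0" using rank_le_vanishes[OF \<xi>] by blast
    qed
  qed
qed

end
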